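(* For every $\varepsilon>0$ there exist constants $C>0$ and $n_0\in\mathbf{N}$ such that the following holds for every integer $n\ge n_0$. Let $X,Y,Z\subset A_n$ be subsets of densities $\alpha=|X|/|A_n|$, $\beta=|Y|/|A_n|$, $\gamma=|Z|/|A_n|$, and suppose that $$\min(\alpha\beta,\alpha\gamma,\beta\gamma)\ \ge\ C\,\frac{(\log n)^7}{n}.$$ Then $$\langle 1_X*1_Y,1_Z\rangle\ \ge\ (1-\varepsilon)\,\alpha\beta\gamma .$$ (In asymptotic notation, as $n\to\infty$: if $\min(\alpha\beta,\alpha\gamma,\beta\gamma)\gg (\log n)^7/n$ then $\langle 1_X*1_Y,1_Z\rangle\ge(1+o(1))\alpha\beta\gamma$, where $U\gg V$ means $V=o(U)$.)
   Context: $A_n$ is the alternating group on $\{1,\dots,n\}$, equipped with the uniform probability measure. Convolution and inner product are taken with respect to this measure: $(f*g)(x)=\frac{1}{|A_n|}\sum_{y\in A_n} f(y)g(y^{-1}x)$ and $\langle f,g\rangle=\frac1{|A_n|}\sum_{x\in A_n} f(x)\overline{g(x)}$. $1_X$ denotes the indicator function of $X$. Thus $\langle 1_X*1_Y,1_Z\rangle=|A_n|^{-2}\cdot\#\{(x,y,z)\in X\times Y\times Z: xy=z\}$. $\log$ is the natural logarithm. *)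

theory Defs
  imports Complex_Main "HOL-Algebra.Sym_Groups" "HOL-Library.Indicator_Function"
    "HOL-Library.Complex_Order"
begin

definition set_density :: "('a, 'b) monoid_scheme \<Rightarrow> 'a set \<Rightarrow> real"
  where "set_density G X = real (card X) / real (order G)"

text \<open>
  Convolution and inner product are normalised by the uniform probability measure on \<open>G\<close>.
  Only values of the functions on the carrier of \<open>G\<close> matter.
\<close>

definition group_convolution ::
    "('a, 'b) monoid_scheme \<Rightarrow> ('a \<Rightarrow> complex) \<Rightarrow> ('a \<Rightarrow> complex) \<Rightarrow> 'a \<Rightarrow> complex"
  where "group_convolution G f g x =
    (1 / of_nat (order G)) * (\<Sum>y\<in>carrier G. f y * g (inv\<^bsub>G\<^esub> y \<otimes>\<^bsub>G\<^esub> x))"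

definition group_inner_prod ::
    "('a, 'b) monoid_scheme \<Rightarrow> ('a \<Rightarrow> complex) \<Rightarrow> ('a \<Rightarrow> complex) \<Rightarrow> complex"
  where "group_inner_prod G f g =
    (1 / of_nat (order G)) * (\<Sum>x\<in>carrier G. f x * cnj (g x))"

text \<open>
  For indicators the inner product is a nonnegative real. The lower bound on it is stated
  with the order on \<open>complex\<close> of \<open>Complex_Order\<close> (comparable numbers have equal imaginary parts).
\<close>

lemma group_inner_prod_convolution_indicator:
  assumes "group G" "finite (carrier G)"
    and "X \<subseteq> carrier G" "Y \<subseteq> carrier G" "Z \<subseteq> carrier G"
  shows "group_inner_prod G (group_convolution G (indicator X) (indicator Y)) (indicator Z) =
    of_nat (card {(x, y, z). x \<in> X \<and> y \<in> Y \<and> z \<in> Z \<and> x \<otimes>\<^bsub>G\<^esub> y = z}) / (of_nat (order G))\<^sup>2"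
proof -
  interpret group G by fact
  define S where "S = {(z, x). z \<in> Z \<and> x \<in> X \<and> inv\<^bsub>G\<^esub> x \<otimes>\<^bsub>G\<^esub> z \<in> Y}"
  have S: "S \<subseteq> carrier G \<times> carrier G"
    using assms unfolding S_def by auto
  have "(\<Sum>z\<in>carrier G. (\<Sum>x\<in>carrier G. indicator X x * indicator Y (inv\<^bsub>G\<^esub> x \<otimes>\<^bsub>G\<^esub> z)) *
      cnj (indicator Z z)) = (\<Sum>z\<in>carrier G. \<Sum>x\<in>carrier G. (indicator S (z, x) :: complex))"
    unfolding sum_distrib_right by (intro sum.cong) (auto simp: S_def indicator_def)
  also have "\<dots> = (\<Sum>p\<in>carrier G \<times> carrier G. indicator S p)"
    by (simp add: sum.cartesian_product)
  also have "\<dots> = of_nat (card S)"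
    using S assms(2) by (simp add: indicator_def of_bool_def sum.If_cases Int_absorb1)
  also have "card S = card {(x, y, z). x \<in> X \<and> y \<in> Y \<and> z \<in> Z \<and> x \<otimes>\<^bsub>G\<^esub> y = z}"
  proof (rule bij_betw_same_card)
    show "bij_betw (\<lambda>(z, x). (x, inv\<^bsub>G\<^esub> x \<otimes>\<^bsub>G\<^esub> z, z)) S
        {(x, y, z). x \<in> X \<and> y \<in> Y \<and> z \<in> Z \<and> x \<otimes>\<^bsub>G\<^esub> y = z}"
      by (rule bij_betw_byWitness[where f' = "\<lambda>(x, y, z). (z, x)"])
        (use assms in \<open>auto simp: S_def m_assoc[symmetric] subset_iff\<close>)
  qed
  finally show ?thesis
    unfolding group_inner_prod_def group_convolution_def
    by (simp add: sum_divide_distrib[symmetric] power2_eq_square)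
qed

end

theory Submission
  imports Defs "HOL-Analysis.Function_Topology" "HOL-Analysis.Convex"
begin

text \<open>
  Write \<open>1\<^sub>X\<close> as the sum of its orthogonal projection to the span of the functions
  \<open>x \<mapsto> [x j = i]\<close> (the trivial and the standard part of \<open>L\<^sup>2(A\<^sub>n)\<close>) and of a rest. Both
  contributions to \<open>\<langle>1\<^sub>X * 1\<^sub>Y, 1\<^sub>Z\<rangle>\<close> are estimated separately.

  The rest. Convolution by the rest is an operator on \<open>L\<^sup>2(A\<^sub>n)\<close> that commutes with right
  translations and annihilates all functions \<open>[x j = i]\<close>. Its top singular space is therefore a
  right-invariant space orthogonal to these functions, and the squared operator norm is at most the
  squared Hilbert--Schmidt norm, which is at most \<open>\<alpha>\<close>, divided by the dimension of that space.
  The dimension is of order \<open>n\<^sup>2\<close>, for the following elementary reason. If every function of the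
  space satisfied \<open>(1 - a) (1 - a') g = 0\<close> for all disjoint double transpositions \<open>a\<close> and \<open>a'\<close>,
  then sums of \<open>g\<close> over the permutations with one prescribed value being zero would force the
  same for two, three and four prescribed values, and then \<open>g = 0\<close>
  (\<open>second_difference_free_vanishes\<close>). So some function is negated by the double transpositions of
  two blocks of four points; it can be made invariant under one double transposition in each of the
  other blocks, and moving the two special blocks around yields \<open>\<lfloor>n/8\<rfloor>\<^sup>2\<close> orthogonal functions
  (\<open>many_orthogonal_vectors\<close>). The rest thus contributes at most \<open>\<surd>(\<alpha>\<beta>\<gamma>) / \<lfloor>n/8\<rfloor>\<close>, which is
  small compared with \<open>\<alpha>\<beta>\<gamma>\<close> as soon as \<open>\<alpha>\<beta>\<gamma>\<close> is at least a large multiple of \<open>1/n\<^sup>2\<close>.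

  The linear part. It contributes \<open>\<alpha>\<beta>\<gamma> + (n - 1) \<Sum>\<^bsub>i,j,k\<^esub> D\<^sub>X(i,j) D\<^sub>Y(j,k) D\<^sub>Z(i,k)\<close>, where
  \<open>D\<^sub>X(i,j)\<close> is the probability that \<open>x \<in> X\<close> and \<open>x j = i\<close>, minus its average \<open>\<alpha>/n\<close>. Bessel's
  inequality bounds the Hilbert--Schmidt norm of \<open>D\<^sub>X\<close> by \<open>\<surd>(\<alpha>/(n - 1))\<close>, which would not be enough
  for all three matrices. But a lower bound is wanted, and a product of three reals is negative only
  if one of the factors is. So in each negative term one matrix may be replaced by its negative part,
  and that is much smaller (\<open>negative_deviation_bound\<close>): a large negative part means that a statistic
  \<open>\<Sum>\<^sub>i a(i, \<pi> i)\<close> with weights in \<open>[0,1]\<close> is on average over \<open>X\<close> far below its mean, and by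
  concentration of such statistics (\<open>perm_stat_mean_deficit\<close>) only a set of small density can do
  that. The squared norm of the negative part is at most \<open>32 \<alpha>\<^sup>2 ln(2/\<alpha>) / n\<close>, and the resulting
  relative error \<open>\<surd>(32 ln(2/\<alpha>) / (n \<beta> \<gamma>))\<close> is small once \<open>\<beta>\<gamma>\<close> is at least a large multiple of
  \<open>ln n / n\<close>.
\<close>

section \<open>Multiplicity and the top singular value of a matrix\<close>

text \<open>
  A maximiser \<open>g\<close> of \<open>\<parallel>K u\<parallel>\<^sup>2\<close> on the unit sphere, which is compact, satisfies
  \<open>K\<^sup>T K g = s g\<close> with \<open>s = \<parallel>K\<parallel>\<^sup>2\<close> by first-order optimality.
\<close>

lemma top_singular_vector:
  fixes K :: "'a \<Rightarrow> 'a \<Rightarrow> real"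
  assumes "finite A" "A \<noteq> {}"
  obtains s g where
    "\<And>u. (\<Sum>x\<in>A. (\<Sum>y\<in>A. K x y * u y)\<^sup>2) \<le> s * (\<Sum>y\<in>A. (u y)\<^sup>2)"
    "\<And>y. y \<in> A \<Longrightarrow> (\<Sum>x\<in>A. K x y * (\<Sum>z\<in>A. K x z * g z)) = s * g y"
    "(\<Sum>y\<in>A. (g y)\<^sup>2) = 1"
proof -
  define q where "q u = (\<Sum>x\<in>A. (\<Sum>y\<in>A. K x y * u y)\<^sup>2)" for u
  define B where "B = PiE UNIV (\<lambda>y. if y \<in> A then {-1..1::real} else {0})"
  define S where "S = B \<inter> {u. (\<Sum>y\<in>A. (u y)\<^sup>2) = 1}"
  have "compactin (product_topology (\<lambda>i. euclidean) UNIV) B"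
    unfolding B_def compactin_PiE by auto
  then have "compact B"
    by (simp add: euclidean_product_topology)
  moreover have "closed {u :: 'a \<Rightarrow> real. (\<Sum>y\<in>A. (u y)\<^sup>2) = 1}"
    by (intro closed_Collect_eq continuous_intros continuous_on_product_then_coordinatewise[OF continuous_on_id])
  ultimately have cS: "compact S"
    unfolding S_def by (rule compact_Int_closed)
  obtain a where a: "a \<in> A" using assms by auto
  have "(\<lambda>y. if y = a then 1 else 0) \<in> S"
    using a assms(1) by (auto simp: S_def B_def if_distrib[of "\<lambda>x. x\<^sup>2"] sum.delta cong: if_cong)
  then have nS: "S \<noteq> {}" by auto
  have cq: "continuous_on S q"
    unfolding q_def
    by (intro continuous_intros continuous_on_product_then_coordinatewise[OF continuous_on_id])
  obtain g where g: "g \<in> S" and gmax: "\<And>u. u \<in> S \<Longrightarrow> q u \<le> q g"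
    using continuous_attains_sup[OF cS nS cq] by auto
  have g1: "(\<Sum>y\<in>A. (g y)\<^sup>2) = 1" using g by (simp add: S_def)
  define s where "s = q g"
  have bound: "q u \<le> s * (\<Sum>y\<in>A. (u y)\<^sup>2)" for u
  proof (cases "(\<Sum>y\<in>A. (u y)\<^sup>2) = 0")
    case True
    then have "\<forall>y\<in>A. u y = 0" using assms(1) by (simp add: sum_nonneg_eq_0_iff)
    then show ?thesis using True by (simp add: q_def)
  next
    case False
    define r where "r = (\<Sum>y\<in>A. (u y)\<^sup>2)"
    have r: "r > 0" using False unfolding r_def by (simp add: order_less_le sum_nonneg)
    define w where "w y = (if y \<in> A then u y / sqrt r else 0)" for y
    have w1: "(\<Sum>y\<in>A. (w y)\<^sup>2) = 1"
      using r by (simp add: w_def power_divide sum_divide_distrib[symmetric] r_def[symmetric])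
    have "\<bar>w y\<bar> \<le> 1" if "y \<in> A" for y
    proof -
      have "(w y)\<^sup>2 \<le> (\<Sum>y\<in>A. (w y)\<^sup>2)"
        using that assms(1) by (intro member_le_sum) auto
      then show ?thesis using w1 by (simp add: abs_square_le_1)
    qed
    then have wb: "- 1 \<le> w y" "w y \<le> 1" if "y \<in> A" for y
      using that by (auto simp: abs_le_iff)
    have "w \<in> S"
      unfolding S_def B_def using w1 by (auto simp: wb) (auto simp: w_def)
    then have "q w \<le> s" using gmax by (simp add: s_def)
    moreover have "q w = q u / r"
    proof -
      have "(\<Sum>y\<in>A. K x y * w y) = (\<Sum>y\<in>A. K x y * u y) / sqrt r" for x
        by (simp add: w_def sum_divide_distrib)
      then have "q w = (\<Sum>x\<in>A. (\<Sum>y\<in>A. K x y * u y)\<^sup>2 / r)"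
        using r by (simp only: q_def power_divide) simp
      then show ?thesis by (simp add: q_def sum_divide_distrib)
    qed
    ultimately show ?thesis using r by (simp add: field_simps r_def)
  qed
  have eig: "(\<Sum>x\<in>A. K x y * (\<Sum>z\<in>A. K x z * g z)) = s * g y" if y: "y \<in> A" for y
  proof -
    \<comment> \<open>First-order optimality of \<open>g\<close> in the direction of the point mass at \<open>y\<close>: the quadratic
      polynomial \<open>p + q t + r t\<^sup>2\<close> below is nonnegative and vanishes at \<open>0\<close>.\<close>
    define b where "b = (\<Sum>x\<in>A. K x y * (\<Sum>z\<in>A. K x z * g z)) - s * g y"
    define c where "c = s - (\<Sum>x\<in>A. (K x y)\<^sup>2)"
    have *: "0 \<le> c * t\<^sup>2 - 2 * b * t" for t
    proof -
      define u where "u z = g z + (if z = y then t else 0)" for z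
      have Ku: "(\<Sum>z\<in>A. K x z * u z) = (\<Sum>z\<in>A. K x z * g z) + t * K x y" for x
        using y assms(1)
        by (simp add: u_def distrib_left sum.distrib if_distrib[of "(*) _"] sum.delta cong: if_cong)
      have "q u = q g + 2 * t * (\<Sum>x\<in>A. K x y * (\<Sum>z\<in>A. K x z * g z)) + t\<^sup>2 * (\<Sum>x\<in>A. (K x y)\<^sup>2)"
        unfolding q_def Ku power2_sum sum.distrib
        by (simp add: sum_distrib_left power_mult_distrib algebra_simps)
      moreover have "(\<Sum>z\<in>A. (u z)\<^sup>2) = 1 + 2 * t * g y + t\<^sup>2"
        using y assms(1) g1
        by (simp add: u_def power2_sum sum.distrib if_distrib[of "(*) _"] if_distrib[of "\<lambda>x. x\<^sup>2"] sum.delta mult_ac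
            cong: if_cong)
      ultimately show ?thesis
        using bound[of u] by (simp add: s_def b_def c_def algebra_simps)
    qed
    have "b = 0"
    proof (rule ccontr)
      assume b: "b \<noteq> 0"
      define d where "d = \<bar>c\<bar> + 1"
      have d: "d > 0" "c < d" by (auto simp: d_def)
      have "0 \<le> c * (b / d)\<^sup>2 - 2 * b * (b / d)" using * .
      also have "c * (b / d)\<^sup>2 \<le> d * (b / d)\<^sup>2" using d by (intro mult_right_mono) auto
      also have "d * (b / d)\<^sup>2 - 2 * b * (b / d) = - (b\<^sup>2 / d)"
        using d by (simp add: field_simps power2_eq_square)
      also have "\<dots> < 0" using b d by simp
      finally show False by simp
    qed
    then show ?thesis by (simp add: b_def)
  qed
  show thesis
    using that[OF bound[unfolded q_def] eig g1] .
qed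

lemma bessel_sum:
  fixes c :: "'a \<Rightarrow> real" and e :: "'i \<Rightarrow> 'a \<Rightarrow> real"
  assumes "finite A" "finite I"
    and nz: "\<And>i. i \<in> I \<Longrightarrow> (\<Sum>y\<in>A. (e i y)\<^sup>2) = 1"
    and orth: "\<And>i j. i \<in> I \<Longrightarrow> j \<in> I \<Longrightarrow> i \<noteq> j \<Longrightarrow> (\<Sum>y\<in>A. e i y * e j y) = 0"
  shows "(\<Sum>i\<in>I. (\<Sum>y\<in>A. c y * e i y)\<^sup>2) \<le> (\<Sum>y\<in>A. (c y)\<^sup>2)"
proof -
  define k where "k i = (\<Sum>y\<in>A. c y * e i y)" for i
  have pair: "(\<Sum>y\<in>A. e i y * e j y) = (if i = j then 1 else 0)" if "i \<in> I" "j \<in> I" for i j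
    using nz orth that by (simp add: power2_eq_square)
  have cross: "(\<Sum>y\<in>A. c y * (\<Sum>i\<in>I. k i * e i y)) = (\<Sum>i\<in>I. (k i)\<^sup>2)"
  proof -
    have "(\<Sum>y\<in>A. c y * (\<Sum>i\<in>I. k i * e i y)) = (\<Sum>i\<in>I. \<Sum>y\<in>A. k i * (c y * e i y))"
      by (subst sum.swap) (simp add: sum_distrib_left mult_ac)
    then show ?thesis by (simp add: sum_distrib_left[symmetric] k_def power2_eq_square)
  qed
  have sq: "(\<Sum>y\<in>A. (\<Sum>i\<in>I. k i * e i y)\<^sup>2) = (\<Sum>i\<in>I. (k i)\<^sup>2)"
  proof -
    have "(\<Sum>y\<in>A. (\<Sum>i\<in>I. k i * e i y)\<^sup>2) = (\<Sum>y\<in>A. \<Sum>i\<in>I. \<Sum>j\<in>I. k i * k j * (e i y * e j y))"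
      by (simp add: power2_eq_square sum_product mult_ac)
    also have "\<dots> = (\<Sum>i\<in>I. \<Sum>j\<in>I. \<Sum>y\<in>A. k i * k j * (e i y * e j y))"
      by (subst sum.swap, intro sum.cong refl, subst sum.swap) simp
    also have "\<dots> = (\<Sum>i\<in>I. \<Sum>j\<in>I. k i * k j * (if i = j then 1 else 0))"
      by (intro sum.cong refl) (simp add: sum_distrib_left[symmetric] pair)
    also have "\<dots> = (\<Sum>i\<in>I. (k i)\<^sup>2)"
      using assms(2) by (simp add: if_distrib[of "(*) _"] sum.delta power2_eq_square cong: if_cong)
    finally show ?thesis .
  qed
  have "0 \<le> (\<Sum>y\<in>A. (c y - (\<Sum>i\<in>I. k i * e i y))\<^sup>2)" by (simp add: sum_nonneg)
  also have "\<dots> = (\<Sum>y\<in>A. (c y)\<^sup>2) - 2 * (\<Sum>y\<in>A. c y * (\<Sum>i\<in>I. k i * e i y))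
      + (\<Sum>y\<in>A. (\<Sum>i\<in>I. k i * e i y)\<^sup>2)"
    by (simp add: power2_diff sum.distrib sum_subtractf sum_distrib_left mult_ac)
  finally show ?thesis using cross sq by (simp add: k_def)
qed

text \<open>
  Each unit vector of the eigenspace contributes \<open>s\<close> to the squared Hilbert--Schmidt norm of
  \<open>K\<close>, so a large eigenspace makes the operator norm small compared with that norm.
\<close>

lemma eigenspace_multiplicity_bound:
  fixes K :: "'a \<Rightarrow> 'a \<Rightarrow> real" and e :: "'i \<Rightarrow> 'a \<Rightarrow> real"
  assumes fin: "finite A" "finite I"
    and eig: "\<And>i y. i \<in> I \<Longrightarrow> y \<in> A \<Longrightarrow> (\<Sum>x\<in>A. K x y * (\<Sum>z\<in>A. K x z * e i z)) = s * e i y"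
    and nz: "\<And>i. i \<in> I \<Longrightarrow> (\<Sum>y\<in>A. (e i y)\<^sup>2) \<noteq> 0"
    and orth: "\<And>i j. i \<in> I \<Longrightarrow> j \<in> I \<Longrightarrow> i \<noteq> j \<Longrightarrow> (\<Sum>y\<in>A. e i y * e j y) = 0"
  shows "s * card I \<le> (\<Sum>x\<in>A. \<Sum>y\<in>A. (K x y)\<^sup>2)"
proof -
  define r where "r i = sqrt (\<Sum>y\<in>A. (e i y)\<^sup>2)" for i
  define d where "d i y = e i y / r i" for i y
  have r: "r i \<noteq> 0" "(r i)\<^sup>2 = (\<Sum>y\<in>A. (e i y)\<^sup>2)" if "i \<in> I" for i
    using nz[OF that] by (auto simp: r_def sum_nonneg)
  have n1: "(\<Sum>y\<in>A. (d i y)\<^sup>2) = 1" if "i \<in> I" for i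
    using r[OF that] nz[OF that] by (simp add: d_def power_divide sum_divide_distrib[symmetric])
  have o1: "(\<Sum>y\<in>A. d i y * d j y) = 0" if "i \<in> I" "j \<in> I" "i \<noteq> j" for i j
    using orth[OF that] by (simp add: d_def sum_divide_distrib[symmetric])
  have e1: "(\<Sum>x\<in>A. K x y * (\<Sum>z\<in>A. K x z * d i z)) = s * d i y" if "i \<in> I" "y \<in> A" for i y
    using eig[OF that] by (simp add: d_def sum_divide_distrib[symmetric])
  have "s = (\<Sum>x\<in>A. (\<Sum>y\<in>A. K x y * d i y)\<^sup>2)" if i: "i \<in> I" for i
  proof -
    have "(\<Sum>x\<in>A. (\<Sum>y\<in>A. K x y * d i y)\<^sup>2) = (\<Sum>x\<in>A. \<Sum>y\<in>A. d i y * (K x y * (\<Sum>z\<in>A. K x z * d i z)))"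
      by (simp add: power2_eq_square sum_distrib_right sum_distrib_left mult_ac)
    also have "\<dots> = (\<Sum>y\<in>A. d i y * (\<Sum>x\<in>A. K x y * (\<Sum>z\<in>A. K x z * d i z)))"
      by (subst sum.swap) (simp add: sum_distrib_left)
    also have "\<dots> = (\<Sum>y\<in>A. s * (d i y)\<^sup>2)"
      using e1[OF i] by (simp add: power2_eq_square mult_ac)
    also have "\<dots> = s" using n1[OF i] by (simp add: sum_distrib_left[symmetric])
    finally show ?thesis by simp
  qed
  then have "(\<Sum>i\<in>I. s) = (\<Sum>i\<in>I. \<Sum>x\<in>A. (\<Sum>y\<in>A. K x y * d i y)\<^sup>2)"
    by (rule sum.cong[OF refl])
  then have "s * card I = (\<Sum>i\<in>I. \<Sum>x\<in>A. (\<Sum>y\<in>A. K x y * d i y)\<^sup>2)"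
    by (simp add: mult.commute)
  also have "\<dots> = (\<Sum>x\<in>A. \<Sum>i\<in>I. (\<Sum>y\<in>A. K x y * d i y)\<^sup>2)" by (rule sum.swap)
  also have "\<dots> \<le> (\<Sum>x\<in>A. \<Sum>y\<in>A. (K x y)\<^sup>2)"
    by (intro sum_mono bessel_sum fin n1 o1)
  finally show ?thesis .
qed

section \<open>Concentration of permutation statistics\<close>

definition perm_stat :: "nat \<Rightarrow> (nat \<Rightarrow> nat \<Rightarrow> real) \<Rightarrow> (nat \<Rightarrow> nat) \<Rightarrow> real" where
  "perm_stat n w \<pi> = (\<Sum>i\<in>{1..n}. w i (\<pi> i))"

lemma sum_permutes_row:
  fixes h :: "nat \<Rightarrow> real"
  assumes "\<pi> permutes {1..n}"
  shows "(\<Sum>j\<in>{1..n}. h (\<pi> j)) = (\<Sum>k\<in>{1..n}. h k)"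
  using sum.permute[OF assms, of h] by (simp add: o_def)

lemma perm_stat_transpose_diff:
  assumes "i \<in> {1..n}" "j \<in> {1..n}"
  shows "perm_stat n w \<pi> - perm_stat n w (\<pi> \<circ> transpose i j)
    = w i (\<pi> i) + w j (\<pi> j) - w i (\<pi> j) - w j (\<pi> i)"
proof (cases "i = j")
  case False
  define R where "R = {1..n} - {i, j}"
  have S: "{1..n} = insert i (insert j R)" and f: "finite R" "i \<notin> insert j R" "j \<notin> R"
    using assms False by (auto simp: R_def)
  have "(\<Sum>k\<in>R. w k ((\<pi> \<circ> transpose i j) k)) = (\<Sum>k\<in>R. w k (\<pi> k))"
    by (rule sum.cong) (auto simp: R_def)
  then show ?thesis unfolding perm_stat_def S using f by simp
qed (simp add: perm_stat_def)

text \<open>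
  A random transposition gives an exchangeable pair for which the drift of the statistic is linear
  in its deviation from the mean; this starts the concentration argument.
\<close>

lemma sum_transpose_diff:
  assumes p: "\<pi> permutes {1..n}"
  shows "(\<Sum>i\<in>{1..n}. \<Sum>j\<in>{1..n}. perm_stat n w \<pi> - perm_stat n w (\<pi> \<circ> transpose i j))
    = 2 * real n * perm_stat n w \<pi> - 2 * (\<Sum>i\<in>{1..n}. \<Sum>j\<in>{1..n}. w i j)"
proof -
  have r: "(\<Sum>i\<in>{1..n}. \<Sum>j\<in>{1..n}. w i (\<pi> j)) = (\<Sum>i\<in>{1..n}. \<Sum>j\<in>{1..n}. w i j)"
    by (intro sum.cong refl sum_permutes_row[OF p])
  have c: "(\<Sum>i\<in>{1..n}. \<Sum>j\<in>{1..n}. w j (\<pi> i)) = (\<Sum>i\<in>{1..n}. \<Sum>j\<in>{1..n}. w i j)"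
    by (subst sum.swap) (rule r)
  have "(\<Sum>i\<in>{1..n}. \<Sum>j\<in>{1..n}. perm_stat n w \<pi> - perm_stat n w (\<pi> \<circ> transpose i j))
      = (\<Sum>i\<in>{1..n}. \<Sum>j\<in>{1..n}. w i (\<pi> i) + w j (\<pi> j) - w i (\<pi> j) - w j (\<pi> i))"
    by (intro sum.cong refl perm_stat_transpose_diff)
  also have "\<dots> = 2 * real n * perm_stat n w \<pi> - 2 * (\<Sum>i\<in>{1..n}. \<Sum>j\<in>{1..n}. w i j)"
    unfolding sum_subtractf sum.distrib r c
    by (simp add: perm_stat_def sum_distrib_left[symmetric])
  finally show ?thesis .
qed

lemma sum_transpose_squares:
  assumes p: "\<pi> permutes {1..n}"
  shows "(\<Sum>i\<in>{1..n}. \<Sum>j\<in>{1..n}. w i (\<pi> i) + w j (\<pi> j) + w i (\<pi> j) + w j (\<pi> i))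
    = 2 * real n * perm_stat n w \<pi> + 2 * (\<Sum>i\<in>{1..n}. \<Sum>j\<in>{1..n}. w i j)"
proof -
  have r: "(\<Sum>i\<in>{1..n}. \<Sum>j\<in>{1..n}. w i (\<pi> j)) = (\<Sum>i\<in>{1..n}. \<Sum>j\<in>{1..n}. w i j)"
    by (intro sum.cong refl sum_permutes_row[OF p])
  have c: "(\<Sum>i\<in>{1..n}. \<Sum>j\<in>{1..n}. w j (\<pi> i)) = (\<Sum>i\<in>{1..n}. \<Sum>j\<in>{1..n}. w i j)"
    by (subst sum.swap) (rule r)
  show ?thesis
    unfolding sum.distrib r c by (simp add: perm_stat_def sum_distrib_left[symmetric])
qed

lemma abs_exp_diff_le: "\<bar>exp x - exp y\<bar> \<le> \<bar>x - y\<bar> * (exp x + exp (y::real))"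
proof -
  have *: "exp x - exp y \<le> (x - y) * exp x" for x y :: real
  proof -
    have "1 + (y - x) \<le> exp (y - x)" by (rule exp_ge_add_one_self)
    then have "(1 + (y - x)) * exp x \<le> exp (y - x) * exp x" by (intro mult_right_mono) auto
    then show ?thesis by (simp add: exp_add[symmetric] algebra_simps)
  qed
  have "exp x - exp y \<le> \<bar>x - y\<bar> * (exp x + exp y)"
    by (rule order_trans[OF *]) (intro mult_mono, auto)
  moreover have "exp y - exp x \<le> \<bar>x - y\<bar> * (exp x + exp y)"
    by (rule order_trans[OF *]) (intro mult_mono, auto)
  ultimately show ?thesis by linarith
qed

text \<open>
  The correlation of the drift of \<open>W\<close> with the exponential weight \<open>exp (- l F)\<close> is controlled by the
  products of the increments of \<open>W\<close> and \<open>F\<close> only.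
\<close>

lemma exchangeable_pair_bound:
  fixes F W :: "(nat \<Rightarrow> nat) \<Rightarrow> real" and n :: nat
  defines "G \<equiv> {\<pi>. \<pi> permutes {1..n}}"
  assumes l: "0 \<le> l"
  shows "\<bar>\<Sum>\<pi>\<in>G. (\<Sum>i\<in>{1..n}. \<Sum>j\<in>{1..n}. W \<pi> - W (\<pi> \<circ> transpose i j)) * exp (- l * F \<pi>)\<bar>
    \<le> l * (\<Sum>\<pi>\<in>G. (\<Sum>i\<in>{1..n}. \<Sum>j\<in>{1..n}.
        \<bar>W \<pi> - W (\<pi> \<circ> transpose i j)\<bar> * \<bar>F \<pi> - F (\<pi> \<circ> transpose i j)\<bar>) * exp (- l * F \<pi>))"
proof -
  have reindex: "(\<Sum>\<pi>\<in>G. h (\<pi> \<circ> transpose i j)) = (\<Sum>\<pi>\<in>G. h \<pi>)"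
    if "i \<in> {1..n}" "j \<in> {1..n}" for i j and h :: "(nat \<Rightarrow> nat) \<Rightarrow> real"
    unfolding G_def
    by (rule sum_permutations_compose_right[symmetric]) (use that in \<open>simp add: permutes_swap_id\<close>)
  have tt: "\<pi> \<circ> transpose i j \<circ> transpose i j = \<pi>" for \<pi> :: "nat \<Rightarrow> nat" and i j
    by (simp add: comp_assoc)
  let ?D = "\<lambda>V i j \<pi>. V \<pi> - V (\<pi> \<circ> transpose i j)"
  have one: "\<bar>\<Sum>\<pi>\<in>G. ?D W i j \<pi> * exp (- l * F \<pi>)\<bar>
      \<le> l * (\<Sum>\<pi>\<in>G. \<bar>?D W i j \<pi>\<bar> * \<bar>?D F i j \<pi>\<bar> * exp (- l * F \<pi>))"
    if ij: "i \<in> {1..n}" "j \<in> {1..n}" for i j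
  proof -
    let ?t = "\<lambda>\<pi>. \<pi> \<circ> transpose i j"
    let ?e = "\<lambda>\<pi>. exp (- l * F \<pi>)"
    \<comment> \<open>Exchanging \<open>\<pi>\<close> with its neighbour turns the first sum into one in which both
      factors are increments along a transposition.\<close>
    have "(\<Sum>\<pi>\<in>G. ?D W i j \<pi> * ?e \<pi>) = (\<Sum>\<pi>\<in>G. ?D W i j (?t \<pi>) * ?e (?t \<pi>))"
      using reindex[OF ij, of "\<lambda>\<pi>. ?D W i j \<pi> * ?e \<pi>"] by simp
    also have "\<dots> = - (\<Sum>\<pi>\<in>G. ?D W i j \<pi> * ?e (?t \<pi>))"
      by (simp add: tt sum_negf[symmetric] algebra_simps)
    finally have "2 * (\<Sum>\<pi>\<in>G. ?D W i j \<pi> * ?e \<pi>) = (\<Sum>\<pi>\<in>G. ?D W i j \<pi> * (?e \<pi> - ?e (?t \<pi>)))"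
      by (simp add: right_diff_distrib sum_subtractf)
    from arg_cong[OF this, of abs] have "2 * \<bar>\<Sum>\<pi>\<in>G. ?D W i j \<pi> * ?e \<pi>\<bar> = \<bar>\<Sum>\<pi>\<in>G. ?D W i j \<pi> * (?e \<pi> - ?e (?t \<pi>))\<bar>"
      by (simp only: abs_mult abs_numeral)
    also have "\<dots> \<le> (\<Sum>\<pi>\<in>G. \<bar>?D W i j \<pi>\<bar> * (l * \<bar>?D F i j \<pi>\<bar> * (?e \<pi> + ?e (?t \<pi>))))"
    proof (rule order_trans[OF sum_abs], rule sum_mono)
      fix \<pi>
      have "\<bar>- l * F \<pi> - - l * F (?t \<pi>)\<bar> = l * \<bar>?D F i j \<pi>\<bar>"
      proof -
        have "- l * F \<pi> - - l * F (?t \<pi>) = - (l * ?D F i j \<pi>)" by (simp add: algebra_simps)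
        then show ?thesis using l by (simp only: abs_minus_cancel abs_mult abs_of_nonneg)
      qed
      then have "\<bar>?e \<pi> - ?e (?t \<pi>)\<bar> \<le> l * \<bar>?D F i j \<pi>\<bar> * (?e \<pi> + ?e (?t \<pi>))"
        using abs_exp_diff_le[of "- l * F \<pi>" "- l * F (?t \<pi>)"] by simp
      then show "\<bar>?D W i j \<pi> * (?e \<pi> - ?e (?t \<pi>))\<bar> \<le> \<bar>?D W i j \<pi>\<bar> * (l * \<bar>?D F i j \<pi>\<bar> * (?e \<pi> + ?e (?t \<pi>)))"
        unfolding abs_mult by (intro mult_left_mono) auto
    qed
    also have "\<dots> = l * (\<Sum>\<pi>\<in>G. \<bar>?D W i j \<pi>\<bar> * \<bar>?D F i j \<pi>\<bar> * ?e \<pi>)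
        + l * (\<Sum>\<pi>\<in>G. \<bar>?D W i j \<pi>\<bar> * \<bar>?D F i j \<pi>\<bar> * ?e (?t \<pi>))"
      unfolding sum_distrib_left sum.distrib[symmetric] by (intro sum.cong refl) algebra
    also have "(\<Sum>\<pi>\<in>G. \<bar>?D W i j \<pi>\<bar> * \<bar>?D F i j \<pi>\<bar> * ?e (?t \<pi>))
        = (\<Sum>\<pi>\<in>G. \<bar>?D W i j \<pi>\<bar> * \<bar>?D F i j \<pi>\<bar> * ?e \<pi>)"
      using reindex[OF ij, of "\<lambda>\<pi>. \<bar>?D W i j \<pi>\<bar> * \<bar>?D F i j \<pi>\<bar> * ?e \<pi>"]
      by (simp only: tt abs_minus_commute)
    finally show ?thesis by linarith
  qed
  have swap: "(\<Sum>\<pi>\<in>G. (\<Sum>i\<in>{1..n}. \<Sum>j\<in>{1..n}. H i j \<pi>) * exp (- l * F \<pi>))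
      = (\<Sum>i\<in>{1..n}. \<Sum>j\<in>{1..n}. \<Sum>\<pi>\<in>G. H i j \<pi> * exp (- l * F \<pi>))"
    for H :: "nat \<Rightarrow> nat \<Rightarrow> (nat \<Rightarrow> nat) \<Rightarrow> real"
    unfolding sum_distrib_right
    by (subst sum.swap) (intro sum.cong refl sum.swap)
  let ?S = "\<lambda>i j. \<Sum>\<pi>\<in>G. ?D W i j \<pi> * exp (- l * F \<pi>)"
  have "\<bar>\<Sum>i\<in>{1..n}. \<Sum>j\<in>{1..n}. ?S i j\<bar> \<le> (\<Sum>i\<in>{1..n}. \<Sum>j\<in>{1..n}. \<bar>?S i j\<bar>)"
    by (rule order_trans[OF sum_abs sum_mono[OF sum_abs]])
  also have "\<dots> \<le> (\<Sum>i\<in>{1..n}. \<Sum>j\<in>{1..n}. l * (\<Sum>\<pi>\<in>G. \<bar>?D W i j \<pi>\<bar> * \<bar>?D F i j \<pi>\<bar> * exp (- l * F \<pi>)))"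
    by (intro sum_mono one)
  finally show ?thesis
    unfolding swap by (simp only: sum_distrib_left)
qed

lemma increment_product_bounds:
  fixes x1 x2 x3 x4 :: real
  assumes "0 \<le> x1" "x1 \<le> 1" "0 \<le> x2" "x2 \<le> 1" "0 \<le> x3" "x3 \<le> 1" "0 \<le> x4" "x4 \<le> 1"
  shows "\<bar>x1 + x2 - x3 - x4\<bar> * \<bar>x1 + x2 - x3 - x4\<bar> \<le> 4 * (x1\<^sup>2 + x2\<^sup>2 + x3\<^sup>2 + x4\<^sup>2)"
    and "\<bar>x1\<^sup>2 + x2\<^sup>2 - x3\<^sup>2 - x4\<^sup>2\<bar> * \<bar>x1 + x2 - x3 - x4\<bar> \<le> 2 * (x1\<^sup>2 + x2\<^sup>2 + x3\<^sup>2 + x4\<^sup>2)"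
proof -
  have "4 * (x1\<^sup>2 + x2\<^sup>2 + x3\<^sup>2 + x4\<^sup>2) - (x1 + x2 - x3 - x4)\<^sup>2
     = (x1 - x2)\<^sup>2 + (x1 + x3)\<^sup>2 + (x1 + x4)\<^sup>2 + (x2 + x3)\<^sup>2 + (x2 + x4)\<^sup>2 + (x3 - x4)\<^sup>2"
    by (simp add: power2_eq_square algebra_simps)
  also have "\<dots> \<ge> 0" by simp
  finally show "\<bar>x1 + x2 - x3 - x4\<bar> * \<bar>x1 + x2 - x3 - x4\<bar> \<le> 4 * (x1\<^sup>2 + x2\<^sup>2 + x3\<^sup>2 + x4\<^sup>2)"
    by (simp add: power2_eq_square)
  have "\<bar>x1\<^sup>2 + x2\<^sup>2 - x3\<^sup>2 - x4\<^sup>2\<bar> * \<bar>x1 + x2 - x3 - x4\<bar> \<le> (x1\<^sup>2 + x2\<^sup>2 + x3\<^sup>2 + x4\<^sup>2) * 2"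
  proof (rule mult_mono)
    show "\<bar>x1\<^sup>2 + x2\<^sup>2 - x3\<^sup>2 - x4\<^sup>2\<bar> \<le> x1\<^sup>2 + x2\<^sup>2 + x3\<^sup>2 + x4\<^sup>2"
      using zero_le_power2[of x1] zero_le_power2[of x2] zero_le_power2[of x3] zero_le_power2[of x4] by linarith
    show "\<bar>x1 + x2 - x3 - x4\<bar> \<le> 2" using assms by linarith
  qed auto
  then show "\<bar>x1\<^sup>2 + x2\<^sup>2 - x3\<^sup>2 - x4\<^sup>2\<bar> * \<bar>x1 + x2 - x3 - x4\<bar> \<le> 2 * (x1\<^sup>2 + x2\<^sup>2 + x3\<^sup>2 + x4\<^sup>2)"
    by simp
qed

text \<open>
  Under the tilted measure with weight \<open>exp (- l f)\<close>, where \<open>f\<close> is the statistic of \<open>a\<close>, the mean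
  of \<open>f\<close> has dropped by at most \<open>16 l v\<close>. The exchangeable pair bounds the drop by the tilted mean of
  the statistic of \<open>a\<^sup>2\<close>, and the same argument applied to that second statistic shows that its tilted
  mean is at most \<open>3 v\<close>; here the increments of \<open>f\<close> are bounded by \<open>2\<close>, the weights being at most \<open>1\<close>.
  It is \<open>v\<close>, the mean of the statistic of \<open>a\<^sup>2\<close>, that enters here and not the possibly much larger \<open>\<mu>\<close>.
\<close>

lemma tilted_mean_lower_bound:
  fixes a :: "nat \<Rightarrow> nat \<Rightarrow> real" and n :: nat
  assumes n: "n \<ge> 1"
    and a: "\<And>i j. i \<in> {1..n} \<Longrightarrow> j \<in> {1..n} \<Longrightarrow> 0 \<le> a i j \<and> a i j \<le> 1"
    and l: "0 \<le> l" "l \<le> 1/4"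
  defines "G \<equiv> {\<pi>. \<pi> permutes {1..n}}"
    and "\<mu> \<equiv> (\<Sum>i\<in>{1..n}. \<Sum>j\<in>{1..n}. a i j) / n"
    and "v \<equiv> (\<Sum>i\<in>{1..n}. \<Sum>j\<in>{1..n}. (a i j)\<^sup>2) / n"
  shows "(\<Sum>\<pi>\<in>G. perm_stat n a \<pi> * exp (- l * perm_stat n a \<pi>))
    \<ge> (\<mu> - 16 * l * v) * (\<Sum>\<pi>\<in>G. exp (- l * perm_stat n a \<pi>))"
proof -
  define b where "b i j = (a i j)\<^sup>2" for i j
  let ?F = "perm_stat n a" and ?W = "perm_stat n b"
  define Z where "Z = (\<Sum>\<pi>\<in>G. exp (- l * ?F \<pi>))"
  define EF where "EF = (\<Sum>\<pi>\<in>G. ?F \<pi> * exp (- l * ?F \<pi>))"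
  define EW where "EW = (\<Sum>\<pi>\<in>G. ?W \<pi> * exp (- l * ?F \<pi>))"
  have Z0: "Z \<ge> 0" by (simp add: Z_def sum_nonneg)
  have Mu: "(\<Sum>i\<in>{1..n}. \<Sum>j\<in>{1..n}. a i j) = n * \<mu>" and V: "(\<Sum>i\<in>{1..n}. \<Sum>j\<in>{1..n}. b i j) = n * v"
    using n by (simp_all add: \<mu>_def v_def b_def)
  have v0: "v \<ge> 0" by (simp add: v_def sum_nonneg)
  have lin: "(\<Sum>\<pi>\<in>G. (\<Sum>i\<in>{1..n}. \<Sum>j\<in>{1..n}. perm_stat n w \<pi> - perm_stat n w (\<pi> \<circ> transpose i j)) * exp (- l * ?F \<pi>))
      = 2 * real n * (\<Sum>\<pi>\<in>G. perm_stat n w \<pi> * exp (- l * ?F \<pi>)) - 2 * (\<Sum>i\<in>{1..n}. \<Sum>j\<in>{1..n}. w i j) * Z" for w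
  proof -
    have "(\<Sum>\<pi>\<in>G. (\<Sum>i\<in>{1..n}. \<Sum>j\<in>{1..n}. perm_stat n w \<pi> - perm_stat n w (\<pi> \<circ> transpose i j)) * exp (- l * ?F \<pi>))
      = (\<Sum>\<pi>\<in>G. (2 * real n * perm_stat n w \<pi> - 2 * (\<Sum>i\<in>{1..n}. \<Sum>j\<in>{1..n}. w i j)) * exp (- l * ?F \<pi>))"
      by (intro sum.cong refl) (simp only: sum_transpose_diff G_def mem_Collect_eq)
    then show ?thesis
      by (simp only: left_diff_distrib sum_subtractf Z_def sum_distrib_left mult.assoc)
  qed
  have quad: "(\<Sum>\<pi>\<in>G. (\<Sum>i\<in>{1..n}. \<Sum>j\<in>{1..n}. \<bar>D i j \<pi>\<bar> * \<bar>?F \<pi> - ?F (\<pi> \<circ> transpose i j)\<bar>) * exp (- l * ?F \<pi>))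
      \<le> c * (2 * real n * EW + 2 * real n * v * Z)"
    if c: "c \<ge> 0" and D: "\<And>i j \<pi>. i \<in> {1..n} \<Longrightarrow> j \<in> {1..n} \<Longrightarrow> \<pi> permutes {1..n} \<Longrightarrow> 
       \<bar>D i j \<pi>\<bar> * \<bar>?F \<pi> - ?F (\<pi> \<circ> transpose i j)\<bar> \<le> c * (b i (\<pi> i) + b j (\<pi> j) + b i (\<pi> j) + b j (\<pi> i))"
    for c and D :: "nat \<Rightarrow> nat \<Rightarrow> (nat \<Rightarrow> nat) \<Rightarrow> real"
  proof -
    have "(\<Sum>\<pi>\<in>G. (\<Sum>i\<in>{1..n}. \<Sum>j\<in>{1..n}. \<bar>D i j \<pi>\<bar> * \<bar>?F \<pi> - ?F (\<pi> \<circ> transpose i j)\<bar>) * exp (- l * ?F \<pi>))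
       \<le> (\<Sum>\<pi>\<in>G. (\<Sum>i\<in>{1..n}. \<Sum>j\<in>{1..n}. c * (b i (\<pi> i) + b j (\<pi> j) + b i (\<pi> j) + b j (\<pi> i))) * exp (- l * ?F \<pi>))"
      by (intro sum_mono mult_right_mono D) (auto simp: G_def)
    also have "\<dots> = (\<Sum>\<pi>\<in>G. c * (2 * real n * ?W \<pi> + 2 * (real n * v)) * exp (- l * ?F \<pi>))"
      unfolding sum_distrib_left[symmetric]
      by (intro sum.cong refl) (simp only: sum_transpose_squares G_def mem_Collect_eq V)
    also have "\<dots> = c * (2 * real n * EW + 2 * real n * v * Z)"
      by (simp add: EW_def Z_def sum_distrib_left sum.distrib distrib_left distrib_right mult_ac)
    finally show ?thesis .
  qed
  have sqF: "\<bar>?F \<pi> - ?F (\<pi> \<circ> transpose i j)\<bar> * \<bar>?F \<pi> - ?F (\<pi> \<circ> transpose i j)\<bar>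
      \<le> 4 * (b i (\<pi> i) + b j (\<pi> j) + b i (\<pi> j) + b j (\<pi> i))"
    and sqW: "\<bar>?W \<pi> - ?W (\<pi> \<circ> transpose i j)\<bar> * \<bar>?F \<pi> - ?F (\<pi> \<circ> transpose i j)\<bar>
      \<le> 2 * (b i (\<pi> i) + b j (\<pi> j) + b i (\<pi> j) + b j (\<pi> i))"
    if "i \<in> {1..n}" "j \<in> {1..n}" "\<pi> permutes {1..n}" for i j \<pi>
  proof -
    have m: "\<pi> i \<in> {1..n}" "\<pi> j \<in> {1..n}" using that permutes_in_image[OF that(3)] by auto
    note bd = a[OF that(1) m(1)] a[OF that(2) m(2)] a[OF that(1) m(2)] a[OF that(2) m(1)]
    show "\<bar>?F \<pi> - ?F (\<pi> \<circ> transpose i j)\<bar> * \<bar>?F \<pi> - ?F (\<pi> \<circ> transpose i j)\<bar>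
      \<le> 4 * (b i (\<pi> i) + b j (\<pi> j) + b i (\<pi> j) + b j (\<pi> i))"
      unfolding perm_stat_transpose_diff[OF that(1,2)] b_def
      by (rule increment_product_bounds(1)) (use bd in auto)
    show "\<bar>?W \<pi> - ?W (\<pi> \<circ> transpose i j)\<bar> * \<bar>?F \<pi> - ?F (\<pi> \<circ> transpose i j)\<bar>
      \<le> 2 * (b i (\<pi> i) + b j (\<pi> j) + b i (\<pi> j) + b j (\<pi> i))"
      unfolding perm_stat_transpose_diff[OF that(1,2)] b_def
      by (rule increment_product_bounds(2)) (use bd in auto)
  qed
  have "\<bar>2 * real n * EF - 2 * (n * \<mu>) * Z\<bar> \<le> l * (4 * (2 * real n * EW + 2 * real n * v * Z))"
    using order_trans[OF exchangeable_pair_bound[OF l(1), where n = n and F = ?F and W = ?F]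
      mult_left_mono[OF quad[of 4 "\<lambda>i j \<pi>. ?F \<pi> - ?F (\<pi> \<circ> transpose i j)", OF _ sqF] l(1), unfolded G_def]]
    unfolding G_def[symmetric] lin Mu EF_def[symmetric] by simp
  moreover have "2 * real n * EF - 2 * (n * \<mu>) * Z = 2 * real n * (EF - \<mu> * Z)"
    by (simp add: algebra_simps)
  ultimately have "\<bar>2 * real n * (EF - \<mu> * Z)\<bar> \<le> l * (4 * (2 * real n * EW + 2 * real n * v * Z))"
    by (simp only:)
  then have "2 * real n * \<bar>EF - \<mu> * Z\<bar> \<le> l * (4 * (2 * real n * EW + 2 * real n * v * Z))"
    by (simp add: abs_mult)
  then have "n * \<bar>EF - \<mu> * Z\<bar> \<le> n * (4 * l * (EW + v * Z))"
    by (simp add: algebra_simps)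
  then have FF: "\<bar>EF - \<mu> * Z\<bar> \<le> 4 * l * (EW + v * Z)" using n by simp
  have "\<bar>2 * real n * EW - 2 * (n * v) * Z\<bar> \<le> l * (2 * (2 * real n * EW + 2 * real n * v * Z))"
    using order_trans[OF exchangeable_pair_bound[OF l(1), where n = n and F = ?F and W = ?W]
      mult_left_mono[OF quad[of 2 "\<lambda>i j \<pi>. ?W \<pi> - ?W (\<pi> \<circ> transpose i j)", OF _ sqW] l(1), unfolded G_def]]
    unfolding G_def[symmetric] lin V EW_def[symmetric] by simp
  moreover have "2 * real n * EW - 2 * (n * v) * Z = 2 * real n * (EW - v * Z)"
    by (simp add: algebra_simps)
  ultimately have "\<bar>2 * real n * (EW - v * Z)\<bar> \<le> l * (2 * (2 * real n * EW + 2 * real n * v * Z))"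
    by (simp only:)
  then have "2 * real n * \<bar>EW - v * Z\<bar> \<le> l * (2 * (2 * real n * EW + 2 * real n * v * Z))"
    by (simp add: abs_mult)
  then have "n * \<bar>EW - v * Z\<bar> \<le> n * (2 * l * (EW + v * Z))"
    by (simp add: algebra_simps)
  then have WW: "\<bar>EW - v * Z\<bar> \<le> 2 * l * (EW + v * Z)" using n by simp
  have EW0: "EW \<ge> 0"
    unfolding EW_def perm_stat_def b_def by (intro sum_nonneg mult_nonneg_nonneg) auto
  have "2 * l * (EW + v * Z) \<le> 1/2 * (EW + v * Z)"
    using l EW0 v0 Z0 by (intro mult_right_mono) auto
  from order_trans[OF abs_ge_self order_trans[OF WW this]]
  have "EW \<le> 3 * (v * Z)" by (simp add: field_simps)
  then have "EW + v * Z \<le> 4 * (v * Z)" by (simp add: mult.commute)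
  then have "4 * l * (EW + v * Z) \<le> 4 * l * (4 * (v * Z))" 
    by (rule mult_left_mono) (use l in simp)
  from order_trans[OF FF this] have "\<bar>EF - \<mu> * Z\<bar> \<le> 16 * l * (v * Z)" by simp
  then have "(\<mu> - 16 * l * v) * Z \<le> EF" by (simp add: abs_le_iff algebra_simps)
  then show ?thesis unfolding EF_def Z_def .
qed

text \<open>
  The tilted mean is minus the logarithmic derivative of the Laplace transform; integrate the
  previous bound from \<open>0\<close> to \<open>l\<close>.
\<close>

lemma perm_stat_laplace_bound:
  fixes a :: "nat \<Rightarrow> nat \<Rightarrow> real" and n :: nat
  assumes n: "n \<ge> 1"
    and a: "\<And>i j. i \<in> {1..n} \<Longrightarrow> j \<in> {1..n} \<Longrightarrow> 0 \<le> a i j \<and> a i j \<le> 1"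
    and l: "0 \<le> l" "l \<le> 1/4"
  defines "G \<equiv> {\<pi>. \<pi> permutes {1..n}}"
    and "\<mu> \<equiv> (\<Sum>i\<in>{1..n}. \<Sum>j\<in>{1..n}. a i j) / n"
    and "v \<equiv> (\<Sum>i\<in>{1..n}. \<Sum>j\<in>{1..n}. (a i j)\<^sup>2) / n"
  shows "(\<Sum>\<pi>\<in>G. exp (- l * perm_stat n a \<pi>)) \<le> fact n * exp (8 * l\<^sup>2 * v - l * \<mu>)"
proof -
  let ?F = "perm_stat n a"
  define \<phi> where "\<phi> t = (\<Sum>\<pi>\<in>G. exp (- t * ?F \<pi>)) * exp (t * \<mu> - 8 * t\<^sup>2 * v)" for t
  define \<phi>' where "\<phi>' t = (- (\<Sum>\<pi>\<in>G. ?F \<pi> * exp (- t * ?F \<pi>)) + (\<Sum>\<pi>\<in>G. exp (- t * ?F \<pi>)) * (\<mu> - 16 * t * v))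
       * exp (t * \<mu> - 8 * t\<^sup>2 * v)" for t
  have deriv: "(\<phi> has_real_derivative \<phi>' t) (at t)" for t
  proof -
    have "((\<lambda>t. \<Sum>\<pi>\<in>G. exp (- t * ?F \<pi>)) has_real_derivative (\<Sum>\<pi>\<in>G. - (?F \<pi> * exp (- t * ?F \<pi>)))) (at t)"
      by (rule DERIV_sum) (auto intro!: derivative_eq_intros)
    moreover have "((\<lambda>t. exp (t * \<mu> - 8 * t\<^sup>2 * v)) has_real_derivative
        (\<mu> - 16 * t * v) * exp (t * \<mu> - 8 * t\<^sup>2 * v)) (at t)"
      by (auto intro!: derivative_eq_intros)
    ultimately show ?thesis
      unfolding \<phi>_def \<phi>'_def
      by (rule DERIV_mult[THEN DERIV_cong]) (simp add: sum_negf algebra_simps)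
  qed
  have "\<phi> l \<le> \<phi> 0"
  proof (rule DERIV_nonpos_imp_nonincreasing[OF l(1)])
    fix t assume t: "0 \<le> t" "t \<le> l"
    have "\<phi>' t \<le> 0"
      unfolding \<phi>'_def using tilted_mean_lower_bound[of n a t, OF n a] t l
      by (intro mult_nonpos_nonneg) (auto simp: G_def \<mu>_def v_def algebra_simps)
    then show "\<exists>y. DERIV \<phi> t :> y \<and> y \<le> 0" using deriv by blast
  qed
  moreover have "\<phi> 0 = fact n"
    by (simp add: \<phi>_def G_def card_permutations)
  ultimately have "(\<Sum>\<pi>\<in>G. exp (- l * ?F \<pi>)) * exp (l * \<mu> - 8 * l\<^sup>2 * v) \<le> fact n"
    by (simp add: \<phi>_def)
  then have "(\<Sum>\<pi>\<in>G. exp (- l * ?F \<pi>)) \<le> fact n / exp (l * \<mu> - 8 * l\<^sup>2 * v)"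
    by (simp add: field_simps)
  also have "\<dots> = fact n * exp (8 * l\<^sup>2 * v - l * \<mu>)"
    by (simp add: exp_diff divide_inverse mult_ac)
  finally show ?thesis .
qed

text \<open>
  Averaging the exponential over a set of density \<open>\<delta>\<close> instead of all permutations costs at most a factor
  \<open>1/\<delta>\<close>, and Jensen's inequality turns the exponential mean over the set into the mean of the statistic.
\<close>

lemma perm_stat_mean_deficit:
  fixes a :: "nat \<Rightarrow> nat \<Rightarrow> real" and n :: nat
  assumes n: "n \<ge> 1"
    and a: "\<And>i j. i \<in> {1..n} \<Longrightarrow> j \<in> {1..n} \<Longrightarrow> 0 \<le> a i j \<and> a i j \<le> 1"
    and l: "0 \<le> l" "l \<le> 1/4"
    and X: "X \<subseteq> {\<pi>. \<pi> permutes {1..n}}" "X \<noteq> {}"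
  defines "\<mu> \<equiv> (\<Sum>i\<in>{1..n}. \<Sum>j\<in>{1..n}. a i j) / n"
    and "v \<equiv> (\<Sum>i\<in>{1..n}. \<Sum>j\<in>{1..n}. (a i j)\<^sup>2) / n"
  shows "l * (\<mu> - (\<Sum>\<pi>\<in>X. perm_stat n a \<pi>) / card X) \<le> ln (fact n / card X) + 8 * l\<^sup>2 * v"
proof -
  let ?F = "perm_stat n a"
  define m where "m = (\<Sum>\<pi>\<in>X. ?F \<pi>) / card X"
  have fX: "finite X" using X(1) finite_permutations[of "{1..n}"] by (auto intro: finite_subset)
  have cX: "real (card X) > 0" using fX X(2) by (simp add: card_gt_0_iff)
  \<comment> \<open>Jensen's inequality, through the tangent line of the exponential at the mean.\<close>
  have "real (card X) * exp (- l * m) = (\<Sum>\<pi>\<in>X. exp (- l * m) * (1 + (- l * ?F \<pi> + l * m)))"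
  proof -
    have "(\<Sum>\<pi>\<in>X. exp (- l * m) * (1 + (- l * ?F \<pi> + l * m)))
        = exp (- l * m) * (card X - l * (\<Sum>\<pi>\<in>X. ?F \<pi>) + card X * (l * m))"
      by (simp only: sum_distrib_left[symmetric] sum.distrib sum_constant) (simp add: sum_negf sum_distrib_left)
    also have "(\<Sum>\<pi>\<in>X. ?F \<pi>) = card X * m" using cX by (simp add: m_def)
    finally show ?thesis by simp
  qed
  also have "\<dots> \<le> (\<Sum>\<pi>\<in>X. exp (- l * ?F \<pi>))"
  proof (rule sum_mono)
    fix \<pi>
    have "exp (- l * m) * (1 + (- l * ?F \<pi> + l * m)) \<le> exp (- l * m) * exp (- l * ?F \<pi> + l * m)"
      by (intro mult_left_mono exp_ge_add_one_self) auto
    then show "exp (- l * m) * (1 + (- l * ?F \<pi> + l * m)) \<le> exp (- l * ?F \<pi>)"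
      by (simp add: exp_add[symmetric])
  qed
  also have "\<dots> \<le> (\<Sum>\<pi>\<in>{\<pi>. \<pi> permutes {1..n}}. exp (- l * ?F \<pi>))"
    using X finite_permutations[of "{1..n}"] by (intro sum_mono2) auto
  also have "\<dots> \<le> fact n * exp (8 * l\<^sup>2 * v - l * \<mu>)"
    unfolding \<mu>_def v_def by (rule perm_stat_laplace_bound[OF n a l]) 
  finally have "exp (- l * m) \<le> (fact n / card X) * exp (8 * l\<^sup>2 * v - l * \<mu>)"
    using cX by (simp add: field_simps)
  also have "\<dots> = exp (ln (fact n / card X) + (8 * l\<^sup>2 * v - l * \<mu>))"
    using cX by (simp add: exp_add)
  finally show ?thesis by (simp add: m_def right_diff_distrib)
qed

section \<open>Vanishing of functions without second differences\<close>

abbreviation Alt :: "nat \<Rightarrow> (nat \<Rightarrow> nat) set" where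
  "Alt n \<equiv> carrier (alt_group n)"

lemma Alt_permutes: "p \<in> Alt n \<Longrightarrow> p permutes {1..n}"
  by (simp add: alt_group_carrier)

lemma Alt_in: "p \<in> Alt n \<Longrightarrow> i \<in> {1..n} \<Longrightarrow> p i \<in> {1..n}"
  using permutes_in_image[OF Alt_permutes] by blast

lemma Alt_eq_iff: "p \<in> Alt n \<Longrightarrow> p i = p j \<longleftrightarrow> i = j"
  using permutes_inj[OF Alt_permutes] by (auto dest: injD)

lemma finite_Alt: "finite (Alt n)"
  by (rule finite_subset[OF _ finite_permutations[of "{1..n}"]]) (auto simp: alt_group_carrier)

lemma Alt_id: "id \<in> Alt n"
  by (simp add: alt_group_carrier permutes_id)

lemma Alt_comp: "p \<in> Alt n \<Longrightarrow> q \<in> Alt n \<Longrightarrow> p \<circ> q \<in> Alt n"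
  using alt_group_carrier'[of p n] alt_group_carrier'[of q n]
  by (simp add: alt_group_carrier permutes_compose evenperm_comp)

lemma Alt_inv: "p \<in> Alt n \<Longrightarrow> inv' p \<in> Alt n"
  by (rule alt_group_inv_closed)

lemma Alt_inv_o: "p \<in> Alt n \<Longrightarrow> inv' p \<circ> p = id" "p \<in> Alt n \<Longrightarrow> p \<circ> inv' p = id"
  by (simp_all add: permutes_inv_o[OF Alt_permutes])

lemma Alt_inv_apply: "p \<in> Alt n \<Longrightarrow> inv' p (p i) = i" "p \<in> Alt n \<Longrightarrow> p (inv' p i) = i"
  by (simp_all add: permutes_inverses[OF Alt_permutes])

lemma Alt_two_transpositions:
  assumes "a \<noteq> b" "c \<noteq> d" "{a, b, c, d} \<subseteq> {1..n}"
  shows "transpose a b \<circ> transpose c d \<in> Alt n"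
proof -
  have "transpose a b \<circ> transpose c d permutes {1..n}"
    using assms by (intro permutes_compose permutes_swap_id) auto
  moreover have "evenperm (transpose a b \<circ> transpose c d)"
    using assms by (simp add: evenperm_comp permutation_swap_id evenperm_swap)
  ultimately show ?thesis by (simp add: alt_group_carrier)
qed

lemma sum_Alt_right:
  assumes h: "h \<in> Alt n"
  shows "(\<Sum>y\<in>Alt n. f (y \<circ> h)) = (\<Sum>y\<in>Alt n. f y)"
  by (rule sum.reindex_bij_witness[where i = "\<lambda>y. y \<circ> inv' h" and j = "\<lambda>y. y \<circ> h"])
    (simp_all add: h comp_assoc Alt_inv_o[OF h] Alt_comp Alt_inv)

text \<open>
  Summing the four-term relation over \<open>q\<close> and then over \<open>p\<close>, the zero marginals leave only a
  relation between \<open>F u v\<close> and \<open>F v u\<close>, namely \<open>k F u v = - F v u\<close> with \<open>k > 1\<close>.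
  Applied twice it forces \<open>F u v = 0\<close>.
\<close>

lemma two_point_vanishing:
  fixes F :: "'a \<Rightarrow> 'a \<Rightarrow> real"
  assumes T: "finite T" "card T \<ge> 4"
    and sq: "\<And>u v p q. {u, v, p, q} \<subseteq> T \<Longrightarrow> distinct [u, v, p, q] \<Longrightarrow> F u v - F p v - F u q + F p q = 0"
    and row: "\<And>u. u \<in> T \<Longrightarrow> (\<Sum>v\<in>T - {u}. F u v) = 0"
    and col: "\<And>v. v \<in> T \<Longrightarrow> (\<Sum>u\<in>T - {v}. F u v) = 0"
    and uv: "u \<in> T" "v \<in> T" "u \<noteq> v"
  shows "F u v = 0"
proof -
  define t where "t = real (card T)"
  have t4: "t \<ge> 4" using T(2) by (simp add: t_def)
  have step1: "(t - 2) * (F u v - F p v) + F u p - F p u = 0"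
    if d: "u \<in> T" "v \<in> T" "p \<in> T" "distinct [u, v, p]" for u v p
  proof -
    define R where "R = T - {u, v, p}"
    have cR: "real (card R) = t - 3"
      unfolding R_def t_def using d T by (subst card_Diff_subset) auto
    have fR: "finite R" using T by (simp add: R_def)
    have nR: "u \<notin> R" "v \<notin> R" "p \<notin> R" by (auto simp: R_def)
    have "T - {u} = insert v (insert p R)" using d by (auto simp: R_def)
    from row[OF d(1), unfolded this] have 1: "F u v + (F u p + (\<Sum>q\<in>R. F u q)) = 0"
      using d(4) fR nR by simp
    have "T - {p} = insert u (insert v R)" using d by (auto simp: R_def)
    from row[OF d(3), unfolded this] have 2: "F p u + (F p v + (\<Sum>q\<in>R. F p q)) = 0"
      using d(4) fR nR by simp
    have "(\<Sum>q\<in>R. F u v - F p v - F u q + F p q) = 0"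
    proof (rule sum.neutral, rule ballI)
      fix q assume "q \<in> R"
      then show "F u v - F p v - F u q + F p q = 0" using sq[of u v p q] d by (auto simp: R_def)
    qed
    then have "(t - 3) * (F u v - F p v) - (\<Sum>q\<in>R. F u q) + (\<Sum>q\<in>R. F p q) = 0"
      by (simp add: sum.distrib sum_subtractf cR algebra_simps)
    then show ?thesis using 1 2 by (simp add: algebra_simps)
  qed
  have step2: "((t - 2) * (t - 1) - 1) * F u v = - F v u"
    if d: "u \<in> T" "v \<in> T" "u \<noteq> v" for u v
  proof -
    define R where "R = T - {u, v}"
    have cR: "real (card R) = t - 2"
      unfolding R_def t_def using d T by (subst card_Diff_subset) auto
    have fR: "finite R" using T by (simp add: R_def)
    have T1: "T - {u} = insert v R" and T2: "T - {v} = insert u R" using d by (auto simp: R_def)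
    have "v \<notin> R" "u \<notin> R" by (auto simp: R_def)
    then have 1: "F u v + (\<Sum>p\<in>R. F u p) = 0" "F u v + (\<Sum>p\<in>R. F p v) = 0" "F v u + (\<Sum>p\<in>R. F p u) = 0"
      using row[OF d(1)] col[OF d(1)] col[OF d(2)] fR unfolding T1 T2 by simp_all
    have "(\<Sum>p\<in>R. (t - 2) * (F u v - F p v) + F u p - F p u) = 0"
    proof (rule sum.neutral, rule ballI)
      fix p assume "p \<in> R"
      then show "(t - 2) * (F u v - F p v) + F u p - F p u = 0" using step1[of u v p] d by (auto simp: R_def)
    qed
    then have "(t - 2) * ((t - 2) * F u v - (\<Sum>p\<in>R. F p v)) + (\<Sum>p\<in>R. F u p) - (\<Sum>p\<in>R. F p u) = 0"
      by (simp add: sum.distrib sum_subtractf sum_distrib_left[symmetric] cR)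
    moreover have "(\<Sum>p\<in>R. F u p) = - F u v" "(\<Sum>p\<in>R. F p v) = - F u v" "(\<Sum>p\<in>R. F p u) = - F v u"
      using 1 by linarith+
    ultimately show ?thesis by (simp add: algebra_simps)
  qed
  define k where "k = (t - 2) * (t - 1) - 1"
  have "2 * 3 \<le> (t - 2) * (t - 1)" using t4 by (intro mult_mono) auto
  then have k: "k > 1" by (simp add: k_def)
  have "k * (k * F u v) = F u v"
    using step2[of u v] step2[of v u] uv by (simp add: k_def)
  then have "(k * k - 1) * F u v = 0" by (simp add: algebra_simps)
  moreover have "k * k > 1 * 1" using k by (intro mult_strict_mono) auto
  ultimately show ?thesis by simp
qed

lemma finite_distinct_list_take:
  assumes "finite T" "k \<le> card T"
  obtains xs where "distinct xs" "set xs \<subseteq> T" "length xs = k"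
proof -
  obtain ys where "set ys = T" "distinct ys" using finite_distinct_list[OF assms(1)] by auto
  then show thesis
    using that[of "take k ys"] assms(2) by (auto simp: distinct_card set_take_subset intro: in_set_takeD)
qed

definition dtransp :: "nat \<Rightarrow> nat \<Rightarrow> nat \<Rightarrow> nat \<Rightarrow> nat \<Rightarrow> nat" where
  "dtransp a b c d = transpose a b \<circ> transpose c d"

lemma dtransp_Alt:
  "distinct [a, b, c, d] \<Longrightarrow> {a, b, c, d} \<subseteq> {1..n} \<Longrightarrow> dtransp a b c d \<in> Alt n"
  unfolding dtransp_def by (rule Alt_two_transpositions) auto

lemma dtransp_simps:
  assumes "distinct [a, b, c, d]"
  shows "dtransp a b c d a = b" "dtransp a b c d b = a" "dtransp a b c d c = d" "dtransp a b c d d = c"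
    "x \<notin> {a, b, c, d} \<Longrightarrow> dtransp a b c d x = x"
  using assms by (simp_all add: dtransp_def)

lemma dtransp_involution:
  assumes "distinct [a, b, c, d]"
  shows "dtransp a b c d \<circ> dtransp a b c d = id"
proof
  fix x
  show "(dtransp a b c d \<circ> dtransp a b c d) x = id x"
    using dtransp_simps[OF assms] by (cases "x \<in> {a, b, c, d}") auto
qed

lemma dtransp_commute:
  assumes "distinct [a, b, c, d, a', b', c', d']"
  shows "dtransp a b c d \<circ> dtransp a' b' c' d' = dtransp a' b' c' d' \<circ> dtransp a b c d"
proof
  fix x
  have *: "dtransp a b c d x = x" if "x \<notin> {a, b, c, d}" for x using dtransp_simps(5)[of a b c d x] assms that by auto
  have **: "dtransp a' b' c' d' x = x" if "x \<notin> {a', b', c', d'}" for x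
    using dtransp_simps(5)[of a' b' c' d' x] assms that by auto
  have d: "distinct [a, b, c, d]" "distinct [a', b', c', d']" using assms by auto
  have i: "dtransp a b c d x \<in> {a, b, c, d}" if "x \<in> {a, b, c, d}" for x
    using that dtransp_simps[OF d(1)] by auto
  have i': "dtransp a' b' c' d' x \<in> {a', b', c', d'}" if "x \<in> {a', b', c', d'}" for x
    using that dtransp_simps[OF d(2)] by auto
  have dj: "{a, b, c, d} \<inter> {a', b', c', d'} = {}" using assms by auto
  consider "x \<in> {a, b, c, d}" | "x \<in> {a', b', c', d'}" | "x \<notin> {a, b, c, d}" "x \<notin> {a', b', c', d'}" by blast
  then show "(dtransp a b c d \<circ> dtransp a' b' c' d') x = (dtransp a' b' c' d' \<circ> dtransp a b c d) x"
  proof cases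
    case 1
    then have "x \<notin> {a', b', c', d'}" "dtransp a b c d x \<notin> {a', b', c', d'}" using i dj by blast+
    then show ?thesis using ** by simp
  next
    case 2
    then have "x \<notin> {a, b, c, d}" "dtransp a' b' c' d' x \<notin> {a, b, c, d}" using i' dj by blast+
    then show ?thesis using * by simp
  next
    case 3 then show ?thesis using * ** by simp
  qed
qed

text \<open>
  In operator notation: \<open>(1 - a) (1 - a') g = 0\<close> for all disjoint double transpositions \<open>a\<close> and \<open>a'\<close>
  acting by right translation.
\<close>

definition second_difference_free :: "nat \<Rightarrow> ((nat \<Rightarrow> nat) \<Rightarrow> real) \<Rightarrow> bool" where
  "second_difference_free n g \<longleftrightarrow> (\<forall>a b c d a' b' c' d'. distinct [a, b, c, d, a', b', c', d'] \<longrightarrow>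
     {a, b, c, d, a', b', c', d'} \<subseteq> {1..n} \<longrightarrow>
     (\<forall>y\<in>Alt n. g y - g (y \<circ> dtransp a b c d) - g (y \<circ> dtransp a' b' c' d')
        + g (y \<circ> dtransp a b c d \<circ> dtransp a' b' c' d') = 0))"

text \<open>
  With the values \<open>i\<close> and \<open>j\<close> fixed and their positions \<open>u\<close> and \<open>v\<close> varying, the fibre sums
  form a function of two points: right translation by a double transposition moves a position, which
  gives the four-term relation, and the sums with one value fewer are the marginals.
\<close>

lemma fibre_sum_two_more_points:
  fixes g :: "(nat \<Rightarrow> nat) \<Rightarrow> real"
  assumes sd: "second_difference_free n g"
    and S: "S \<subseteq> {1..n}" "card S + 8 \<le> n"
    and H: "\<And>w i. w \<in> {1..n} - S \<Longrightarrow> sum g {y\<in>Alt n. (\<forall>s\<in>S. y s = x s) \<and> y w = i} = 0"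
    and uv: "u \<in> {1..n} - S" "v \<in> {1..n} - S" "u \<noteq> v"
  shows "sum g {y\<in>Alt n. (\<forall>s\<in>S. y s = x s) \<and> y u = i \<and> y v = j} = 0"
proof (cases "{y\<in>Alt n. (\<forall>s\<in>S. y s = x s) \<and> y u = i \<and> y v = j} = {}")
  case False
  define T where "T = {1..n} - S"
  define C where "C = {y\<in>Alt n. \<forall>s\<in>S. y s = x s}"
  define F where "F u v = sum g {y\<in>C. y u = i \<and> y v = j}" for u v
  obtain y0 where y0: "y0 \<in> Alt n" "\<forall>s\<in>S. y0 s = x s" "y0 u = i" "y0 v = j" using False by auto
  have ij: "i \<in> {1..n}" "j \<in> {1..n}" "i \<noteq> j" "i \<notin> x ` S" "j \<notin> x ` S"
    using y0 uv Alt_in[OF y0(1)] Alt_eq_iff[OF y0(1)] by (auto simp flip: y0(3,4)) (metis y0(2))+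
  have fS: "finite S" using S finite_subset by blast
  have fT: "finite T" and cT: "card T \<ge> 8"
    using S fS by (auto simp: T_def card_Diff_subset)
  have CAlt: "C \<subseteq> Alt n" and fC: "finite C" using finite_Alt by (auto simp: C_def)
  have inv_T: "inv' y k \<in> T" "y (inv' y k) = k" if y: "y \<in> C" and k: "k \<in> {1..n}" "k \<notin> x ` S" for y k
  proof -
    have yA: "y \<in> Alt n" using y by (simp add: C_def)
    show *: "y (inv' y k) = k" using Alt_inv_apply[OF yA] by simp
    have "inv' y k \<notin> S" using y k * unfolding C_def by (metis (mono_tags, lifting) image_eqI mem_Collect_eq)
    then show "inv' y k \<in> T" using Alt_in[OF Alt_inv[OF yA] k(1)] by (simp add: T_def)
  qed
  have marg: "(\<Sum>v'\<in>T - {w}. sum g {y\<in>C. y w = k \<and> y v' = l}) = 0"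
    if w: "w \<in> T" and kl: "k \<noteq> l" "l \<in> {1..n}" "l \<notin> x ` S" for w k l
  proof -
    let ?D = "{y\<in>C. y w = k}"
    have "(\<Sum>v'\<in>T - {w}. sum g {y\<in>?D. inv' y l = v'}) = sum g ?D"
    proof (rule sum.group)
      show "(\<lambda>y. inv' y l) ` ?D \<subseteq> T - {w}" using inv_T[of _ l] kl by auto
    qed (use fC fT in auto)
    moreover have "{y\<in>?D. inv' y l = v'} = {y\<in>C. y w = k \<and> y v' = l}" for v'
      using CAlt Alt_inv_apply by auto
    moreover have "?D = {y\<in>Alt n. (\<forall>s\<in>S. y s = x s) \<and> y w = k}" by (auto simp: C_def)
    ultimately show ?thesis using H[of w k] w by (simp add: T_def)
  qed
  have shift: "F u' v' = (\<Sum>y\<in>{y\<in>C. y u = i \<and> y v = j}. g (y \<circ> h))"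
    if h: "h \<in> Alt n" "\<forall>s\<in>S. h s = s" and uv: "h u' = u" "h v' = v" for u v u' v' h
  proof -
    have hi: "\<forall>s\<in>S. inv' h s = s" "inv' h u = u'" "inv' h v = v'"
      using h uv Alt_inv_apply[OF h(1)] by metis+
    show ?thesis unfolding F_def
      by (rule sum.reindex_bij_witness[where i = "\<lambda>y. y \<circ> h" and j = "\<lambda>y. y \<circ> inv' h"])
        (auto simp: C_def comp_assoc Alt_inv_o[OF h(1)] h hi uv Alt_comp Alt_inv)
  qed
  have "F u v = 0"
  proof (rule two_point_vanishing[OF fT])
    show "card T \<ge> 4" using cT by simp
    show "u \<in> T" "v \<in> T" "u \<noteq> v" using uv by (auto simp: T_def)
    show "(\<Sum>v\<in>T - {u}. F u v) = 0" if "u \<in> T" for u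
      using marg[OF that, of i j] ij by (simp add: F_def)
    show "(\<Sum>u\<in>T - {v}. F u v) = 0" if "v \<in> T" for v
      using marg[OF that, of j i] ij by (simp add: F_def conj_commute)
    fix u v p q assume P: "{u, v, p, q} \<subseteq> T" "distinct [u, v, p, q]"
    have "card (T - {u, v, p, q}) \<ge> 4"
      using P cT by (subst card_Diff_subset) auto
    then obtain zs where zs: "distinct zs" "set zs \<subseteq> T - {u, v, p, q}" "length zs = 4"
      using finite_distinct_list_take[of "T - {u, v, p, q}" 4] fT by auto
    then obtain r r' s s' where "zs = [r, r', s, s']"
      by (auto simp: length_Suc_conv numeral_eq_Suc)
    with zs P have D: "distinct [u, p, r, r', v, q, s, s']" "{u, p, r, r', v, q, s, s'} \<subseteq> T" by auto
    define a where "a = dtransp u p r r'"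
    define a' where "a' = dtransp v q s s'"
    have d1: "distinct [u, p, r, r']" and d2: "distinct [v, q, s, s']" using D by auto
    have Dn: "{u, p, r, r', v, q, s, s'} \<subseteq> {1..n}" using D(2) by (auto simp: T_def)
    have A: "a \<in> Alt n" "a' \<in> Alt n" unfolding a_def a'_def
      by (rule dtransp_Alt, use D Dn in auto)+
    have "v \<notin> {u, p, r, r'}" "q \<notin> {u, p, r, r'}" "u \<notin> {v, q, s, s'}" "p \<notin> {v, q, s, s'}"
      using D(1) by auto
    then have av: "a v = v" "a q = q" "a' u = u" "a' p = p"
      unfolding a_def a'_def by (auto intro!: dtransp_simps(5)[OF d1] dtransp_simps(5)[OF d2])
    have av': "a u = p" "a p = u" "a' v = q" "a' q = v"
      unfolding a_def a'_def by (fact dtransp_simps[OF d1] dtransp_simps[OF d2])+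
    have fixS: "\<forall>z\<in>S. a z = z" "\<forall>z\<in>S. a' z = z"
    proof -
      have nz: "z \<notin> {u, p, r, r'}" "z \<notin> {v, q, s, s'}" if "z \<in> S" for z
        using D(2) that by (auto simp: T_def)
      show "\<forall>z\<in>S. a z = z"
        unfolding a_def by (intro ballI dtransp_simps(5)[OF d1] nz(1))
      show "\<forall>z\<in>S. a' z = z"
        unfolding a'_def by (intro ballI dtransp_simps(5)[OF d2] nz(2))
    qed
    let ?B = "{y\<in>C. y u = i \<and> y v = j}"
    have "F u v = (\<Sum>y\<in>?B. g y)" by (simp add: F_def)
    moreover have "F p v = (\<Sum>y\<in>?B. g (y \<circ> a))" using shift[of a p u v v] A fixS av av' by simp
    moreover have "F u q = (\<Sum>y\<in>?B. g (y \<circ> a'))" using shift[of a' u u q v] A fixS av av' by simp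
    moreover have "F p q = (\<Sum>y\<in>?B. g (y \<circ> a \<circ> a'))"
      using shift[of "a \<circ> a'" p u q v] Alt_comp[OF A] fixS av av' by (simp add: comp_assoc)
    moreover have "(\<Sum>y\<in>?B. g y - g (y \<circ> a) - g (y \<circ> a') + g (y \<circ> a \<circ> a')) = 0"
    proof (rule sum.neutral, rule ballI)
      fix y assume "y \<in> ?B"
      then have "y \<in> Alt n" by (simp add: C_def)
      then show "g y - g (y \<circ> a) - g (y \<circ> a') + g (y \<circ> a \<circ> a') = 0"
        using sd[unfolded second_difference_free_def, rule_format, OF D(1) Dn] by (simp add: a_def a'_def)
    qed
    ultimately show "F u v - F p v - F u q + F p q = 0"
      by (simp add: sum.distrib sum_subtractf)
  qed
  moreover have "{y\<in>C. y u = i \<and> y v = j} = {y\<in>Alt n. (\<forall>s\<in>S. y s = x s) \<and> y u = i \<and> y v = j}"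
    by (auto simp: C_def)
  ultimately show ?thesis by (simp add: F_def)
qed (simp only: sum.empty)

text \<open>
  Double transpositions generate the alternating group on at least five points: two transpositions
  that overlap become double transpositions after inserting a third one, twice, on two further points.
\<close>

lemma invariant_under_even_permutations:
  fixes \<phi> :: "(nat \<Rightarrow> nat) \<Rightarrow> 'b"
  assumes T: "T \<subseteq> {1..n}" "card T \<ge> 5"
    and invar: "\<And>y a b c d. y \<in> Alt n \<Longrightarrow> distinct [a, b, c, d] \<Longrightarrow> {a, b, c, d} \<subseteq> T \<Longrightarrow> \<phi> (y \<circ> dtransp a b c d) = \<phi> y"
    and h: "h permutes T" "evenperm h" and y: "y \<in> Alt n"
  shows "\<phi> (y \<circ> h) = \<phi> y"
proof -
  have fT: "finite T" using T finite_subset by blast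
  have two: "\<phi> (y \<circ> transpose a b \<circ> transpose p q) = \<phi> y"
    if y: "y \<in> Alt n" and P: "{a, b, p, q} \<subseteq> T" "a \<noteq> b" "p \<noteq> q" for y a b p q
  proof (cases "distinct [a, b, p, q]")
    case True
    then show ?thesis using invar[OF y True P(1)] by (simp add: dtransp_def comp_assoc)
  next
    case False
    then have "{a, b, p, q} \<subseteq> {a, b, p} \<or> {a, b, p, q} \<subseteq> {a, b, q}" using P by auto
    then have "card {a, b, p, q} \<le> 3"
      using card_mono[of "{a, b, p}" "{a, b, p, q}"] card_mono[of "{a, b, q}" "{a, b, p, q}"]
        card_length[of "[a, b, p]"] card_length[of "[a, b, q]"] by auto
    then have "card (T - {a, b, p, q}) \<ge> 2"
      using P T(2) by (subst card_Diff_subset) auto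
    then obtain zs where zs: "distinct zs" "set zs \<subseteq> T - {a, b, p, q}" "length zs = 2"
      using finite_distinct_list_take[of "T - {a, b, p, q}" 2] fT by auto
    then obtain r s where "zs = [r, s]"
      by (auto simp: length_Suc_conv numeral_eq_Suc)
    with zs P have D: "distinct [a, b, r, s]" "{a, b, r, s} \<subseteq> T" "distinct [r, s, p, q]" "{r, s, p, q} \<subseteq> T" by auto
    have y': "y \<circ> dtransp a b r s \<in> Alt n"
      using y D T by (intro Alt_comp dtransp_Alt) auto
    have "y \<circ> transpose a b \<circ> transpose p q = (y \<circ> dtransp a b r s) \<circ> dtransp r s p q"
      by (rule ext) (simp add: dtransp_def)
    then show ?thesis using invar[OF y' D(3,4)] invar[OF y D(1,2)] by simp
  qed
  have "(evenperm h \<longrightarrow> (\<forall>y\<in>Alt n. \<phi> (y \<circ> h) = \<phi> y)) \<and>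
    (\<not> evenperm h \<longrightarrow> (\<forall>y\<in>Alt n. \<forall>p\<in>T. \<forall>q\<in>T. p \<noteq> q \<longrightarrow> \<phi> (y \<circ> h \<circ> transpose p q) = \<phi> y))"
    using fT h(1)
  proof (induction rule: permutes_rev_induct)
    case id then show ?case by simp
  next
    case (swap a b h)
    have ph: "permutation h" using swap fT permutation_permutes by blast
    have ev: "evenperm (h \<circ> transpose a b) \<longleftrightarrow> \<not> evenperm h"
      using swap ph by (simp add: evenperm_comp permutation_swap_id evenperm_swap)
    show ?case
    proof (cases "evenperm h")
      case True
      have hA: "h \<in> Alt n"
        using True permutes_subset[of h T "{1..n}"] swap T by (simp add: alt_group_carrier)
      have "\<phi> (y \<circ> (h \<circ> transpose a b) \<circ> transpose p q) = \<phi> y"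
        if "y \<in> Alt n" "p \<in> T" "q \<in> T" "p \<noteq> q" for y p q
        using two[of "y \<circ> h" a b p q] that swap True Alt_comp[OF that(1) hA] by (simp add: comp_assoc)
      then show ?thesis using ev True by blast
    next
      case False
      then have "\<forall>y\<in>Alt n. \<phi> (y \<circ> h \<circ> transpose a b) = \<phi> y"
        using swap by blast
      then show ?thesis using ev False by (metis comp_assoc)
    qed
  qed
  then show ?thesis using h(2) y by blast
qed

text \<open>
  The fibre sums with one, two, three and four prescribed values vanish in turn. For a double
  transposition \<open>a\<close> the difference \<open>g - g \<circ> a\<close> is invariant under all even permutations of the
  points off \<open>a\<close>, hence constant on the fibres over the four points of \<open>a\<close>, where its sum is zero.
  So \<open>g\<close> is invariant under every double transposition, constant on \<open>A\<^sub>n\<close>, and of mean zero.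
\<close>

lemma second_difference_free_vanishes:
  fixes g :: "(nat \<Rightarrow> nat) \<Rightarrow> real"
  assumes n: "n \<ge> 10" and sd: "second_difference_free n g"
    and z: "\<And>u i. u \<in> {1..n} \<Longrightarrow> sum g {y\<in>Alt n. y u = i} = 0"
    and y: "y \<in> Alt n"
  shows "g y = 0"
proof -
  have l2: "sum g {y\<in>Alt n. y u = i \<and> y v = j} = 0"
    if "{u, v} \<subseteq> {1..n}" "u \<noteq> v" for u v i j
    using fibre_sum_two_more_points[OF sd, of "{}" id u v i j] z n that by simp
  have l3: "sum g {y\<in>Alt n. y w = k \<and> y u = i \<and> y v = j} = 0"
    if "{u, v, w} \<subseteq> {1..n}" "distinct [u, v, w]" for u v w i j k
    using fibre_sum_two_more_points[OF sd, of "{w}" "\<lambda>_. k" u v i j] l2 n that by simp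
  have l4: "sum g {y\<in>Alt n. y w = k \<and> y w' = k' \<and> y u = i \<and> y v = j} = 0"
    if d: "{u, v, w, w'} \<subseteq> {1..n}" "distinct [u, v, w, w']" for u v w w' i j k k'
  proof -
    have "sum g {y\<in>Alt n. (\<forall>s\<in>{w, w'}. y s = (id(w := k, w' := k')) s) \<and> y u = i \<and> y v = j} = 0"
    proof (rule fibre_sum_two_more_points[OF sd])
      fix z l assume "z \<in> {1..n} - {w, w'}"
      then show "sum g {y\<in>Alt n. (\<forall>s\<in>{w, w'}. y s = (id(w := k, w' := k')) s) \<and> y z = l} = 0"
        using l3[of w' z w k k' l] d by (simp add: conj_assoc)
    qed (use d n in auto)
    then show ?thesis using d by (simp add: conj_assoc)
  qed
  have invar: "g (y \<circ> dtransp a b c d) = g y"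
    if y: "y \<in> Alt n" and D: "distinct [a, b, c, d]" "{a, b, c, d} \<subseteq> {1..n}" for y a b c d
  proof -
    let ?a = "dtransp a b c d"
    define T where "T = {1..n} - {a, b, c, d}"
    have cT: "card T \<ge> 5" unfolding T_def using D n by (subst card_Diff_subset) auto
    define \<Delta> where "\<Delta> y = g y - g (y \<circ> ?a)" for y
    have aA: "?a \<in> Alt n" by (rule dtransp_Alt[OF D])
    have const: "\<Delta> (y \<circ> h) = \<Delta> y" if h: "h permutes T" "evenperm h" "y \<in> Alt n" for y h
    proof (rule invariant_under_even_permutations[OF _ cT _ h])
      show "T \<subseteq> {1..n}" by (auto simp: T_def)
      fix y a' b' c' d' assume y: "y \<in> Alt n" and D': "distinct [a', b', c', d']" "{a', b', c', d'} \<subseteq> T"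
      have DD: "distinct [a, b, c, d, a', b', c', d']" "{a, b, c, d, a', b', c', d'} \<subseteq> {1..n}"
        using D D' by (auto simp: T_def)
      have "y \<circ> dtransp a' b' c' d' \<circ> ?a = y \<circ> ?a \<circ> dtransp a' b' c' d'"
        using dtransp_commute[OF DD(1)] by (simp add: comp_assoc)
      then show "\<Delta> (y \<circ> dtransp a' b' c' d') = \<Delta> y"
        using sd[unfolded second_difference_free_def, rule_format, OF DD y] by (simp add: \<Delta>_def)
    qed
    define C where "C = {z\<in>Alt n. z a = y a \<and> z b = y b \<and> z c = y c \<and> z d = y d}"
    have fC: "finite C" "y \<in> C" using finite_Alt y by (auto simp: C_def)
    have "\<Delta> z = \<Delta> y" if "z \<in> C" for z
    proof -
      have zA: "z \<in> Alt n" using that by (simp add: C_def)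
      define h where "h = inv' y \<circ> z"
      have hA: "h \<in> Alt n" unfolding h_def using zA y by (intro Alt_comp Alt_inv)
      have "h s = s" if "s \<in> {a, b, c, d}" for s
        using \<open>z \<in> C\<close> that Alt_inv_apply[OF y] by (auto simp: h_def C_def)
      then have "h permutes T"
        using permutes_superset[of h "{1..n}" T] Alt_permutes[OF hA] by (auto simp: T_def)
      then have "\<Delta> (y \<circ> h) = \<Delta> y" using const hA y by (simp add: alt_group_carrier)
      moreover have "y \<circ> h = z" using Alt_inv_o[OF y] by (simp add: h_def flip: comp_assoc)
      ultimately show ?thesis by simp
    qed
    then have "sum \<Delta> C = card C * \<Delta> y" by simp
    moreover have "sum \<Delta> C = sum g C - (\<Sum>z\<in>C. g (z \<circ> ?a))"
      by (simp add: \<Delta>_def sum_subtractf)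
    moreover have "sum g C = 0" unfolding C_def using l4[of c d a b] D by auto
    moreover have "(\<Sum>z\<in>C. g (z \<circ> ?a)) = sum g {z\<in>Alt n. z b = y a \<and> z a = y b \<and> z d = y c \<and> z c = y d}"
      by (rule sum.reindex_bij_witness[where i = "\<lambda>z. z \<circ> ?a" and j = "\<lambda>z. z \<circ> ?a"])
        (use aA D dtransp_simps[OF D(1)] in \<open>auto simp: C_def comp_assoc dtransp_involution intro: Alt_comp\<close>)
    moreover have "sum g {z\<in>Alt n. z b = y a \<and> z a = y b \<and> z d = y c \<and> z c = y d} = 0"
      using l4[of d c b a] D by auto
    ultimately have "card C * \<Delta> y = 0" by simp
    moreover have "card C \<noteq> 0" using fC by auto
    ultimately show ?thesis by (simp add: \<Delta>_def)
  qed
  have const: "g y = g id" if y: "y \<in> Alt n" for y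
  proof -
    have "g (id \<circ> y) = g id"
    proof (rule invariant_under_even_permutations[where T = "{1..n}" and n = n and \<phi> = g])
      show "y permutes {1..n}" "evenperm y" using y by (simp_all only: alt_group_carrier)
    qed (use n Alt_id invar in simp_all)
    then show ?thesis by simp
  qed
  have "sum g {y\<in>Alt n. y 1 = 1} = card {y\<in>Alt n. y 1 = 1} * g id"
    by (subst sum.cong[OF refl const]) auto
  then have "card {y\<in>Alt n. y 1 = 1} * g id = 0" using z[of 1 1] n by simp
  moreover have "id \<in> {y\<in>Alt n. y 1 = 1}" using Alt_id by simp
  then have "card {y\<in>Alt n. y 1 = 1} \<noteq> 0" using finite_Alt by auto
  ultimately show ?thesis using const[OF y] by simp
qed

section \<open>Right-invariant spaces contain many orthogonal functions\<close>

text \<open>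
  Disjoint blocks of four points. The points of a block are listed in order, because the order
  singles out one of the three double transpositions of the block, and reordering changes it.
\<close>

definition block_system :: "nat \<Rightarrow> nat \<Rightarrow> (nat \<Rightarrow> nat \<Rightarrow> nat) \<Rightarrow> bool" where
  "block_system n B pt \<longleftrightarrow> (\<forall>b<B. \<forall>r<4. pt b r \<in> {1..n}) \<and>
     (\<forall>b<B. \<forall>r<4. \<forall>c<B. \<forall>s<4. pt b r = pt c s \<longrightarrow> b = c \<and> r = s)"

definition block_inv :: "(nat \<Rightarrow> nat \<Rightarrow> nat) \<Rightarrow> nat \<Rightarrow> nat \<Rightarrow> nat" where
  "block_inv pt b = dtransp (pt b 0) (pt b 1) (pt b 2) (pt b 3)"

lemma block_system_in: "block_system n B pt \<Longrightarrow> b < B \<Longrightarrow> r < 4 \<Longrightarrow> pt b r \<in> {1..n}"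
  by (simp add: block_system_def)

lemma block_system_eq:
  "block_system n B pt \<Longrightarrow> b < B \<Longrightarrow> r < 4 \<Longrightarrow> c < B \<Longrightarrow> s < 4 \<Longrightarrow> pt b r = pt c s \<longleftrightarrow> b = c \<and> r = s"
  unfolding block_system_def by blast

lemma block_distinct:
  assumes "block_system n B pt" "b < B"
  shows "distinct [pt b 0, pt b 1, pt b 2, pt b 3]" "{pt b 0, pt b 1, pt b 2, pt b 3} \<subseteq> {1..n}"
  using block_system_eq[OF assms(1)] block_system_in[OF assms] assms(2) by simp_all

lemma blocks_distinct:
  assumes "block_system n B pt" "b < B" "c < B" "b \<noteq> c"
  shows "distinct [pt b 0, pt b 1, pt b 2, pt b 3, pt c 0, pt c 1, pt c 2, pt c 3]"
proof -
  have x: "pt b r \<noteq> pt c s" if "r < 4" "s < 4" for r s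
    using block_system_eq[OF assms(1,2) that(1) assms(3) that(2)] assms(4) by simp
  have "distinct ([pt b 0, pt b 1, pt b 2, pt b 3] @ [pt c 0, pt c 1, pt c 2, pt c 3])"
    unfolding distinct_append
    using block_distinct(1)[OF assms(1,2)] block_distinct(1)[OF assms(1,3)] by (simp add: x)
  then show ?thesis by (simp only: append.simps)
qed

lemma block_inv_Alt: "block_system n B pt \<Longrightarrow> b < B \<Longrightarrow> block_inv pt b \<in> Alt n"
  unfolding block_inv_def by (intro dtransp_Alt block_distinct)

lemma block_inv_involution: "block_system n B pt \<Longrightarrow> b < B \<Longrightarrow> block_inv pt b \<circ> block_inv pt b = id"
  unfolding block_inv_def by (intro dtransp_involution block_distinct)

lemma block_inv_commute:
  "block_system n B pt \<Longrightarrow> b < B \<Longrightarrow> c < B \<Longrightarrow> b \<noteq> c \<Longrightarrow>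
    block_inv pt b \<circ> block_inv pt c = block_inv pt c \<circ> block_inv pt b"
  unfolding block_inv_def by (intro dtransp_commute blocks_distinct)

lemma block_system_extending:
  assumes D: "distinct [a, b, c, d, a', b', c', d']" "{a, b, c, d, a', b', c', d'} \<subseteq> {1..n}"
    and B: "4 * B \<le> n"
  obtains pt where "block_system n B pt" "block_inv pt 0 = dtransp a b c d" "block_inv pt 1 = dtransp a' b' c' d'"
proof -
  define xs where "xs = [a, b, c, d, a', b', c', d']"
  have xs: "distinct xs" "set xs \<subseteq> {1..n}"
    using D unfolding xs_def by (simp_all only: list.set)
  obtain ys where ys: "set ys = {1..n} - set xs" "distinct ys"
    using finite_distinct_list[of "{1..n} - set xs"] by (metis finite_Diff finite_atLeastAtMost)
  define L where "L = xs @ ys"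
  have dL: "distinct L" unfolding L_def distinct_append using xs(1) ys by blast
  have sL: "set L = {1..n}" unfolding L_def set_append ys(1) using xs(2) by blast
  have lL: "length L = n" using distinct_card[OF dL] sL by simp
  define pt where "pt b r = L ! (4 * b + r)" for b r
  have "block_system n B pt"
    unfolding block_system_def
  proof (intro conjI allI impI)
    fix b r assume "b < B" "r < (4::nat)"
    then have "4 * b + r < length L" using B lL by simp
    then show "pt b r \<in> {1..n}" using nth_mem[of "4 * b + r" L] sL by (simp add: pt_def)
    fix c s assume "c < B" "s < (4::nat)" "pt b r = pt c s"
    then have "4 * b + r = 4 * c + s"
      using nth_eq_iff_index_eq[OF dL, of "4 * b + r" "4 * c + s"] \<open>b < B\<close> \<open>r < 4\<close> B lL by (simp add: pt_def)
    then show "b = c" "r = s" using \<open>r < 4\<close> \<open>s < 4\<close> by presburger+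
  qed
  then show thesis
    by (rule that) (simp_all add: block_inv_def pt_def L_def xs_def)
qed

lemma block_system_relabel:
  assumes "block_system n B pt" "b < B" "\<sigma> permutes {..<4}"
  shows "block_system n B (pt(b := pt b \<circ> \<sigma>))"
proof -
  have s: "\<sigma> r < 4 \<longleftrightarrow> r < 4" for r using permutes_in_image[OF assms(3), of r] by simp
  have i: "\<sigma> r = \<sigma> s \<longleftrightarrow> r = s" for r s using permutes_inj[OF assms(3)] by (auto dest: injD)
  show ?thesis
    unfolding block_system_def using block_system_in[OF assms(1)] block_system_eq[OF assms(1)] assms(2) s i
    by (auto split: if_splits)
qed

definition right_eigen :: "nat \<Rightarrow> (nat \<Rightarrow> nat) \<Rightarrow> real \<Rightarrow> ((nat \<Rightarrow> nat) \<Rightarrow> real) \<Rightarrow> bool" where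
  "right_eigen n a c f \<longleftrightarrow> (\<forall>y\<in>Alt n. f (y \<circ> a) = c * f y)"

lemma right_eigen_average:
  assumes e: "right_eigen n t c f" and a: "a \<in> Alt n" and comm: "a \<circ> t = t \<circ> a"
  shows "right_eigen n t c (\<lambda>y. f y + f (y \<circ> a))"
  unfolding right_eigen_def
proof
  fix y assume y: "y \<in> Alt n"
  have "f (y \<circ> t \<circ> a) = f (y \<circ> a \<circ> t)" using comm by (simp add: comp_assoc)
  also have "\<dots> = c * f (y \<circ> a)" using e Alt_comp[OF y a] by (simp add: right_eigen_def)
  finally show "f (y \<circ> t) + f (y \<circ> t \<circ> a) = c * (f y + f (y \<circ> a))"
    using e y by (simp add: right_eigen_def distrib_left)
qed

lemma right_eigen_average_self:
  assumes a: "a \<circ> a = id"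
  shows "right_eigen n a 1 (\<lambda>y. f y + f (y \<circ> a))"
  unfolding right_eigen_def using a by (simp add: comp_assoc)

locale right_invariant_space =
  fixes n :: nat and E :: "((nat \<Rightarrow> nat) \<Rightarrow> real) set"
  assumes add: "\<And>f g. f \<in> E \<Longrightarrow> g \<in> E \<Longrightarrow> (\<lambda>y. f y + g y) \<in> E"
    and scale: "\<And>f c. f \<in> E \<Longrightarrow> (\<lambda>y. c * f y) \<in> E"
    and translate: "\<And>f h. f \<in> E \<Longrightarrow> h \<in> Alt n \<Longrightarrow> (\<lambda>y. f (y \<circ> h)) \<in> E"
begin

text \<open>
  One of the three double transpositions of block \<open>k\<close> fixes a nonzero vector with the same
  eigenvalues on the earlier blocks: average over one of them if that does not give zero, and if two
  of them negate \<open>f\<close> then the third, their product, fixes \<open>f\<close>. Relabelling the points of the block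
  makes it the distinguished one.
\<close>

lemma block_fixed_vector_step:
  assumes bs: "block_system n B pt" and k: "k < B"
    and f: "f \<in> E" "\<exists>y\<in>Alt n. f y \<noteq> 0"
    and eig: "\<And>b. b < k \<Longrightarrow> right_eigen n (block_inv pt b) (\<chi> b) f"
  shows "\<exists>pt' f'. block_system n B pt' \<and> f' \<in> E \<and> (\<exists>y\<in>Alt n. f' y \<noteq> 0) \<and>
    (\<forall>b<k. right_eigen n (block_inv pt' b) (\<chi> b) f') \<and> right_eigen n (block_inv pt' k) 1 f'"
proof -
  have average: ?thesis
    if s: "\<sigma> permutes {..<4}" and nz: "\<exists>y\<in>Alt n. f y + f (y \<circ> block_inv (pt(k := pt k \<circ> \<sigma>)) k) \<noteq> 0" for \<sigma>
  proof -
    define pt' where "pt' = pt(k := pt k \<circ> \<sigma>)"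
    define a where "a = block_inv pt' k"
    have bs': "block_system n B pt'" unfolding pt'_def by (rule block_system_relabel[OF bs k s])
    have aA: "a \<in> Alt n" unfolding a_def by (rule block_inv_Alt[OF bs' k])
    define f' where "f' y = f y + f (y \<circ> a)" for y
    have "right_eigen n (block_inv pt' b) (\<chi> b) f'" if b: "b < k" for b
      unfolding f'_def
    proof (rule right_eigen_average[OF _ aA])
      show "right_eigen n (block_inv pt' b) (\<chi> b) f"
        using eig[OF b] b by (simp add: block_inv_def pt'_def)
      show "a \<circ> block_inv pt' b = block_inv pt' b \<circ> a"
        unfolding a_def by (rule block_inv_commute[OF bs']) (use b k in auto)
    qed
    moreover have "right_eigen n a 1 f'"
      unfolding f'_def by (rule right_eigen_average_self) (unfold a_def, rule block_inv_involution[OF bs' k])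
    moreover have "f' \<in> E" unfolding f'_def by (intro add translate f aA)
    moreover have "\<exists>y\<in>Alt n. f' y \<noteq> 0" using nz by (simp add: f'_def a_def pt'_def)
    ultimately show ?thesis using bs' by (auto simp: a_def)
  qed
  let ?p = "pt k"
  have D: "distinct [?p 0, ?p 1, ?p 2, ?p 3]" by (rule block_distinct[OF bs k])
  have D': "distinct [?p 0, ?p 2, ?p 1, ?p 3]" "distinct [?p 0, ?p 3, ?p 2, ?p 1]" using D by auto
  consider "\<exists>y\<in>Alt n. f y + f (y \<circ> block_inv pt k) \<noteq> 0"
    | "\<exists>y\<in>Alt n. f y + f (y \<circ> dtransp (?p 0) (?p 2) (?p 1) (?p 3)) \<noteq> 0"
    | "\<forall>y\<in>Alt n. f y + f (y \<circ> block_inv pt k) = 0"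
      "\<forall>y\<in>Alt n. f y + f (y \<circ> dtransp (?p 0) (?p 2) (?p 1) (?p 3)) = 0" by blast
  then show ?thesis
  proof cases
    case 1
    show ?thesis by (rule average[of id]) (use 1 in \<open>simp_all add: permutes_id\<close>)
  next
    case 2
    show ?thesis by (rule average[of "transpose 1 2"]) (use 2 in \<open>simp_all add: permutes_swap_id block_inv_def\<close>)
  next
    case 3
    \<comment> \<open>The product of the two involutions that negate \<open>f\<close> is the third one of the block, and it fixes \<open>f\<close>.\<close>
    have prod: "dtransp (?p 0) (?p 2) (?p 1) (?p 3) \<circ> block_inv pt k = dtransp (?p 0) (?p 3) (?p 2) (?p 1)"
    proof
      fix x
      show "(dtransp (?p 0) (?p 2) (?p 1) (?p 3) \<circ> block_inv pt k) x = dtransp (?p 0) (?p 3) (?p 2) (?p 1) x"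
        unfolding block_inv_def
        using dtransp_simps[OF D] dtransp_simps[OF D'(1)] dtransp_simps[OF D'(2)]
        by (cases "x \<in> {?p 0, ?p 1, ?p 2, ?p 3}") auto
    qed
    have aA: "dtransp (?p 0) (?p 2) (?p 1) (?p 3) \<in> Alt n"
      by (rule dtransp_Alt[OF D'(1)]) (use block_distinct[OF bs k] in auto)
    have "f (y \<circ> dtransp (?p 0) (?p 3) (?p 2) (?p 1)) = f y" if y: "y \<in> Alt n" for y
    proof -
      have "f (y \<circ> dtransp (?p 0) (?p 2) (?p 1) (?p 3) \<circ> block_inv pt k) = f y"
        using bspec[OF 3(1) Alt_comp[OF y aA]] bspec[OF 3(2) y] by simp
      then show ?thesis using prod by (simp add: comp_assoc)
    qed
    then have 4: "\<exists>y\<in>Alt n. f y + f (y \<circ> dtransp (?p 0) (?p 3) (?p 2) (?p 1)) \<noteq> 0" using f(2) by auto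
    show ?thesis by (rule average[of "transpose 1 3"]) (use 4 in \<open>simp_all add: permutes_swap_id block_inv_def\<close>)
  qed
qed

text \<open>
  The function \<open>(1 - a) (1 - a') f\<close> is negated by \<open>a\<close> and by \<open>a'\<close>. The two carry the first two blocks, and the
  remaining blocks are treated one at a time.
\<close>

lemma block_eigenvector:
  assumes nsd: "f \<in> E" "\<not> second_difference_free n f" and B: "2 \<le> B" "4 * B \<le> n" and k: "k \<le> B - 2"
  shows "\<exists>pt f. block_system n B pt \<and> f \<in> E \<and> (\<exists>y\<in>Alt n. f y \<noteq> 0) \<and>
    (\<forall>b<2 + k. right_eigen n (block_inv pt b) (if b < 2 then -1 else 1) f)"
  using k
proof (induction k)
  case 0
  obtain a b c d a' b' c' d' y0 where D: "distinct [a, b, c, d, a', b', c', d']"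
    "{a, b, c, d, a', b', c', d'} \<subseteq> {1..n}" and y0: "y0 \<in> Alt n"
    "f y0 - f (y0 \<circ> dtransp a b c d) - f (y0 \<circ> dtransp a' b' c' d')
        + f (y0 \<circ> dtransp a b c d \<circ> dtransp a' b' c' d') \<noteq> 0"
    using nsd(2) unfolding second_difference_free_def not_all not_imp ball_simps
    by (elim exE bexE conjE) (rule that)
  obtain pt where pt: "block_system n B pt" "block_inv pt 0 = dtransp a b c d" "block_inv pt 1 = dtransp a' b' c' d'"
    using block_system_extending[OF D B(2)] .
  define s where "s = block_inv pt 0"
  define t where "t = block_inv pt 1"
  have st: "s \<in> Alt n" "t \<in> Alt n" "s \<circ> s = id" "t \<circ> t = id" "s \<circ> t = t \<circ> s"
    unfolding s_def t_def using block_inv_Alt[OF pt(1)] block_inv_involution[OF pt(1)] block_inv_commute[OF pt(1)] B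
    by auto
  define h where "h y = (f y + -1 * f (y \<circ> s)) + -1 * (f (y \<circ> t) + -1 * f (y \<circ> s \<circ> t))" for y
  have "h \<in> E" unfolding h_def comp_assoc by (intro add scale translate nsd(1) st Alt_comp)
  moreover have "\<exists>y\<in>Alt n. h y \<noteq> 0"
    using y0 unfolding h_def s_def t_def pt(2,3) by (intro bexI[of _ y0]) auto
  moreover have "right_eigen n s (-1) h"
  proof -
    have ss: "s \<circ> (s \<circ> t) = t" by (simp only: st(3) flip: comp_assoc) simp
    show ?thesis unfolding right_eigen_def h_def comp_assoc ss st(3) by simp
  qed
  moreover have "right_eigen n t (-1) h"
  proof -
    have ts: "t \<circ> (s \<circ> t) = s" unfolding st(5) by (simp only: st(4) flip: comp_assoc) simp
    show ?thesis unfolding right_eigen_def h_def comp_assoc ts st(4) st(5)[symmetric] by simp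
  qed
  ultimately have "block_system n B pt \<and> h \<in> E \<and> (\<exists>y\<in>Alt n. h y \<noteq> 0) \<and>
    (\<forall>b<2 + 0. right_eigen n (block_inv pt b) (if b < 2 then -1 else 1) h)"
    using pt(1) by (auto simp: s_def t_def less_2_cases_iff)
  then show ?case by blast
next
  case (Suc k)
  then obtain pt f where IH: "block_system n B pt" "f \<in> E" "\<exists>y\<in>Alt n. f y \<noteq> 0"
    "\<And>b. b < 2 + k \<Longrightarrow> right_eigen n (block_inv pt b) (if b < 2 then -1 else 1) f" by auto
  have "2 + k < B" using Suc.prems B(1) by linarith
  from block_fixed_vector_step[OF IH(1) this IH(2,3) IH(4)]
  obtain pt' f' where S: "block_system n B pt'" "f' \<in> E" "\<exists>y\<in>Alt n. f' y \<noteq> 0"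
    "\<And>b. b < 2 + k \<Longrightarrow> right_eigen n (block_inv pt' b) (if b < 2 then -1 else 1) f'"
    "right_eigen n (block_inv pt' (2 + k)) 1 f'"
    by blast
  have "right_eigen n (block_inv pt' b) (if b < 2 then -1 else 1) f'" if "b < 2 + Suc k" for b
  proof (cases "b = 2 + k")
    case False
    then show ?thesis using S(4) that by simp
  qed (use S(5) in simp)
  then show ?case using S(1-3) by blast
qed

end

text \<open>
  Four transpositions, hence an even permutation, whatever the two blocks are.
\<close>

definition block_swap :: "(nat \<Rightarrow> nat \<Rightarrow> nat) \<Rightarrow> nat \<Rightarrow> nat \<Rightarrow> nat \<Rightarrow> nat" where
  "block_swap pt b c = (transpose (pt b 0) (pt c 0) \<circ> transpose (pt b 1) (pt c 1)) \<circ>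
     (transpose (pt b 2) (pt c 2) \<circ> transpose (pt b 3) (pt c 3))"

lemma block_swap_Alt:
  assumes "block_system n B pt" "b < B" "c < B"
  shows "block_swap pt b c \<in> Alt n"
proof (cases "b = c")
  case True
  then show ?thesis using Alt_id by (simp add: block_swap_def)
next
  case False
  then show ?thesis
    unfolding block_swap_def
    using block_system_eq[OF assms(1)] block_system_in[OF assms(1)] assms(2,3)
    by (intro Alt_comp Alt_two_transpositions) (auto simp del: One_nat_def)
qed

lemma block_swap_apply:
  assumes bs: "block_system n B pt" and b: "b < B" "c < B" "e < B" and r: "r < 4"
  shows "block_swap pt b c (pt e r) = pt (transpose b c e) r"
proof (cases "b = c")
  case False
  have tr: "transpose (pt b s) (pt c s) (pt e' r) = pt (if s = r then transpose b c e' else e') r"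
    if "s < 4" "e' < B" for s e'
    using block_system_eq[OF bs] that b r by (simp add: transpose_def)
  have tB: "transpose b c e < B" using b by (simp add: transpose_def)
  have "r = 0 \<or> r = 1 \<or> r = 2 \<or> r = 3" using r by auto
  then show ?thesis
    unfolding block_swap_def using tr tB b by (auto simp del: One_nat_def)
qed (simp add: block_swap_def)

lemma dtransp_conj:
  assumes "h \<in> Alt n"
  shows "dtransp (h a) (h b) (h c) (h d) \<circ> h = h \<circ> dtransp a b c d"
proof
  fix x
  show "(dtransp (h a) (h b) (h c) (h d) \<circ> h) x = (h \<circ> dtransp a b c d) x"
    using Alt_eq_iff[OF assms] by (simp add: dtransp_def transpose_def)
qed

lemma right_eigen_orthogonal:
  assumes u: "right_eigen n a (-1) u" and v: "right_eigen n a 1 v" and a: "a \<in> Alt n"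
  shows "(\<Sum>y\<in>Alt n. u y * v y) = 0"
proof -
  have "(\<Sum>y\<in>Alt n. u y * v y) = (\<Sum>y\<in>Alt n. u (y \<circ> a) * v (y \<circ> a))"
    by (rule sum_Alt_right[OF a, of "\<lambda>y. u y * v y", symmetric])
  also have "\<dots> = - (\<Sum>y\<in>Alt n. u y * v y)"
    using u v by (simp add: right_eigen_def sum_negf)
  finally show ?thesis by simp
qed

text \<open>
  The function found above is negated by the double transpositions of blocks \<open>0\<close> and \<open>1\<close> and fixed by
  all others. Moving block \<open>0\<close> to an even and block \<open>1\<close> to an odd position gives functions that are
  distinguished by the set of blocks on which the eigenvalue is \<open>- 1\<close>.
\<close>

lemma (in right_invariant_space) many_orthogonal_vectors:
  assumes nsd: "f \<in> E" "\<not> second_difference_free n f" and M: "1 \<le> M" "8 * M \<le> n"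
  obtains \<phi> where "\<And>i. i \<in> {..<M} \<times> {..<M} \<Longrightarrow> \<phi> i \<in> E"
    "\<And>i. i \<in> {..<M} \<times> {..<M} \<Longrightarrow> (\<Sum>y\<in>Alt n. (\<phi> i y)\<^sup>2) \<noteq> 0"
    "\<And>i j. i \<in> {..<M} \<times> {..<M} \<Longrightarrow> j \<in> {..<M} \<times> {..<M} \<Longrightarrow> i \<noteq> j \<Longrightarrow> (\<Sum>y\<in>Alt n. \<phi> i y * \<phi> j y) = 0"
proof -
  define B where "B = 2 * M"
  have B: "2 \<le> B" "4 * B \<le> n" using M by (auto simp: B_def)
  have "2 + (B - 2) = B" using B by simp
  then obtain pt h where bs: "block_system n B pt" and h: "h \<in> E" "\<exists>y\<in>Alt n. h y \<noteq> 0"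
    and eig: "\<And>b. b < B \<Longrightarrow> right_eigen n (block_inv pt b) (if b < 2 then -1 else 1) h"
    using block_eigenvector[OF nsd B order_refl] by auto
  define \<sigma> where "\<sigma> i = transpose 0 (2 * fst i) \<circ> transpose 1 (2 * snd i + 1)" for i :: "nat \<times> nat"
  define \<pi> where "\<pi> i = block_swap pt 0 (2 * fst i) \<circ> block_swap pt 1 (2 * snd i + 1)" for i :: "nat \<times> nat"
  define \<phi> where "\<phi> i y = h (y \<circ> \<pi> i)" for i y
  have rng: "2 * fst i < B" "2 * snd i + 1 < B" if "i \<in> {..<M} \<times> {..<M}" for i
    using that by (auto simp: B_def)
  have piA: "\<pi> i \<in> Alt n" if "i \<in> {..<M} \<times> {..<M}" for i
    unfolding \<pi>_def using rng[OF that] B by (intro Alt_comp block_swap_Alt[OF bs]) auto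
  have sB: "\<sigma> i b < B" if "i \<in> {..<M} \<times> {..<M}" "b < B" for i b
    unfolding \<sigma>_def using rng[OF that(1)] that(2) B by (auto simp: transpose_def)
  have pi_pt: "\<pi> i (pt b r) = pt (\<sigma> i b) r" if i: "i \<in> {..<M} \<times> {..<M}" "b < B" "r < 4" for i b r
  proof -
    have "transpose 1 (2 * snd i + 1) b < B" using rng[OF i(1)] i(2) B by (auto simp: transpose_def)
    then show ?thesis
      using block_swap_apply[OF bs] rng[OF i(1)] i(2,3) B by (simp add: \<pi>_def \<sigma>_def)
  qed
  have eig\<phi>: "right_eigen n (block_inv pt (\<sigma> i b)) (if b < 2 then -1 else 1) (\<phi> i)"
    if i: "i \<in> {..<M} \<times> {..<M}" "b < B" for i b
    unfolding right_eigen_def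
  proof
    fix y assume y: "y \<in> Alt n"
    have "block_inv pt (\<sigma> i b) \<circ> \<pi> i = \<pi> i \<circ> block_inv pt b"
      unfolding block_inv_def using pi_pt[OF i] dtransp_conj[OF piA[OF i(1)], of "pt b 0" "pt b 1" "pt b 2" "pt b 3"]
      by simp
    then have "\<phi> i (y \<circ> block_inv pt (\<sigma> i b)) = h (y \<circ> \<pi> i \<circ> block_inv pt b)"
      by (simp add: \<phi>_def comp_assoc)
    also have "\<dots> = (if b < 2 then -1 else 1) * \<phi> i y"
      using eig[OF i(2)] Alt_comp[OF y piA[OF i(1)]] by (simp add: right_eigen_def \<phi>_def)
    finally show "\<phi> i (y \<circ> block_inv pt (\<sigma> i b)) = (if b < 2 then -1 else 1) * \<phi> i y" .
  qed
  have neg: "right_eigen n (block_inv pt (2 * fst i)) (-1) (\<phi> i)"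
    "right_eigen n (block_inv pt (2 * snd i + 1)) (-1) (\<phi> i)" if i: "i \<in> {..<M} \<times> {..<M}" for i
    using eig\<phi>[OF i, of 0] eig\<phi>[OF i, of 1] B by (auto simp: \<sigma>_def transpose_def split: if_splits)
  have pos: "right_eigen n (block_inv pt c) 1 (\<phi> i)"
    if i: "i \<in> {..<M} \<times> {..<M}" and c: "c < B" "c \<noteq> 2 * fst i" "c \<noteq> 2 * snd i + 1" for i c
  proof -
    define b where "b = transpose 1 (2 * snd i + 1) (transpose 0 (2 * fst i) c)"
    have "\<sigma> i b = c" by (simp add: \<sigma>_def b_def)
    moreover have "b < B" using rng[OF i] c B by (auto simp: b_def transpose_def)
    moreover have "\<not> b < 2"
    proof
      assume "b < 2"
      then have "b = 0 \<or> b = 1" by auto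
      then have "\<sigma> i b = 2 * fst i \<or> \<sigma> i b = 2 * snd i + 1"
        by (auto simp: \<sigma>_def transpose_def) presburger
      then show False using \<open>\<sigma> i b = c\<close> c by auto
    qed
    ultimately show ?thesis using eig\<phi>[OF i, of b] by auto
  qed
  show thesis
  proof
    fix i assume i: "i \<in> {..<M} \<times> {..<M}"
    show "\<phi> i \<in> E" unfolding \<phi>_def by (intro translate h piA i)
    have "(\<Sum>y\<in>Alt n. (\<phi> i y)\<^sup>2) = (\<Sum>y\<in>Alt n. (h y)\<^sup>2)"
      unfolding \<phi>_def by (rule sum_Alt_right[OF piA[OF i], of "\<lambda>y. (h y)\<^sup>2"])
    then show "(\<Sum>y\<in>Alt n. (\<phi> i y)\<^sup>2) \<noteq> 0"
      using h(2) finite_Alt[of n] by (auto simp: sum_nonneg_eq_0_iff)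
    fix j assume j: "j \<in> {..<M} \<times> {..<M}" and ij: "i \<noteq> j"
    have "fst i \<noteq> fst j \<or> snd i \<noteq> snd j" using ij by (auto simp: prod_eq_iff)
    then show "(\<Sum>y\<in>Alt n. \<phi> i y * \<phi> j y) = 0"
    proof
      assume "fst i \<noteq> fst j"
      then have "2 * fst i \<noteq> 2 * fst j" "2 * fst i \<noteq> 2 * snd j + 1" by presburger+
      then show ?thesis
        using right_eigen_orthogonal[OF neg(1)[OF i] pos[OF j rng(1)[OF i]]] block_inv_Alt[OF bs rng(1)[OF i]] by simp
    next
      assume "snd i \<noteq> snd j"
      then have "2 * snd i + 1 \<noteq> 2 * fst j" "2 * snd i + 1 \<noteq> 2 * snd j + 1" by presburger+
      then show ?thesis
        using right_eigen_orthogonal[OF neg(2)[OF i] pos[OF j rng(2)[OF i]]] block_inv_Alt[OF bs rng(2)[OF i]] by simp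
    qed
  qed
qed

section \<open>Convolution by functions orthogonal to the linear functions\<close>

lemma marginal_of_translate:
  assumes mz: "\<And>i j. i \<in> {1..n} \<Longrightarrow> j \<in> {1..n} \<Longrightarrow> sum f {y\<in>Alt n. y j = i} = (0::real)"
    and x: "x \<in> Alt n" and u: "u \<in> {1..n}"
  shows "(\<Sum>y\<in>{y\<in>Alt n. y u = i}. f (x \<circ> inv' y)) = 0"
proof (cases "i \<in> {1..n}")
  case True
  have bij: "bij y" if "y \<in> Alt n" for y using permutes_bij[OF Alt_permutes[OF that]] .
  have ii: "inv' (x \<circ> inv' y) \<circ> x = y" "x \<circ> inv' (inv' y \<circ> x) = y" if "y \<in> Alt n" for y
  proof -
    have "inv' (x \<circ> inv' y) = y \<circ> inv' x" "inv' (inv' y \<circ> x) = inv' x \<circ> y"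
      using bij[OF x] bij[OF that] by (simp_all add: o_inv_distrib bij_imp_bij_inv inv_inv_eq)
    then show "inv' (x \<circ> inv' y) \<circ> x = y" "x \<circ> inv' (inv' y \<circ> x) = y"
      using Alt_inv_o[OF x] by (simp_all add: comp_assoc) (simp_all flip: comp_assoc)
  qed
  have "(\<Sum>y\<in>{y\<in>Alt n. y u = i}. f (x \<circ> inv' y)) = sum f {y\<in>Alt n. y i = x u}"
  proof (rule sum.reindex_bij_witness[where i = "\<lambda>w. inv' w \<circ> x" and j = "\<lambda>y. x \<circ> inv' y"])
    fix y assume "y \<in> {y\<in>Alt n. y u = i}"
    then have y: "y \<in> Alt n" "y u = i" by auto
    show "inv' (x \<circ> inv' y) \<circ> x = y" using ii y by simp
    show "x \<circ> inv' y \<in> {y\<in>Alt n. y i = x u}"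
      using y x Alt_inv_apply[OF y(1)] by (auto intro!: Alt_comp Alt_inv)
  next
    fix w assume "w \<in> {y\<in>Alt n. y i = x u}"
    then have w: "w \<in> Alt n" "w i = x u" by auto
    show "x \<circ> inv' (inv' w \<circ> x) = w" using ii w by simp
    show "inv' w \<circ> x \<in> {y\<in>Alt n. y u = i}"
      using w x Alt_inv_apply[OF w(1)] by (auto intro!: Alt_comp Alt_inv simp flip: w(2))
  qed auto
  also have "\<dots> = 0" using mz[OF Alt_in[OF x u] True] .
  finally show ?thesis .
next
  case False
  then have "{y\<in>Alt n. y u = i} = {}" using Alt_in u by auto
  then show ?thesis by (simp only: sum.empty)
qed

text \<open>
  The top singular space of convolution by \<open>f\<close> is right-invariant, because convolution on the left
  commutes with right translation, and is orthogonal to the linear functions, because they are in the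
  kernel. So its dimension is at least \<open>M\<^sup>2\<close>.
\<close>

lemma convolution_norm_bound:
  fixes f u :: "(nat \<Rightarrow> nat) \<Rightarrow> real"
  assumes n: "n \<ge> 10" and M: "1 \<le> M" "8 * M \<le> n"
    and mz: "\<And>i j. i \<in> {1..n} \<Longrightarrow> j \<in> {1..n} \<Longrightarrow> sum f {y\<in>Alt n. y j = i} = 0"
  shows "(real M)\<^sup>2 * (\<Sum>x\<in>Alt n. (\<Sum>y\<in>Alt n. f (x \<circ> inv' y) * u y)\<^sup>2)
    \<le> card (Alt n) * (\<Sum>y\<in>Alt n. (f y)\<^sup>2) * (\<Sum>y\<in>Alt n. (u y)\<^sup>2)"
proof -
  define K where "K x y = f (x \<circ> inv' y)" for x y :: "nat \<Rightarrow> nat"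
  have "Alt n \<noteq> {}" using Alt_id by auto
  then obtain s g where
    sb: "\<And>u. (\<Sum>x\<in>Alt n. (\<Sum>y\<in>Alt n. K x y * u y)\<^sup>2) \<le> s * (\<Sum>y\<in>Alt n. (u y)\<^sup>2)"
    and sg: "\<And>y. y \<in> Alt n \<Longrightarrow> (\<Sum>x\<in>Alt n. K x y * (\<Sum>z\<in>Alt n. K x z * g z)) = s * g y"
    and g1: "(\<Sum>y\<in>Alt n. (g y)\<^sup>2) = 1"
    using top_singular_vector[OF finite_Alt, of n K] by blast
  have s0: "s \<ge> 0" using order_trans[OF sum_nonneg sb[of g]] g1 by simp
  have HS: "(\<Sum>x\<in>Alt n. \<Sum>y\<in>Alt n. (K x y)\<^sup>2) = card (Alt n) * (\<Sum>y\<in>Alt n. (f y)\<^sup>2)"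
  proof -
    have "(\<Sum>x\<in>Alt n. (K x y)\<^sup>2) = (\<Sum>y\<in>Alt n. (f y)\<^sup>2)" if y: "y \<in> Alt n" for y
      unfolding K_def by (rule sum_Alt_right[OF Alt_inv[OF y], of "\<lambda>y. (f y)\<^sup>2"])
    then show ?thesis by (subst sum.swap) simp
  qed
  have KK: "K (x \<circ> k) (y \<circ> k) = K x y" if "x \<in> Alt n" "y \<in> Alt n" "k \<in> Alt n" for x y k
  proof -
    have "inv' (y \<circ> k) = inv' k \<circ> inv' y"
      using that by (intro o_inv_distrib permutes_bij[OF Alt_permutes]) 
    then have "x \<circ> k \<circ> inv' (y \<circ> k) = x \<circ> (k \<circ> inv' k) \<circ> inv' y" by (simp add: comp_assoc)
    then show ?thesis using Alt_inv_o[OF that(3)] by (simp add: K_def)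
  qed
  define E where "E = {h. \<forall>y\<in>Alt n. (\<Sum>x\<in>Alt n. K x y * (\<Sum>z\<in>Alt n. K x z * h z)) = s * h y}"
  interpret right_invariant_space n E
  proof
    fix h h' assume "h \<in> E" "h' \<in> E"
    then show "(\<lambda>y. h y + h' y) \<in> E"
      by (simp add: E_def distrib_left sum.distrib)
  next
    fix h and c :: real assume h: "h \<in> E"
    have "(\<Sum>x\<in>Alt n. K x y * (\<Sum>z\<in>Alt n. K x z * (c * h z))) = c * (\<Sum>x\<in>Alt n. K x y * (\<Sum>z\<in>Alt n. K x z * h z))" for y
      by (simp add: sum_distrib_left mult_ac)
    then show "(\<lambda>y. c * h y) \<in> E" using h by (simp add: E_def)
  next
    fix h k assume h: "h \<in> E" and k: "k \<in> Alt n"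
    have "(\<Sum>x\<in>Alt n. K x y * (\<Sum>z\<in>Alt n. K x z * h (z \<circ> k))) = s * h (y \<circ> k)" if y: "y \<in> Alt n" for y
    proof -
      have "(\<Sum>x\<in>Alt n. K x y * (\<Sum>z\<in>Alt n. K x z * h (z \<circ> k)))
         = (\<Sum>x\<in>Alt n. K (x \<circ> k) (y \<circ> k) * (\<Sum>z\<in>Alt n. K (x \<circ> k) (z \<circ> k) * h (z \<circ> k)))"
        using KK y k by simp
      also have "\<dots> = (\<Sum>x\<in>Alt n. K (x \<circ> k) (y \<circ> k) * (\<Sum>z\<in>Alt n. K (x \<circ> k) z * h z))"
        by (intro sum.cong refl arg_cong2[where f = "(*)"] sum_Alt_right[OF k])
      also have "\<dots> = (\<Sum>x\<in>Alt n. K x (y \<circ> k) * (\<Sum>z\<in>Alt n. K x z * h z))"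
        by (rule sum_Alt_right[OF k, of "\<lambda>x. K x (y \<circ> k) * (\<Sum>z\<in>Alt n. K x z * h z)"])
      also have "\<dots> = s * h (y \<circ> k)" using h Alt_comp[OF y k] by (simp add: E_def)
      finally show ?thesis .
    qed
    then show "(\<lambda>y. h (y \<circ> k)) \<in> E" by (simp add: E_def)
  qed
  have bound: "(real M)\<^sup>2 * s \<le> card (Alt n) * (\<Sum>y\<in>Alt n. (f y)\<^sup>2)"
  proof (cases "s = 0")
    case True then show ?thesis by (simp add: sum_nonneg)
  next
    case False
    have gE: "g \<in> E" using sg by (simp add: E_def)
    have marg: "sum g {y\<in>Alt n. y u = i} = 0" if u: "u \<in> {1..n}" for u i
    proof -
      have "s * sum g {y\<in>Alt n. y u = i} = (\<Sum>y\<in>{y\<in>Alt n. y u = i}. \<Sum>x\<in>Alt n. K x y * (\<Sum>z\<in>Alt n. K x z * g z))"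
        using sg by (simp add: sum_distrib_left)
      also have "\<dots> = (\<Sum>x\<in>Alt n. (\<Sum>y\<in>{y\<in>Alt n. y u = i}. K x y) * (\<Sum>z\<in>Alt n. K x z * g z))"
        by (subst sum.swap) (simp add: sum_distrib_right)
      also have "\<dots> = 0"
        using marginal_of_translate[OF mz _ u] by (intro sum.neutral) (simp add: K_def)
      finally show ?thesis using False by simp
    qed
    have "\<not> second_difference_free n g"
    proof
      assume "second_difference_free n g"
      then have "g y = 0" if "y \<in> Alt n" for y
        using second_difference_free_vanishes[OF n] marg that by blast
      then show False using g1 by simp
    qed
    then obtain \<phi> where \<phi>: "\<And>i. i \<in> {..<M} \<times> {..<M} \<Longrightarrow> \<phi> i \<in> E"
      "\<And>i. i \<in> {..<M} \<times> {..<M} \<Longrightarrow> (\<Sum>y\<in>Alt n. (\<phi> i y)\<^sup>2) \<noteq> 0"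
      "\<And>i j. i \<in> {..<M} \<times> {..<M} \<Longrightarrow> j \<in> {..<M} \<times> {..<M} \<Longrightarrow> i \<noteq> j \<Longrightarrow> (\<Sum>y\<in>Alt n. \<phi> i y * \<phi> j y) = 0"
      using many_orthogonal_vectors[OF gE _ M] by blast
    have "s * card ({..<M} \<times> {..<M}) \<le> (\<Sum>x\<in>Alt n. \<Sum>y\<in>Alt n. (K x y)\<^sup>2)"
      by (rule eigenspace_multiplicity_bound[OF finite_Alt _ _ \<phi>(2,3)]) (use \<phi>(1) in \<open>auto simp: E_def\<close>)
    then show ?thesis unfolding HS by (simp add: power2_eq_square mult_ac)
  qed
  have "(real M)\<^sup>2 * (\<Sum>x\<in>Alt n. (\<Sum>y\<in>Alt n. K x y * u y)\<^sup>2) \<le> (real M)\<^sup>2 * (s * (\<Sum>y\<in>Alt n. (u y)\<^sup>2))"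
    by (intro mult_left_mono sb) simp
  also have "\<dots> = ((real M)\<^sup>2 * s) * (\<Sum>y\<in>Alt n. (u y)\<^sup>2)" by simp
  also have "\<dots> \<le> (card (Alt n) * (\<Sum>y\<in>Alt n. (f y)\<^sup>2)) * (\<Sum>y\<in>Alt n. (u y)\<^sup>2)"
    by (intro mult_right_mono bound) (simp add: sum_nonneg)
  finally show ?thesis by (simp add: K_def)
qed

section \<open>The linear part of an indicator function\<close>

lemma sum_by_value:
  assumes S: "finite S" "\<And>y. y \<in> S \<Longrightarrow> y \<in> Alt n" and j: "j \<in> {1..n}"
  shows "(\<Sum>y\<in>S. h (y j) * k y) = (\<Sum>i\<in>{1..n}. h i * (\<Sum>y\<in>{y\<in>S. y j = i}. (k y :: real)))"
proof -
  have "(\<Sum>i\<in>{1..n}. \<Sum>y\<in>{y\<in>S. y j = i}. h (y j) * k y) = (\<Sum>y\<in>S. h (y j) * k y)"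
  proof (rule sum.group)
    show "(\<lambda>y. y j) ` S \<subseteq> {1..n}" using Alt_in[OF S(2) j] by blast
  qed (use S in auto)
  then show ?thesis by (simp add: sum_distrib_left)
qed

text \<open>
  Left multiplication by the double transposition of \<open>i\<close>, \<open>i'\<close> and two points other than \<open>l\<close>.
\<close>

lemma card_fixing_value_shift:
  assumes n: "n \<ge> 5" and ij: "i \<in> {1..n}" "i' \<in> {1..n}" "i \<noteq> l" "i' \<noteq> l"
  shows "card {y\<in>Alt n. y k = l \<and> y j = i} = card {y\<in>Alt n. y k = l \<and> y j = i'}"
proof (cases "i = i'")
  case False
  have "card ({1..n} - {i, i', l}) \<ge> 2"
    using n diff_card_le_card_Diff[of "{i, i', l}" "{1..n}"] card_length[of "[i, i', l]"] by auto
  then obtain zs where zs: "distinct zs" "set zs \<subseteq> {1..n} - {i, i', l}" "length zs = 2"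
    using finite_distinct_list_take[of "{1..n} - {i, i', l}" 2] by auto
  then obtain a b where "zs = [a, b]"
    by (auto simp: length_Suc_conv numeral_eq_Suc)
  with zs have ab: "distinct [i, i', a, b]" "{i, i', a, b} \<subseteq> {1..n}" "l \<notin> {i, i', a, b}" 
    using False ij by auto
  define h where "h = dtransp i i' a b"
  have hA: "h \<in> Alt n" unfolding h_def by (rule dtransp_Alt[OF ab(1,2)])
  have hh: "h \<circ> h = id" unfolding h_def by (rule dtransp_involution[OF ab(1)])
  have hv: "h l = l" "h i = i'" "h i' = i" unfolding h_def using dtransp_simps[OF ab(1)] ab(3) by blast+
  show ?thesis
  proof (rule bij_betw_same_card[where f = "\<lambda>y. h \<circ> y"], rule bij_betw_byWitness[where f' = "\<lambda>y. h \<circ> y"])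
    show "\<forall>y\<in>{y\<in>Alt n. y k = l \<and> y j = i}. h \<circ> (h \<circ> y) = y"
      "\<forall>y\<in>{y\<in>Alt n. y k = l \<and> y j = i'}. h \<circ> (h \<circ> y) = y"
      using hh by (simp_all flip: comp_assoc)
    show "(\<circ>) h ` {y\<in>Alt n. y k = l \<and> y j = i} \<subseteq> {y\<in>Alt n. y k = l \<and> y j = i'}"
      "(\<circ>) h ` {y\<in>Alt n. y k = l \<and> y j = i'} \<subseteq> {y\<in>Alt n. y k = l \<and> y j = i}"
      using hv by (auto intro!: Alt_comp[OF hA])
  qed
qed simp

lemma card_one_value:
  assumes n: "n \<ge> 5" and k: "k \<in> {1..n}" and l: "l \<in> {1..n}"
  shows "real (card {y\<in>Alt n. y k = l}) = card (Alt n) / n"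
proof -
  have eq: "card {y\<in>Alt n. y k = i} = card {y\<in>Alt n. y k = l}" if i: "i \<in> {1..n}" for i
  proof -
    \<comment> \<open>The point \<open>0\<close> lies outside \<open>{1..n}\<close>, so \<open>y 0 = 0\<close> prescribes nothing.\<close>
    have "y 0 = 0" if "y \<in> Alt n" for y using permutes_not_in[OF Alt_permutes[OF that]] by simp
    then have "{y\<in>Alt n. y 0 = 0 \<and> y k = m} = {y\<in>Alt n. y k = m}" for m by auto
    then show ?thesis using card_fixing_value_shift[OF n i l, of 0 0 k] i l by simp
  qed
  have "real (card (Alt n)) = (\<Sum>i\<in>{1..n}. real (card {y\<in>Alt n. y k = i}))"
    using sum_by_value[of "Alt n" n k "\<lambda>_. 1" "\<lambda>_. 1"] finite_Alt k by simp
  also have "\<dots> = n * real (card {y\<in>Alt n. y k = l})" using eq by simp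
  finally show ?thesis using n by simp
qed

lemma card_two_values:
  assumes n: "n \<ge> 5" and kj: "k \<in> {1..n}" "j \<in> {1..n}" "k \<noteq> j" and li: "l \<in> {1..n}" "i \<in> {1..n}" "i \<noteq> l"
  shows "real (card {y\<in>Alt n. y k = l \<and> y j = i}) = card (Alt n) / (real n * (real n - 1))"
proof -
  define c where "c i = real (card {y\<in>Alt n. y k = l \<and> y j = i})" for i
  have eq: "c i' = c i" if i: "i' \<in> {1..n} - {l}" for i'
    unfolding c_def using card_fixing_value_shift[OF n, of i' i l k j] i li by simp
  have False if "y \<in> Alt n" "y k = l" "y j = l" for y
    using Alt_eq_iff[OF that(1), of k j] that(2,3) kj(3) by simp
  then have "{y\<in>Alt n. y k = l \<and> y j = l} = {}" by blast
  then have cl: "c l = 0" unfolding c_def by (simp only: card.empty of_nat_0)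
  have "real (card {y\<in>Alt n. y k = l}) = (\<Sum>i\<in>{1..n}. c i)"
  proof -
    define S where "S = {y\<in>Alt n. y k = l}"
    have "(\<Sum>y\<in>S. (1::real) * 1) = (\<Sum>i\<in>{1..n}. 1 * (\<Sum>y\<in>{y\<in>S. y j = i}. 1))"
      by (rule sum_by_value[OF _ _ kj(2)]) (simp_all add: S_def finite_Alt)
    moreover have "{y\<in>S. y j = i} = {y\<in>Alt n. y k = l \<and> y j = i}" for i by (simp add: S_def conj_assoc)
    ultimately show ?thesis by (simp add: c_def S_def)
  qed
  also have "\<dots> = c l + (\<Sum>i\<in>{1..n} - {l}. c i)" using li by (intro sum.remove) auto
  also have "(\<Sum>i\<in>{1..n} - {l}. c i) = (\<Sum>i'\<in>{1..n} - {l}. c i)" by (intro sum.cong refl eq)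
  also have "c l + \<dots> = (real n - 1) * c i" using cl li(1) n by (simp add: of_nat_diff)
  finally have "(real n - 1) * c i = card (Alt n) / n" using card_one_value[OF n kj(1) li(1)] by simp
  then show ?thesis using n by (simp add: c_def field_simps)
qed

abbreviation alt_density :: "nat \<Rightarrow> (nat \<Rightarrow> nat) set \<Rightarrow> real" where
  "alt_density n X \<equiv> set_density (alt_group n) X"

lemma alt_density_eq: "alt_density n X = card X / card (Alt n)"
  by (simp add: set_density_def order_def)

definition deviation :: "nat \<Rightarrow> (nat \<Rightarrow> nat) set \<Rightarrow> nat \<Rightarrow> nat \<Rightarrow> real" where
  "deviation n X i j = card {x\<in>X. x j = i} / card (Alt n) - alt_density n X / n"

text \<open>
  The orthogonal projection of the indicator of \<open>X\<close> to the span of the functions \<open>[x j = i]\<close>: its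
  difference from the indicator is orthogonal to all of them (\<open>linear_residual_marginal\<close>).
\<close>

definition linear_part :: "nat \<Rightarrow> (nat \<Rightarrow> nat) set \<Rightarrow> (nat \<Rightarrow> nat) \<Rightarrow> real" where
  "linear_part n X x = alt_density n X + (real n - 1) * (\<Sum>j\<in>{1..n}. deviation n X (x j) j)"

lemma card_Alt_pos: "0 < card (Alt n)"
  using Alt_id finite_Alt by (auto simp: card_gt_0_iff)

lemma finite_subset_Alt: "X \<subseteq> Alt n \<Longrightarrow> finite X"
  using finite_Alt finite_subset by blast

lemma card_by_value:
  assumes "X \<subseteq> Alt n" "j \<in> {1..n}"
  shows "(\<Sum>i\<in>{1..n}. real (card {x\<in>X. x j = i})) = card X"
proof -
  have "(\<Sum>x\<in>X. (1::real) * 1) = (\<Sum>i\<in>{1..n}. 1 * (\<Sum>x\<in>{x\<in>X. x j = i}. 1))"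
    by (rule sum_by_value) (use assms finite_subset_Alt in auto)
  then show ?thesis by simp
qed

lemma card_by_position:
  assumes X: "X \<subseteq> Alt n" and i: "i \<in> {1..n}"
  shows "(\<Sum>j\<in>{1..n}. real (card {x\<in>X. x j = i})) = card X"
proof -
  have "(\<Sum>j\<in>{1..n}. \<Sum>x\<in>{x\<in>X. inv' x i = j}. 1) = (\<Sum>x\<in>X. (1::real))"
  proof (rule sum.group)
    show "(\<lambda>x. inv' x i) ` X \<subseteq> {1..n}" using Alt_in[OF Alt_inv i] X by blast
  qed (use X finite_subset_Alt in auto)
  moreover have "{x\<in>X. inv' x i = j} = {x\<in>X. x j = i}" for j
    using X Alt_inv_apply by (auto simp: subset_iff)
  ultimately show ?thesis by simp
qed

lemma deviation_sum_values:
  assumes "X \<subseteq> Alt n" "j \<in> {1..n}"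
  shows "(\<Sum>i\<in>{1..n}. deviation n X i j) = 0"
  using card_by_value[OF assms] assms(2)
  by (simp add: deviation_def sum_subtractf alt_density_eq sum_divide_distrib[symmetric])

lemma deviation_sum_positions:
  assumes "X \<subseteq> Alt n" "i \<in> {1..n}"
  shows "(\<Sum>j\<in>{1..n}. deviation n X i j) = 0"
  using card_by_position[OF assms] assms(2)
  by (simp add: deviation_def sum_subtractf alt_density_eq sum_divide_distrib[symmetric])

text \<open>
  On the permutations with \<open>y k = l\<close> each other value \<open>y j\<close> is uniform on the values different from
  \<open>l\<close>, so its contribution averages to \<open>- D l j / (n - 1)\<close> by the zero column sums. By the zero row sums
  these add up to \<open>D l k / (n - 1)\<close>, and with \<open>D l k\<close> from \<open>j = k\<close> the factor \<open>n - 1\<close> makes the total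
  \<open>n D l k\<close>.
\<close>

lemma linear_part_marginal:
  assumes n: "n \<ge> 5" and X: "X \<subseteq> Alt n" and k: "k \<in> {1..n}" and l: "l \<in> {1..n}"
  shows "sum (linear_part n X) {y\<in>Alt n. y k = l} = card {x\<in>X. x k = l}"
proof -
  let ?A = "real (card (Alt n))"
  let ?S = "{y\<in>Alt n. y k = l}"
  let ?D = "deviation n X"
  have one: "(\<Sum>y\<in>?S. ?D (y k) k) = ?A / n * ?D l k"
    using card_one_value[OF n k l] by simp
  have two: "(\<Sum>y\<in>?S. ?D (y j) j) = - (?A / (real n * (real n - 1)) * ?D l j)" if j: "j \<in> {1..n} - {k}" for j
  proof -
    have jn: "j \<in> {1..n}" and kj: "k \<noteq> j" using j by auto
    have False if "y \<in> Alt n" "y k = l" "y j = l" for y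
      using Alt_eq_iff[OF that(1), of k j] that(2,3) kj by simp
    then have "{y\<in>?S. y j = l} = {}" by blast
    then have z: "real (card {y\<in>?S. y j = l}) = 0" by (simp only: card.empty of_nat_0)
    have "(\<Sum>y\<in>?S. ?D (y j) j * 1) = (\<Sum>i\<in>{1..n}. ?D i j * (\<Sum>y\<in>{y\<in>?S. y j = i}. 1))"
      by (rule sum_by_value[OF _ _ jn, where h = "\<lambda>i. ?D i j"]) (use finite_Alt in auto)
    also have "\<dots> = (\<Sum>i\<in>{1..n}. ?D i j * real (card {y\<in>?S. y j = i}))" by simp
    also have "\<dots> = ?D l j * real (card {y\<in>?S. y j = l}) + (\<Sum>i\<in>{1..n} - {l}. ?D i j * real (card {y\<in>?S. y j = i}))"
      using l by (intro sum.remove) auto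
    also have "\<dots> = (\<Sum>i\<in>{1..n} - {l}. ?D i j * (?A / (real n * (real n - 1))))"
      unfolding z using card_two_values[OF n k jn kj l] by (simp add: conj_assoc)
    also have "\<dots> = (\<Sum>i\<in>{1..n} - {l}. ?D i j) * (?A / (real n * (real n - 1)))"
      by (simp only: sum_distrib_right)
    also have "(\<Sum>i\<in>{1..n} - {l}. ?D i j) = - ?D l j"
      using deviation_sum_values[OF X jn] sum.remove[of "{1..n}" l "\<lambda>i. ?D i j"] l by simp
    finally show ?thesis by simp
  qed
  have "(\<Sum>y\<in>?S. \<Sum>j\<in>{1..n}. ?D (y j) j) = (\<Sum>j\<in>{1..n}. \<Sum>y\<in>?S. ?D (y j) j)"
    by (rule sum.swap)
  also have "\<dots> = (\<Sum>y\<in>?S. ?D (y k) k) + (\<Sum>j\<in>{1..n} - {k}. \<Sum>y\<in>?S. ?D (y j) j)"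
    using k by (intro sum.remove) auto
  also have "\<dots> = ?A / n * ?D l k - ?A / (real n * (real n - 1)) * (\<Sum>j\<in>{1..n} - {k}. ?D l j)"
    unfolding one using two by (simp add: sum_negf sum_distrib_left)
  also have "(\<Sum>j\<in>{1..n} - {k}. ?D l j) = - ?D l k"
    using deviation_sum_positions[OF X l] sum.remove[of "{1..n}" k "?D l"] k by simp
  also have "?A / n * ?D l k - ?A / (real n * (real n - 1)) * - ?D l k = ?A / (real n - 1) * ?D l k"
    using n by (simp add: field_simps)
  finally have s: "(\<Sum>y\<in>?S. \<Sum>j\<in>{1..n}. ?D (y j) j) = ?A / (real n - 1) * ?D l k" .
  have "sum (linear_part n X) ?S = card ?S * alt_density n X + (real n - 1) * (\<Sum>y\<in>?S. \<Sum>j\<in>{1..n}. ?D (y j) j)"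
    by (simp add: linear_part_def sum.distrib sum_distrib_left)
  also have "\<dots> = ?A / n * alt_density n X + ?A * ?D l k"
    unfolding s card_one_value[OF n k l] using n by simp
  also have "\<dots> = card {x\<in>X. x k = l}"
    using card_Alt_pos[of n] by (simp add: deviation_def field_simps)
  finally show ?thesis .
qed

lemma linear_residual_marginal:
  assumes n: "n \<ge> 5" and X: "X \<subseteq> Alt n" and k: "k \<in> {1..n}" and l: "l \<in> {1..n}"
  shows "(\<Sum>y\<in>{y\<in>Alt n. y k = l}. indicator X y - linear_part n X y) = 0"
proof -
  have "(\<Sum>y\<in>{y\<in>Alt n. y k = l}. indicator X y :: real) = card ({y\<in>Alt n. y k = l} \<inter> X)"
    using finite_Alt[of n] by (simp add: indicator_def of_bool_def sum.If_cases Int_def)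
  also have "{y\<in>Alt n. y k = l} \<inter> X = {x\<in>X. x k = l}" using X by auto
  finally show ?thesis using linear_part_marginal[OF assms] by (simp add: sum_subtractf)
qed

text \<open>
  Pythagoras for the orthogonal decomposition of the indicator of \<open>X\<close>. The squared norm of the linear
  part is \<open>\<alpha>\<^sup>2\<close> plus \<open>n - 1\<close> times that of the deviation matrix.
\<close>

lemma linear_residual_bounds:
  assumes n: "n \<ge> 5" and X: "X \<subseteq> Alt n"
  shows "(\<Sum>y\<in>Alt n. (indicator X y - linear_part n X y)\<^sup>2) \<le> card X"
    and "(real n - 1) * (\<Sum>i\<in>{1..n}. \<Sum>j\<in>{1..n}. (deviation n X i j)\<^sup>2) \<le> alt_density n X"
proof -
  let ?A = "real (card (Alt n))" and ?L = "linear_part n X" and ?D = "deviation n X"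
  let ?R = "\<lambda>y. indicator X y - ?L y"
  let ?\<alpha> = "alt_density n X"
  have fX: "finite X" using X finite_subset_Alt by blast
  have fib: "(\<Sum>y\<in>Alt n. ?D (y j) j * ?R y) = 0" if j: "j \<in> {1..n}" for j
    using sum_by_value[OF finite_Alt _ j, of n "\<lambda>i. ?D i j" ?R] linear_residual_marginal[OF n X j] by simp
  have tot: "(\<Sum>y\<in>Alt n. ?R y) = 0"
  proof -
    have 1: "1 \<in> {1..n}" using n by simp
    show ?thesis
      using sum_by_value[OF finite_Alt _ 1, of n "\<lambda>_. 1" ?R] linear_residual_marginal[OF n X 1] by simp
  qed
  have RL: "(\<Sum>y\<in>Alt n. ?R y * ?L y) = 0"
  proof -
    have "(\<Sum>y\<in>Alt n. r y * ?L y) = ?\<alpha> * (\<Sum>y\<in>Alt n. r y)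
        + (real n - 1) * (\<Sum>y\<in>Alt n. \<Sum>j\<in>{1..n}. ?D (y j) j * r y)" for r
      by (simp add: linear_part_def distrib_left sum.distrib sum_distrib_left mult_ac)
    also have "(\<Sum>y\<in>Alt n. \<Sum>j\<in>{1..n}. ?D (y j) j * ?R y) = 0"
      using fib by (subst sum.swap) simp
    finally show ?thesis using tot by simp
  qed
  have XL: "(\<Sum>y\<in>Alt n. indicator X y * h y) = (\<Sum>x\<in>X. h x :: real)" for h
    using X finite_Alt by (simp add: indicator_def sum.If_cases Int_absorb1 if_distrib[of "\<lambda>c. c * _"] cong: if_cong)
  have L2: "(\<Sum>y\<in>Alt n. (?L y)\<^sup>2) = (\<Sum>x\<in>X. ?L x)"
  proof -
    have "(\<Sum>y\<in>Alt n. ?R y * ?L y) = (\<Sum>y\<in>Alt n. indicator X y * ?L y) - (\<Sum>y\<in>Alt n. (?L y)\<^sup>2)"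
      by (simp add: power2_eq_square left_diff_distrib sum_subtractf)
    then show ?thesis using RL XL[of ?L] by simp
  qed
  have R2: "(\<Sum>y\<in>Alt n. (?R y)\<^sup>2) = card X - (\<Sum>x\<in>X. ?L x)"
  proof -
    have "(\<Sum>y\<in>Alt n. (?R y)\<^sup>2) = (\<Sum>y\<in>Alt n. indicator X y * 1) - (\<Sum>y\<in>Alt n. indicator X y * ?L y) - (\<Sum>y\<in>Alt n. ?R y * ?L y)"
      unfolding sum_subtractf[symmetric]
      by (intro sum.cong refl) (simp add: power2_eq_square indicator_def algebra_simps)
    then show ?thesis using RL unfolding XL by simp
  qed
  have "(\<Sum>x\<in>X. ?L x) \<ge> 0" unfolding L2[symmetric] by (simp add: sum_nonneg)
  then show "(\<Sum>y\<in>Alt n. (?R y)\<^sup>2) \<le> card X" unfolding R2 by simp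
  have "(\<Sum>x\<in>X. ?L x) \<le> card X"
  proof -
    have "0 \<le> (\<Sum>y\<in>Alt n. (?R y)\<^sup>2)" by (simp add: sum_nonneg)
    then show ?thesis unfolding R2 by simp
  qed
  moreover have "(\<Sum>x\<in>X. ?L x) = card X * ?\<alpha> + (real n - 1) * (?A * (\<Sum>i\<in>{1..n}. \<Sum>j\<in>{1..n}. (?D i j)\<^sup>2))"
  proof -
    have "(\<Sum>x\<in>X. \<Sum>j\<in>{1..n}. ?D (x j) j) = (\<Sum>j\<in>{1..n}. \<Sum>x\<in>X. ?D (x j) j)" by (rule sum.swap)
    also have "\<dots> = (\<Sum>j\<in>{1..n}. \<Sum>i\<in>{1..n}. ?D i j * card {x\<in>X. x j = i})"
    proof (intro sum.cong refl)
      fix j assume j: "j \<in> {1..n}"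
      show "(\<Sum>x\<in>X. ?D (x j) j) = (\<Sum>i\<in>{1..n}. ?D i j * card {x\<in>X. x j = i})"
        using sum_by_value[OF fX _ j, of "\<lambda>i. ?D i j" "\<lambda>_. 1"] X by auto
    qed
    also have "\<dots> = (\<Sum>j\<in>{1..n}. \<Sum>i\<in>{1..n}. ?A * (?D i j)\<^sup>2 + ?D i j * (?A * ?\<alpha> / n))"
    proof (intro sum.cong refl)
      fix i j
      have "real (card {x\<in>X. x j = i}) = ?A * ?D i j + ?A * ?\<alpha> / n"
        using card_Alt_pos[of n] by (simp add: deviation_def field_simps)
      then show "?D i j * card {x\<in>X. x j = i} = ?A * (?D i j)\<^sup>2 + ?D i j * (?A * ?\<alpha> / n)"
        by (simp add: power2_eq_square algebra_simps)
    qed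
    also have "\<dots> = ?A * (\<Sum>j\<in>{1..n}. \<Sum>i\<in>{1..n}. (?D i j)\<^sup>2)"
    proof -
      have "(\<Sum>i\<in>{1..n}. ?D i j * (?A * ?\<alpha> / n)) = 0" if "j \<in> {1..n}" for j
        using deviation_sum_values[OF X that] by (simp only: sum_distrib_right[symmetric] mult_zero_left)
      then show ?thesis by (simp only: sum.distrib sum_distrib_left) (simp add: sum_distrib_left)
    qed
    finally have "(\<Sum>x\<in>X. \<Sum>j\<in>{1..n}. ?D (x j) j) = ?A * (\<Sum>i\<in>{1..n}. \<Sum>j\<in>{1..n}. (?D i j)\<^sup>2)"
      by (subst sum.swap)
    then show ?thesis by (simp add: linear_part_def sum.distrib sum_distrib_left[symmetric])
  qed
  moreover have "card X * ?\<alpha> \<ge> 0" by (simp add: alt_density_eq)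
  ultimately have "?A * ((real n - 1) * (\<Sum>i\<in>{1..n}. \<Sum>j\<in>{1..n}. (?D i j)\<^sup>2)) \<le> card X"
    by (simp add: mult_ac)
  then show "(real n - 1) * (\<Sum>i\<in>{1..n}. \<Sum>j\<in>{1..n}. (?D i j)\<^sup>2) \<le> ?\<alpha>"
    using card_Alt_pos[of n] by (simp add: alt_density_eq field_simps)
qed

text \<open>
  Use as weights the relative shortfall \<open>a j i = (n / \<alpha>) max 0 (- D i j)\<close>, which is at most \<open>1\<close>. The
  average of the resulting statistic over \<open>X\<close> falls below its mean by exactly the mean \<open>v\<close> of
  the statistic of \<open>a\<^sup>2\<close>, so the mean deficit bound with \<open>l = 1/16\<close> reads \<open>v / 16 \<le> ln (2 / \<alpha>) + v / 32\<close>. The \<open>2\<close> is the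
  index of \<open>A\<^sub>n\<close> in the symmetric group.
\<close>

lemma negative_deviation_bound:
  assumes n: "n \<ge> 2" and X: "X \<subseteq> Alt n" "X \<noteq> {}"
  shows "(\<Sum>i\<in>{1..n}. \<Sum>j\<in>{1..n}. (max 0 (- deviation n X i j))\<^sup>2)
    \<le> 32 * (alt_density n X)\<^sup>2 * ln (2 / alt_density n X) / n"
proof -
  let ?A = "real (card (Alt n))" and ?\<alpha> = "alt_density n X" and ?D = "deviation n X"
  have fX: "finite X" using X finite_subset_Alt by blast
  have cX: "real (card X) > 0" using X fX by (simp add: card_gt_0_iff)
  have a0: "?\<alpha> > 0" using cX card_Alt_pos[of n] by (simp add: alt_density_eq)
  define c where "c = n / ?\<alpha>"
  have c0: "c > 0" using a0 n by (simp add: c_def)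
  define a where "a j i = c * max 0 (- ?D i j)" for j i
  define S where "S = (\<Sum>j\<in>{1..n}. \<Sum>i\<in>{1..n}. (a j i)\<^sup>2)"
  have a01: "0 \<le> a j i \<and> a j i \<le> 1" for j i
  proof -
    have "- ?D i j \<le> ?\<alpha> / n" using card_Alt_pos[of n] by (simp add: deviation_def)
    then have "max 0 (- ?D i j) \<le> ?\<alpha> / n" using a0 by simp
    then have "c * max 0 (- ?D i j) \<le> c * (?\<alpha> / n)" using c0 by (intro mult_left_mono) auto
    then show ?thesis using c0 a0 n by (simp add: a_def c_def)
  qed
  have XP: "X \<subseteq> {\<pi>. \<pi> permutes {1..n}}" using X Alt_permutes by blast
  have mean: "(\<Sum>\<pi>\<in>X. perm_stat n a \<pi>) / card X = (\<Sum>j\<in>{1..n}. \<Sum>i\<in>{1..n}. a j i) / n - S / n"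
  proof -
    have "(\<Sum>\<pi>\<in>X. perm_stat n a \<pi>) = (\<Sum>j\<in>{1..n}. \<Sum>\<pi>\<in>X. a j (\<pi> j))"
      unfolding perm_stat_def by (rule sum.swap)
    also have "\<dots> = (\<Sum>j\<in>{1..n}. \<Sum>i\<in>{1..n}. a j i * card {x\<in>X. x j = i})"
    proof (intro sum.cong refl)
      fix j assume j: "j \<in> {1..n}"
      show "(\<Sum>x\<in>X. a j (x j)) = (\<Sum>i\<in>{1..n}. a j i * card {x\<in>X. x j = i})"
        using sum_by_value[OF fX _ j, of "a j" "\<lambda>_. 1"] X by auto
    qed
    also have "\<dots> = (\<Sum>j\<in>{1..n}. \<Sum>i\<in>{1..n}. (a j i - (a j i)\<^sup>2) * (card X / n))"
    proof (intro sum.cong refl)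
      fix i j
      have D: "real (card {x\<in>X. x j = i}) = (card X / n) * (1 + c * ?D i j)"
        using card_Alt_pos[of n] cX n by (simp add: deviation_def alt_density_eq c_def field_simps)
      have h: "a j i * (c * ?D i j) = - (a j i)\<^sup>2"
        by (simp add: a_def max_def power2_eq_square)
      have "a j i * card {x\<in>X. x j = i} = (card X / n) * (a j i + a j i * (c * ?D i j))"
        unfolding D by (simp only: distrib_left mult_1_right mult_ac)
      then show "a j i * card {x\<in>X. x j = i} = (a j i - (a j i)\<^sup>2) * (card X / n)"
        unfolding h by (simp only: mult.commute diff_conv_add_uminus)
    qed
    also have "\<dots> = ((\<Sum>j\<in>{1..n}. \<Sum>i\<in>{1..n}. a j i) - S) * (card X / n)"
      by (simp only: S_def sum_subtractf[symmetric] sum_distrib_right)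
    finally show ?thesis using cX by (simp add: diff_divide_distrib)
  qed
  have "(1/16) * (S / n) \<le> ln (fact n / card X) + 8 * (1/16)\<^sup>2 * (S / n)"
    using perm_stat_mean_deficit[of n a "1/16" X] n a01 XP X(2) mean by (simp add: S_def)
  then have "S / n \<le> 32 * ln (fact n / card X)" by (simp add: power2_eq_square)
  also have "fact n / card X = 2 / ?\<alpha>"
  proof -
    have "(fact n :: real) = 2 * ?A"
      using arg_cong[OF alt_group_card_carrier[OF n], of real] by simp
    then show ?thesis by (simp add: alt_density_eq)
  qed
  finally have "S \<le> 32 * ln (2 / ?\<alpha>) * n" using n by (simp add: field_simps)
  moreover have "S = c\<^sup>2 * (\<Sum>i\<in>{1..n}. \<Sum>j\<in>{1..n}. (max 0 (- ?D i j))\<^sup>2)"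
    unfolding S_def a_def by (subst sum.swap) (simp add: power_mult_distrib sum_distrib_left)
  ultimately show ?thesis using a0 n by (simp add: c_def power2_eq_square field_simps)
qed

section \<open>The contribution of the linear part\<close>

lemma trilinear_Cauchy_Schwarz:
  fixes a b c :: "'i \<Rightarrow> 'i \<Rightarrow> real"
  assumes "finite I"
  shows "(\<Sum>i\<in>I. \<Sum>j\<in>I. \<Sum>k\<in>I. a i j * b j k * c i k)
    \<le> sqrt (\<Sum>i\<in>I. \<Sum>j\<in>I. (a i j)\<^sup>2) * sqrt (\<Sum>i\<in>I. \<Sum>j\<in>I. (b i j)\<^sup>2) * sqrt (\<Sum>i\<in>I. \<Sum>j\<in>I. (c i j)\<^sup>2)"
proof -
  let ?t = "\<Sum>i\<in>I. \<Sum>j\<in>I. \<Sum>k\<in>I. a i j * b j k * c i k"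
  let ?d = "\<lambda>(i, j). \<Sum>k\<in>I. b j k * c i k"
  have "?t = (\<Sum>(i, j)\<in>I \<times> I. a i j * (\<Sum>k\<in>I. b j k * c i k))"
    by (simp add: sum.cartesian_product[symmetric] sum_distrib_left mult.assoc)
  also have "\<dots> = (\<Sum>p\<in>I \<times> I. (\<lambda>(i, j). a i j) p * ?d p)"
    by (intro sum.cong) auto
  finally have "?t\<^sup>2 \<le> (\<Sum>p\<in>I \<times> I. ((\<lambda>(i, j). a i j) p)\<^sup>2) * (\<Sum>p\<in>I \<times> I. (?d p)\<^sup>2)"
    by (simp only: Cauchy_Schwarz_ineq_sum)
  also have "(\<Sum>p\<in>I \<times> I. ((\<lambda>(i, j). a i j) p)\<^sup>2) = (\<Sum>i\<in>I. \<Sum>j\<in>I. (a i j)\<^sup>2)"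
    by (simp add: sum.cartesian_product split_def)
  also have "(\<Sum>p\<in>I \<times> I. (?d p)\<^sup>2) = (\<Sum>i\<in>I. \<Sum>j\<in>I. (\<Sum>k\<in>I. b j k * c i k)\<^sup>2)"
    by (simp add: sum.cartesian_product split_def)
  also have "(\<Sum>i\<in>I. \<Sum>j\<in>I. (a i j)\<^sup>2) * (\<Sum>i\<in>I. \<Sum>j\<in>I. (\<Sum>k\<in>I. b j k * c i k)\<^sup>2)
      \<le> (\<Sum>i\<in>I. \<Sum>j\<in>I. (a i j)\<^sup>2) * (\<Sum>i\<in>I. \<Sum>j\<in>I. (\<Sum>k\<in>I. (b j k)\<^sup>2) * (\<Sum>k\<in>I. (c i k)\<^sup>2))"
    by (intro mult_left_mono sum_mono Cauchy_Schwarz_ineq_sum sum_nonneg) auto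
  also have "(\<Sum>i\<in>I. \<Sum>j\<in>I. (\<Sum>k\<in>I. (b j k)\<^sup>2) * (\<Sum>k\<in>I. (c i k)\<^sup>2))
      = (\<Sum>i\<in>I. \<Sum>j\<in>I. (b i j)\<^sup>2) * (\<Sum>i\<in>I. \<Sum>j\<in>I. (c i j)\<^sup>2)"
    unfolding sum_product by (rule sum.swap)
  finally have "?t \<le> sqrt ((\<Sum>i\<in>I. \<Sum>j\<in>I. (a i j)\<^sup>2) * ((\<Sum>i\<in>I. \<Sum>j\<in>I. (b i j)\<^sup>2) * (\<Sum>i\<in>I. \<Sum>j\<in>I. (c i j)\<^sup>2)))"
    by (rule real_le_rsqrt)
  then show ?thesis by (simp add: real_sqrt_mult mult.assoc)
qed

lemma product_lower_bound_negative_parts: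
  fixes x y z :: real
  shows "x * y * z \<ge> - (max 0 (-x) * \<bar>y\<bar> * \<bar>z\<bar> + \<bar>x\<bar> * max 0 (-y) * \<bar>z\<bar> + \<bar>x\<bar> * \<bar>y\<bar> * max 0 (-z))"
proof -
  define p where "p = max 0 (-x) * \<bar>y\<bar> * \<bar>z\<bar>"
  define q where "q = \<bar>x\<bar> * max 0 (-y) * \<bar>z\<bar>"
  define r where "r = \<bar>x\<bar> * \<bar>y\<bar> * max 0 (-z)"
  have nn: "p \<ge> 0" "q \<ge> 0" "r \<ge> 0" by (simp_all add: p_def q_def r_def)
  have ab: "- (x * y * z) \<le> \<bar>x\<bar> * \<bar>y\<bar> * \<bar>z\<bar>" by (simp add: abs_mult[symmetric])
  consider "x \<ge> 0" "y \<ge> 0" "z \<ge> 0" | "x < 0" | "y < 0" | "z < 0" by linarith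
  then have "- (x * y * z) \<le> p + q + r"
  proof cases
    case 1
    then have "0 \<le> x * y * z" by simp
    then show ?thesis using nn by linarith
  next
    case 2
    then have "p = \<bar>x\<bar> * \<bar>y\<bar> * \<bar>z\<bar>" by (simp add: p_def)
    then show ?thesis using nn ab by linarith
  next
    case 3
    then have "q = \<bar>x\<bar> * \<bar>y\<bar> * \<bar>z\<bar>" by (simp add: q_def)
    then show ?thesis using nn ab by linarith
  next
    case 4
    then have "r = \<bar>x\<bar> * \<bar>y\<bar> * \<bar>z\<bar>" by (simp add: r_def)
    then show ?thesis using nn ab by linarith
  qed
  then show ?thesis by (simp add: p_def q_def r_def)
qed

text \<open>
  Only terms with a negative factor pull the sum down, and in those this factor may be replaced by the
  negative part of its matrix.
\<close>

lemma trilinear_lower_bound: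
  fixes a b c :: "'i \<Rightarrow> 'i \<Rightarrow> real"
  assumes I: "finite I"
  defines "N \<equiv> \<lambda>m :: 'i \<Rightarrow> 'i \<Rightarrow> real. sqrt (\<Sum>i\<in>I. \<Sum>j\<in>I. (m i j)\<^sup>2)"
    and "neg \<equiv> \<lambda>(m :: 'i \<Rightarrow> 'i \<Rightarrow> real) i j. max 0 (- m i j)"
  shows "(\<Sum>i\<in>I. \<Sum>j\<in>I. \<Sum>k\<in>I. a i j * b j k * c i k)
    \<ge> - (N (neg a) * N b * N c + N a * N (neg b) * N c + N a * N b * N (neg c))"
proof -
  let ?ab = "\<lambda>(m :: 'i \<Rightarrow> 'i \<Rightarrow> real) i j. \<bar>m i j\<bar>"
  let ?T = "\<lambda>a b c :: 'i \<Rightarrow> 'i \<Rightarrow> real. \<Sum>i\<in>I. \<Sum>j\<in>I. \<Sum>k\<in>I. a i j * b j k * c i k"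
  have Nab: "N (?ab m) = N m" for m by (simp add: N_def)
  have "- (?T (neg a) (?ab b) (?ab c) + ?T (?ab a) (neg b) (?ab c) + ?T (?ab a) (?ab b) (neg c)) \<le> ?T a b c"
    unfolding sum.distrib[symmetric] sum_negf[symmetric] neg_def
    by (intro sum_mono product_lower_bound_negative_parts)
  moreover have "?T (neg a) (?ab b) (?ab c) \<le> N (neg a) * N b * N c"
    using trilinear_Cauchy_Schwarz[OF I, of "neg a" "?ab b" "?ab c"] by (simp add: N_def)
  moreover have "?T (?ab a) (neg b) (?ab c) \<le> N a * N (neg b) * N c"
    using trilinear_Cauchy_Schwarz[OF I, of "?ab a" "neg b" "?ab c"] by (simp add: N_def)
  moreover have "?T (?ab a) (?ab b) (neg c) \<le> N a * N b * N (neg c)"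
    using trilinear_Cauchy_Schwarz[OF I, of "?ab a" "?ab b" "neg c"] by (simp add: N_def)
  ultimately show ?thesis by linarith
qed

text \<open>
  Substituting \<open>k = y\<^sup>-\<^sup>1 j\<close> turns the sum into one over the joint incidences \<open>z k = i\<close>, \<open>y k = j\<close>,
  that is, into a trace of incidence matrices.
\<close>

lemma linear_part_convolution:
  assumes X: "X \<subseteq> Alt n" and Y: "Y \<subseteq> Alt n" and Z: "Z \<subseteq> Alt n"
  shows "(\<Sum>z\<in>Z. \<Sum>y\<in>Y. linear_part n X (z \<circ> inv' y)) = (real (card (Alt n)))\<^sup>2 *
    (alt_density n X * alt_density n Y * alt_density n Z + (real n - 1) *
      (\<Sum>i\<in>{1..n}. \<Sum>j\<in>{1..n}. \<Sum>k\<in>{1..n}. deviation n X i j * deviation n Y j k * deviation n Z i k))"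
proof -
  let ?A = "real (card (Alt n))" and ?I = "{1..n}"
  let ?D = "deviation n X" and ?E = "deviation n Y" and ?F = "deviation n Z"
  let ?\<beta> = "alt_density n Y / n" and ?\<gamma> = "alt_density n Z / n"
  have A0: "?A > 0" using card_Alt_pos by simp
  have fY: "finite Y" and fZ: "finite Z" using Y Z finite_subset_Alt by blast+
  have Yc: "real (card {y\<in>Y. y k = j}) = ?A * (?E j k + ?\<beta>)" for j k
    using A0 by (simp add: deviation_def)
  have Zc: "real (card {z\<in>Z. z k = i}) = ?A * (?F i k + ?\<gamma>)" for i k
    using A0 by (simp add: deviation_def)
  have pos: "(\<Sum>j\<in>?I. ?D (z (inv' y j)) j) = (\<Sum>k\<in>?I. ?D (z k) (y k))" if "y \<in> Alt n" for y z
    using sum.permute[OF Alt_permutes[OF that], of "\<lambda>j. ?D (z (inv' y j)) j"] Alt_inv_apply[OF that]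
    by (simp add: o_def)
  have inner: "(\<Sum>z\<in>Z. \<Sum>y\<in>Y. ?D (z k) (y k)) = (\<Sum>i\<in>?I. \<Sum>j\<in>?I. ?D i j * (?A * (?E j k + ?\<beta>)) * (?A * (?F i k + ?\<gamma>)))"
    if k: "k \<in> ?I" for k
  proof -
    have 1: "(\<Sum>y\<in>Y. ?D i (y k)) = (\<Sum>j\<in>?I. ?D i j * (?A * (?E j k + ?\<beta>)))" for i
      using sum_by_value[OF fY _ k, of "?D i" "\<lambda>_. 1"] Y Yc by (simp add: subset_iff)
    have "(\<Sum>z\<in>Z. \<Sum>y\<in>Y. ?D (z k) (y k)) = (\<Sum>i\<in>?I. (\<Sum>y\<in>Y. ?D i (y k)) * (?A * (?F i k + ?\<gamma>)))"
      using sum_by_value[OF fZ _ k, of "\<lambda>i. \<Sum>y\<in>Y. ?D i (y k)" "\<lambda>_. 1"] Z Zc by (simp add: subset_iff)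
    then show ?thesis by (simp only: 1 sum_distrib_right)
  qed
  \<comment> \<open>The constant parts of the incidence matrices of \<open>Y\<close> and \<open>Z\<close> are killed by the zero row and
    column sums of the deviation matrix of \<open>X\<close>.\<close>
  have "(\<Sum>i\<in>?I. \<Sum>j\<in>?I. ?D i j * (?A * (?E j k + ?\<beta>)) * (?A * (?F i k + ?\<gamma>)))
      = ?A\<^sup>2 * (\<Sum>i\<in>?I. \<Sum>j\<in>?I. ?D i j * ?E j k * ?F i k)" for k
  proof -
    have "(\<Sum>i\<in>?I. \<Sum>j\<in>?I. ?D i j * (?A * (?E j k + ?\<beta>)) * (?A * (?F i k + ?\<gamma>)))
      = (\<Sum>i\<in>?I. \<Sum>j\<in>?I. ?A\<^sup>2 * (?D i j * ?E j k * ?F i k) + ?D i j * (?A\<^sup>2 * ?\<beta> * (?F i k + ?\<gamma>))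
          + ?D i j * (?A\<^sup>2 * ?E j k * ?\<gamma>))"
      by (intro sum.cong refl) (simp only: power2_eq_square distrib_left distrib_right mult_ac add_ac)
    also have "\<dots> = (\<Sum>i\<in>?I. \<Sum>j\<in>?I. ?A\<^sup>2 * (?D i j * ?E j k * ?F i k))
        + (\<Sum>i\<in>?I. (\<Sum>j\<in>?I. ?D i j) * (?A\<^sup>2 * ?\<beta> * (?F i k + ?\<gamma>)))
        + (\<Sum>i\<in>?I. \<Sum>j\<in>?I. ?D i j * (?A\<^sup>2 * ?E j k * ?\<gamma>))"
      by (simp only: sum.distrib sum_distrib_right)
    also have "(\<Sum>i\<in>?I. (\<Sum>j\<in>?I. ?D i j) * (?A\<^sup>2 * ?\<beta> * (?F i k + ?\<gamma>))) = 0"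
      using deviation_sum_positions[OF X] by (intro sum.neutral) simp
    also have "(\<Sum>i\<in>?I. \<Sum>j\<in>?I. ?D i j * (?A\<^sup>2 * ?E j k * ?\<gamma>)) = (\<Sum>j\<in>?I. (\<Sum>i\<in>?I. ?D i j) * (?A\<^sup>2 * ?E j k * ?\<gamma>))"
      by (subst sum.swap) (simp only: sum_distrib_right)
    also have "\<dots> = 0"
      using deviation_sum_values[OF X] by (intro sum.neutral) simp
    finally show ?thesis by (simp only: sum_distrib_left add_0_right)
  qed
  note center = this
  have "(\<Sum>z\<in>Z. \<Sum>y\<in>Y. linear_part n X (z \<circ> inv' y))
      = (\<Sum>z\<in>Z. \<Sum>y\<in>Y. alt_density n X + (real n - 1) * (\<Sum>k\<in>?I. ?D (z k) (y k)))"
    by (intro sum.cong refl) (use pos Y in \<open>auto simp: linear_part_def\<close>)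
  also have "\<dots> = card Z * (card Y * alt_density n X) + (real n - 1) * (\<Sum>z\<in>Z. \<Sum>y\<in>Y. \<Sum>k\<in>?I. ?D (z k) (y k))"
    by (simp add: sum.distrib sum_distrib_left)
  also have "(\<Sum>z\<in>Z. \<Sum>y\<in>Y. \<Sum>k\<in>?I. ?D (z k) (y k)) = (\<Sum>k\<in>?I. \<Sum>z\<in>Z. \<Sum>y\<in>Y. ?D (z k) (y k))"
    by (subst sum.swap[of _ ?I Y], subst sum.swap[of _ ?I Z]) simp
  also have "\<dots> = (\<Sum>k\<in>?I. ?A\<^sup>2 * (\<Sum>i\<in>?I. \<Sum>j\<in>?I. ?D i j * ?E j k * ?F i k))"
    by (intro sum.cong refl) (simp only: inner center)
  also have "\<dots> = ?A\<^sup>2 * (\<Sum>i\<in>?I. \<Sum>j\<in>?I. \<Sum>k\<in>?I. ?D i j * ?E j k * ?F i k)"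
    unfolding sum_distrib_left[symmetric]
    by (subst sum.swap, subst (2) sum.swap) simp
  also have "real (card Z) = ?A * alt_density n Z" using A0 by (simp add: alt_density_eq)
  also have "real (card Y) = ?A * alt_density n Y" using A0 by (simp add: alt_density_eq)
  finally show ?thesis by algebra
qed

text \<open>
  The first error term is due to the rest, the three others to the negative parts of the three deviation
  matrices; the factor \<open>n - 1\<close> of the trace is absorbed by the two Hilbert--Schmidt norms
  \<open>\<surd>(\<alpha>/(n - 1))\<close> that accompany each negative part.
\<close>

lemma product_mixing_quantitative:
  fixes n M :: nat
  assumes n: "n \<ge> 10" and M: "1 \<le> M" "8 * M \<le> n"
    and sub: "X \<subseteq> Alt n" "Y \<subseteq> Alt n" "Z \<subseteq> Alt n" and ne: "X \<noteq> {}" "Y \<noteq> {}" "Z \<noteq> {}"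
  defines "\<alpha> \<equiv> alt_density n X" and "\<beta> \<equiv> alt_density n Y" and "\<gamma> \<equiv> alt_density n Z"
  defines "e \<equiv> \<lambda>a. sqrt (32 * a\<^sup>2 * ln (2 / a) / n)"
  shows "(\<Sum>z\<in>Z. \<Sum>y\<in>Y. indicator X (z \<circ> inv' y)) / (real (card (Alt n)))\<^sup>2
    \<ge> \<alpha> * \<beta> * \<gamma> - sqrt (\<alpha> * \<beta> * \<gamma>) / M
       - (e \<alpha> * sqrt (\<beta> * \<gamma>) + e \<beta> * sqrt (\<alpha> * \<gamma>) + e \<gamma> * sqrt (\<alpha> * \<beta>))"
proof -
  let ?A = "real (card (Alt n))" and ?I = "{1..n}"
  let ?R = "\<lambda>x. (indicator X x :: real) - linear_part n X x"
  have A0: "?A > 0" using card_Alt_pos by simp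
  have dens: "real (card X) = ?A * \<alpha>" "real (card Y) = ?A * \<beta>" "real (card Z) = ?A * \<gamma>"
    using A0 by (simp_all add: \<alpha>_def \<beta>_def \<gamma>_def alt_density_eq)
  have nn: "\<alpha> \<ge> 0" "\<beta> \<ge> 0" "\<gamma> \<ge> 0" by (simp_all add: \<alpha>_def \<beta>_def \<gamma>_def alt_density_eq)
  have rest: "\<bar>\<Sum>z\<in>Z. \<Sum>y\<in>Y. ?R (z \<circ> inv' y)\<bar> \<le> ?A\<^sup>2 * (sqrt (\<alpha> * \<beta> * \<gamma>) / M)"
  proof -
    let ?T = "\<lambda>z. \<Sum>y\<in>Alt n. ?R (z \<circ> inv' y) * indicator Y y"
    have ind: "(\<Sum>y\<in>Alt n. h y * indicator S y) = sum h S" if "S \<subseteq> Alt n" for S and h :: "_ \<Rightarrow> real"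
      using that finite_Alt[of n] by (simp add: indicator_def sum.If_cases Int_absorb1 if_distrib[of "(*) _"] cong: if_cong)
    have indsq: "(\<Sum>y\<in>Alt n. (indicator S y :: real)\<^sup>2) = card S" if "S \<subseteq> Alt n" for S
    proof -
      have "(\<Sum>y\<in>Alt n. (indicator S y :: real)\<^sup>2) = (\<Sum>y\<in>Alt n. 1 * indicator S y)"
        by (intro sum.cong) (auto simp: indicator_def)
      then show ?thesis unfolding ind[OF that] by simp
    qed
    have "(\<Sum>z\<in>Z. \<Sum>y\<in>Y. ?R (z \<circ> inv' y)) = (\<Sum>z\<in>Alt n. ?T z * indicator Z z)"
      by (simp only: ind[OF sub(3)] ind[OF sub(2)])
    then have "(\<Sum>z\<in>Z. \<Sum>y\<in>Y. ?R (z \<circ> inv' y))\<^sup>2 \<le> (\<Sum>z\<in>Alt n. (?T z)\<^sup>2) * (\<Sum>z\<in>Alt n. (indicator Z z)\<^sup>2)"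
      by (simp only: Cauchy_Schwarz_ineq_sum)
    then have "(real M)\<^sup>2 * (\<Sum>z\<in>Z. \<Sum>y\<in>Y. ?R (z \<circ> inv' y))\<^sup>2 \<le> ((real M)\<^sup>2 * (\<Sum>z\<in>Alt n. (?T z)\<^sup>2)) * real (card Z)"
      unfolding indsq[OF sub(3)] mult.assoc by (intro mult_left_mono) auto
    also have "\<dots> \<le> (?A * (\<Sum>y\<in>Alt n. (?R y)\<^sup>2) * (\<Sum>y\<in>Alt n. (indicator Y y)\<^sup>2)) * real (card Z)"
      by (intro mult_right_mono convolution_norm_bound[OF n M] linear_residual_marginal sub) (use n in auto)
    also have "\<dots> \<le> (?A * real (card X) * real (card Y)) * real (card Z)"
      unfolding indsq[OF sub(2)]
      by (intro mult_right_mono mult_left_mono linear_residual_bounds sub) (use n in auto)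
    also have "\<dots> = (?A\<^sup>2 * sqrt (\<alpha> * \<beta> * \<gamma>))\<^sup>2"
    proof -
      have "(sqrt (\<alpha> * \<beta> * \<gamma>))\<^sup>2 = \<alpha> * \<beta> * \<gamma>" using nn by simp
      then show ?thesis unfolding dens power_mult_distrib by algebra
    qed
    finally have "(real M * \<bar>\<Sum>z\<in>Z. \<Sum>y\<in>Y. ?R (z \<circ> inv' y)\<bar>)\<^sup>2 \<le> (?A\<^sup>2 * sqrt (\<alpha> * \<beta> * \<gamma>))\<^sup>2"
      by (simp add: power_mult_distrib)
    then have "real M * \<bar>\<Sum>z\<in>Z. \<Sum>y\<in>Y. ?R (z \<circ> inv' y)\<bar> \<le> ?A\<^sup>2 * sqrt (\<alpha> * \<beta> * \<gamma>)"
      by (rule power2_le_imp_le) (use nn in simp)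
    moreover have "s \<le> r / real M" if "real M * s \<le> r" for s r :: real
      using that M by (simp add: field_simps)
    ultimately show ?thesis by (simp only: times_divide_eq_right)
  qed
  let ?N = "\<lambda>m :: nat \<Rightarrow> nat \<Rightarrow> real. sqrt (\<Sum>i\<in>?I. \<Sum>j\<in>?I. (m i j)\<^sup>2)"
  let ?neg = "\<lambda>(m :: nat \<Rightarrow> nat \<Rightarrow> real) i j. max 0 (- m i j)"
  have N: "sqrt (real n - 1) * ?N (deviation n S) \<le> sqrt (alt_density n S)" if "S \<subseteq> Alt n" for S
    unfolding real_sqrt_mult[symmetric]
    by (rule real_sqrt_le_mono, rule linear_residual_bounds(2)[OF _ that]) (use n in simp)
  have Nneg: "?N (?neg (deviation n S)) \<le> e (alt_density n S)" if "S \<subseteq> Alt n" "S \<noteq> {}" for S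
    unfolding e_def by (rule real_sqrt_le_mono, rule negative_deviation_bound[OF _ that]) (use n in simp)
  have prod: "(real n - 1) * (p * ?N (deviation n S) * ?N (deviation n S')) \<le> e a * sqrt (alt_density n S * alt_density n S')"
    if "S \<subseteq> Alt n" "S' \<subseteq> Alt n" "p \<le> e a" "p \<ge> 0" for S S' p a
  proof -
    have "(real n - 1) * (p * ?N (deviation n S) * ?N (deviation n S'))
       = p * ((sqrt (real n - 1) * ?N (deviation n S)) * (sqrt (real n - 1) * ?N (deviation n S')))"
    proof -
      have s: "real n - 1 = sqrt (real n - 1) * sqrt (real n - 1)" using n by simp
      have "(s * s) * (p * x * y) = p * ((s * x) * (s * y))" for s x y :: real
        by (simp only: mult_ac)
      then show ?thesis by (subst s)
    qed
    also have "\<dots> \<le> e a * (sqrt (alt_density n S) * sqrt (alt_density n S'))"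
      using that n by (intro mult_mono N mult_nonneg_nonneg) (auto intro!: sum_nonneg simp: alt_density_eq)
    finally show ?thesis by (simp add: real_sqrt_mult)
  qed
  let ?T = "\<Sum>i\<in>?I. \<Sum>j\<in>?I. \<Sum>k\<in>?I. deviation n X i j * deviation n Y j k * deviation n Z i k"
  define D where "D S = ?N (deviation n S)" for S
  define Dn where "Dn S = ?N (?neg (deviation n S))" for S
  have Dn0: "Dn S \<ge> 0" for S unfolding Dn_def by (simp add: sum_nonneg)
  have "?T \<ge> - (Dn X * D Y * D Z + D X * Dn Y * D Z + D X * D Y * Dn Z)"
    unfolding D_def Dn_def by (rule trilinear_lower_bound) simp
  then have "(real n - 1) * ?T \<ge> (real n - 1) * - (Dn X * D Y * D Z + D X * Dn Y * D Z + D X * D Y * Dn Z)"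
    using n by (intro mult_left_mono) auto
  moreover have "(real n - 1) * (Dn X * D Y * D Z) \<le> e \<alpha> * sqrt (\<beta> * \<gamma>)"
    unfolding D_def \<alpha>_def \<beta>_def \<gamma>_def by (rule prod[OF sub(2,3) _ Dn0]) (unfold Dn_def, rule Nneg[OF sub(1) ne(1)])
  moreover have "(real n - 1) * (Dn Y * D X * D Z) \<le> e \<beta> * sqrt (\<alpha> * \<gamma>)"
    unfolding D_def \<alpha>_def \<beta>_def \<gamma>_def by (rule prod[OF sub(1,3) _ Dn0]) (unfold Dn_def, rule Nneg[OF sub(2) ne(2)])
  moreover have "(real n - 1) * (Dn Z * D X * D Y) \<le> e \<gamma> * sqrt (\<alpha> * \<beta>)"
    unfolding D_def \<alpha>_def \<beta>_def \<gamma>_def by (rule prod[OF sub(1,2) _ Dn0]) (unfold Dn_def, rule Nneg[OF sub(3) ne(3)])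
  moreover have "(real n - 1) * - (Dn X * D Y * D Z + D X * Dn Y * D Z + D X * D Y * Dn Z)
      = - ((real n - 1) * (Dn X * D Y * D Z) + (real n - 1) * (Dn Y * D X * D Z) + (real n - 1) * (Dn Z * D X * D Y))"
    by algebra
  ultimately have T: "(real n - 1) * ?T \<ge> - (e \<alpha> * sqrt (\<beta> * \<gamma>) + e \<beta> * sqrt (\<alpha> * \<gamma>) + e \<gamma> * sqrt (\<alpha> * \<beta>))"
    by linarith
  have "(\<Sum>z\<in>Z. \<Sum>y\<in>Y. indicator X (z \<circ> inv' y)) = (\<Sum>z\<in>Z. \<Sum>y\<in>Y. linear_part n X (z \<circ> inv' y)) + (\<Sum>z\<in>Z. \<Sum>y\<in>Y. ?R (z \<circ> inv' y))"
    by (simp add: sum.distrib[symmetric])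
  also have "\<dots> = ?A\<^sup>2 * (\<alpha> * \<beta> * \<gamma> + (real n - 1) * ?T) + (\<Sum>z\<in>Z. \<Sum>y\<in>Y. ?R (z \<circ> inv' y))"
    using linear_part_convolution[OF sub] by (simp add: \<alpha>_def \<beta>_def \<gamma>_def)
  also have "\<dots> \<ge> ?A\<^sup>2 * (\<alpha> * \<beta> * \<gamma> + (real n - 1) * ?T) - ?A\<^sup>2 * (sqrt (\<alpha> * \<beta> * \<gamma>) / M)"
    using rest by linarith
  finally have "?A\<^sup>2 * (\<alpha> * \<beta> * \<gamma> + (real n - 1) * ?T - sqrt (\<alpha> * \<beta> * \<gamma>) / M)
      \<le> (\<Sum>z\<in>Z. \<Sum>y\<in>Y. indicator X (z \<circ> inv' y))"
    by (simp only: right_diff_distrib)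
  then have "\<alpha> * \<beta> * \<gamma> + (real n - 1) * ?T - sqrt (\<alpha> * \<beta> * \<gamma>) / M
      \<le> (\<Sum>z\<in>Z. \<Sum>y\<in>Y. indicator X (z \<circ> inv' y)) / ?A\<^sup>2"
    using A0 by (simp add: pos_le_divide_eq mult.commute)
  then show ?thesis using T by linarith
qed

section \<open>Product mixing\<close>

lemma inner_prod_as_sum:
  assumes sub: "X \<subseteq> Alt n" "Y \<subseteq> Alt n" "Z \<subseteq> Alt n"
  shows "group_inner_prod (alt_group n) (group_convolution (alt_group n) (indicator X) (indicator Y)) (indicator Z)
    = complex_of_real ((\<Sum>z\<in>Z. \<Sum>y\<in>Y. indicator X (z \<circ> inv' y)) / (real (card (Alt n)))\<^sup>2)"
proof -
  let ?S = "{(x, y, z). x \<in> X \<and> y \<in> Y \<and> z \<in> Z \<and> x \<otimes>\<^bsub>alt_group n\<^esub> y = z}"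
  let ?P = "{(z, y). z \<in> Z \<and> y \<in> Y \<and> z \<circ> inv' y \<in> X}"
  have fin: "finite Y" "finite Z" using sub finite_subset_Alt by blast+
  have "card ?S = card ?P"
  proof (rule bij_betw_same_card, rule bij_betw_byWitness)
    show "\<forall>p\<in>?S. (\<lambda>(z, y). (z \<circ> inv' y, y, z)) ((\<lambda>(x, y, z). (z, y)) p) = p"
      using Alt_inv_o sub by (auto simp: alt_group_mult comp_assoc subset_iff)
    show "\<forall>p\<in>?P. (\<lambda>(x, y, z). (z, y)) ((\<lambda>(z, y). (z \<circ> inv' y, y, z)) p) = p" by auto
    show "(\<lambda>(x, y, z). (z, y)) ` ?S \<subseteq> ?P"
      using Alt_inv_o sub by (auto simp: alt_group_mult comp_assoc subset_iff)
    show "(\<lambda>(z, y). (z \<circ> inv' y, y, z)) ` ?P \<subseteq> ?S"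
      using Alt_inv_o sub by (auto simp: alt_group_mult comp_assoc subset_iff)
  qed
  moreover have "real (card ?P) = (\<Sum>z\<in>Z. \<Sum>y\<in>Y. indicator X (z \<circ> inv' y))"
  proof -
    have "(\<Sum>z\<in>Z. \<Sum>y\<in>Y. indicator X (z \<circ> inv' y) :: real) = (\<Sum>p\<in>Z \<times> Y. indicator ?P p)"
      unfolding sum.cartesian_product by (intro sum.cong) (auto simp: indicator_def)
    also have "\<dots> = real (card ((Z \<times> Y) \<inter> ?P))"
      using fin by (simp add: indicator_def of_bool_def sum.If_cases Int_def)
    also have "(Z \<times> Y) \<inter> ?P = ?P" by auto
    finally show ?thesis by (rule sym)
  qed
  ultimately have "(\<Sum>z\<in>Z. \<Sum>y\<in>Y. indicator X (z \<circ> inv' y)) = real (card ?S)" by (simp only:)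
  moreover have "complex_of_real (real k / (real (card (Alt n)))\<^sup>2) = of_nat k / (of_nat (order (alt_group n)))\<^sup>2" for k
    by (simp add: order_def)
  ultimately show ?thesis
    by (simp only: group_inner_prod_convolution_indicator[OF alt_group_is_group finite_Alt sub])
qed

text \<open>
  Since \<open>a \<ge> 1/n\<close>, the logarithm is at most \<open>2 ln n\<close>, and a hypothesis on \<open>b c\<close> of the order of
  \<open>ln n / n\<close> absorbs it.
\<close>

lemma deviation_error_small:
  fixes n :: nat and a b c \<epsilon> C :: real
  assumes \<epsilon>: "\<epsilon> > 0" and C: "C \<ge> 1024 / \<epsilon>\<^sup>2" "C \<ge> 1" and n: "n \<ge> 3"
    and a: "0 < a" "a \<le> 1" "1 / n \<le> a" and bc: "0 < b" "0 < c" "C * ln n / n \<le> b * c"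
  shows "sqrt (32 * a\<^sup>2 * ln (2 / a) / n) * sqrt (b * c) \<le> \<epsilon> / 4 * (a * b * c)"
proof -
  have n0: "real n > 0" using n by simp
  have "2 / a \<le> (real n)\<^sup>2"
  proof -
    have "2 / a \<le> 2 / (1 / n)" using a n0 by (intro divide_left_mono) auto
    also have "\<dots> \<le> real n * real n" using n by simp
    finally show ?thesis by (simp add: power2_eq_square)
  qed
  then have "ln (2 / a) \<le> ln ((real n)\<^sup>2)" using a n0 by (intro ln_mono) auto
  also have "\<dots> = 2 * ln n" using n0 by (simp add: ln_realpow)
  finally have L: "ln (2 / a) \<le> 2 * ln n" .
  have "32 * a\<^sup>2 * ln (2 / a) / n * (b * c) \<le> 32 * a\<^sup>2 * (2 * ln n) / n * (b * c)"
    using L a bc n0 by (intro mult_right_mono divide_right_mono mult_left_mono) auto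
  also have "\<dots> = (64 * (ln n / n)) * (a\<^sup>2 * (b * c))" by simp
  also have "\<dots> \<le> (\<epsilon>\<^sup>2 / 16 * (b * c)) * (a\<^sup>2 * (b * c))"
  proof (rule mult_right_mono)
    have "ln n \<ge> 0" using n by simp
    then have "1024 / \<epsilon>\<^sup>2 * (ln n / n) \<le> C * (ln n / n)" using C by (intro mult_right_mono) auto
    then have "1024 / \<epsilon>\<^sup>2 * (ln n / n) \<le> b * c" using bc(3) by simp
    then have "\<epsilon>\<^sup>2 / 16 * (1024 / \<epsilon>\<^sup>2 * (ln n / n)) \<le> \<epsilon>\<^sup>2 / 16 * (b * c)"
      by (intro mult_left_mono) auto
    then show "64 * (ln n / n) \<le> \<epsilon>\<^sup>2 / 16 * (b * c)" using \<epsilon> by simp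
  qed (use bc in auto)
  also have "\<dots> = (\<epsilon> / 4 * (a * b * c))\<^sup>2" by (simp add: power2_eq_square)
  finally have "sqrt (32 * a\<^sup>2 * ln (2 / a) / n * (b * c)) \<le> \<epsilon> / 4 * (a * b * c)"
    using \<epsilon> a bc by (intro real_le_lsqrt) auto
  then show ?thesis by (simp only: real_sqrt_mult)
qed

lemma spectral_error_small:
  fixes n :: nat and a b c \<epsilon> C :: real
  assumes \<epsilon>: "\<epsilon> > 0" and C: "C \<ge> 64 / \<epsilon>" and n: "n \<ge> 8"
    and p: "0 < a" "0 < b" "0 < c" "C\<^sup>2 / (real n)\<^sup>2 \<le> a * b * c"
  shows "sqrt (a * b * c) / real (n div 8) \<le> \<epsilon> / 4 * (a * b * c)"
proof -
  let ?M = "real (n div 8)"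
  have "n \<le> 16 * (n div 8)" using n by presburger
  then have "real n \<le> real (16 * (n div 8))" by (simp only: of_nat_le_iff)
  then have M: "?M \<ge> real n / 16" "?M > 0" using n by simp_all
  define r where "r = sqrt (a * b * c)"
  have rr: "r * r = a * b * c" "r > 0" using p by (simp_all add: r_def)
  have C0: "C > 0" using C \<epsilon> by (smt (verit) divide_pos_pos)
  have "sqrt (C\<^sup>2 / (real n)\<^sup>2) \<le> r" unfolding r_def using p(4) by (rule real_sqrt_le_mono)
  then have "C / n \<le> r" using C0 by (simp add: real_sqrt_divide)
  then have "C \<le> r * n" using n by (simp add: field_simps)
  then have "64 / \<epsilon> \<le> r * n" using C by linarith
  then have "64 \<le> \<epsilon> * r * n" using \<epsilon> by (simp add: field_simps)
  also have "\<dots> \<le> \<epsilon> * r * (16 * ?M)" using M \<epsilon> rr by (intro mult_left_mono) auto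
  finally have "1 \<le> \<epsilon> / 4 * r * ?M" by simp
  then have "r * 1 \<le> r * (\<epsilon> / 4 * r * ?M)" using rr by (intro mult_left_mono) auto
  then have "r / ?M \<le> \<epsilon> / 4 * (r * r)" using M by (simp add: field_simps)
  then show ?thesis by (simp only: rr(1)) (simp only: r_def)
qed

theorem theorem1p2:
  fixes \<epsilon> :: real
  assumes "\<epsilon> > 0"
  shows "\<exists>C :: real. C > 0 \<and> (\<exists>n0 :: nat. \<forall>n \<ge> n0. \<forall>X Y Z.
    X \<subseteq> carrier (alt_group n) \<longrightarrow> Y \<subseteq> carrier (alt_group n) \<longrightarrow> Z \<subseteq> carrier (alt_group n) \<longrightarrow>
    (let \<alpha> = set_density (alt_group n) X;
         \<beta> = set_density (alt_group n) Y;
         \<gamma> = set_density (alt_group n) Z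
     in Min {\<alpha> * \<beta>, \<alpha> * \<gamma>, \<beta> * \<gamma>} \<ge> C * (ln (real n)) ^ 7 / real n \<longrightarrow>
        group_inner_prod (alt_group n) (group_convolution (alt_group n) (indicator X) (indicator Y)) (indicator Z)
          \<ge> complex_of_real ((1 - \<epsilon>) * \<alpha> * \<beta> * \<gamma>)))"
proof -
  \<comment> \<open>The second summand absorbs the error of the rest, the third the errors of the negative parts;
    each of the four errors takes a quarter of \<open>\<epsilon>\<close>.\<close>
  define C where "C = 1 + 64 / \<epsilon> + 1024 / \<epsilon>\<^sup>2"
  have C: "C \<ge> 64 / \<epsilon>" "C \<ge> 1024 / \<epsilon>\<^sup>2" "C \<ge> 1" "C > 0"
    using assms by (auto simp: C_def add_pos_nonneg)
  have main: "group_inner_prod (alt_group n) (group_convolution (alt_group n) (indicator X) (indicator Y)) (indicator Z)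
      \<ge> complex_of_real ((1 - \<epsilon>) * a * b * c)"
    if n: "n \<ge> 10" and sub: "X \<subseteq> Alt n" "Y \<subseteq> Alt n" "Z \<subseteq> Alt n"
      and abc: "a = alt_density n X" "b = alt_density n Y" "c = alt_density n Z"
      and big: "Min {a * b, a * c, b * c} \<ge> C * (ln n) ^ 7 / n" for n :: nat and X Y Z and a b c :: real
  proof -
    let ?A = "real (card (Alt n))"
    have n0: "real n > 0" using n by simp
    have "exp 1 \<le> real n" using exp_le n by linarith
    then have ln1: "1 \<le> ln n" using n0 by (simp add: ln_ge_iff)
    have "ln n ^ 1 \<le> ln n ^ 7" using ln1 by (intro power_increasing) auto
    then have "C * ln n / n \<le> C * (ln n) ^ 7 / n"
      using C n0 by (intro divide_right_mono mult_left_mono) auto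
    then have ln_bounds: "C * ln n / n \<le> a * b" "C * ln n / n \<le> a * c" "C * ln n / n \<le> b * c"
      using big by (auto intro: order_trans)
    have "C * 1 / n \<le> C * ln n / n" using C n0 ln1 by (intro divide_right_mono mult_left_mono) auto
    then have prods: "C / n \<le> a * b" "C / n \<le> a * c" "C / n \<le> b * c" using ln_bounds by auto
    have Cn: "C / n > 0" using C n0 by simp
    have le1: "0 \<le> alt_density n S" "alt_density n S \<le> 1" if "S \<subseteq> Alt n" for S
      using card_mono[OF finite_Alt that] card_Alt_pos[of n] by (simp_all add: alt_density_eq)
    have r: "0 \<le> a" "a \<le> 1" "0 \<le> b" "b \<le> 1" "0 \<le> c" "c \<le> 1"
      using le1 sub by (simp_all add: abc)
    have ab: "a * b \<le> a" "a * b \<le> b" "a * c \<le> c"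
      using mult_left_le[of b a] mult_left_le_one_le[of b a] mult_left_le_one_le[of c a] r by simp_all
    have ge: "C / n \<le> a" "C / n \<le> b" "C / n \<le> c" using prods ab by linarith+
    have pos: "0 < a" "0 < b" "0 < c" using ge Cn by linarith+
    have "1 / n \<le> C / n" using C n0 by (intro divide_right_mono) auto
    then have inv_n: "1 / n \<le> a" "1 / n \<le> b" "1 / n \<le> c" using ge by linarith+
    have ne: "X \<noteq> {}" "Y \<noteq> {}" "Z \<noteq> {}" using pos by (auto simp: abc alt_density_eq)
    have "C / n * (C / n) \<le> a * b * c" using prods(1) ge(3) Cn r by (intro mult_mono) auto
    then have abc_big: "C\<^sup>2 / (real n)\<^sup>2 \<le> a * b * c" by (simp add: power2_eq_square)
    have rest: "sqrt (a * b * c) / real (n div 8) \<le> \<epsilon> / 4 * (a * b * c)"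
      by (rule spectral_error_small[OF assms C(1) _ pos abc_big]) (use n in simp)
    have devX: "sqrt (32 * a\<^sup>2 * ln (2 / a) / n) * sqrt (b * c) \<le> \<epsilon> / 4 * (a * b * c)"
      by (rule deviation_error_small[OF assms C(2) C(3) _ pos(1) r(2) inv_n(1) pos(2,3) ln_bounds(3)]) (use n in simp)
    have devY: "sqrt (32 * b\<^sup>2 * ln (2 / b) / n) * sqrt (a * c) \<le> \<epsilon> / 4 * (b * a * c)"
      by (rule deviation_error_small[OF assms C(2) C(3) _ pos(2) r(4) inv_n(2) pos(1,3) ln_bounds(2)]) (use n in simp)
    have devZ: "sqrt (32 * c\<^sup>2 * ln (2 / c) / n) * sqrt (a * b) \<le> \<epsilon> / 4 * (c * a * b)"
      by (rule deviation_error_small[OF assms C(2) C(3) _ pos(3) r(6) inv_n(3) pos(1,2) ln_bounds(1)]) (use n in simp)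
    have M: "1 \<le> n div 8" "8 * (n div 8) \<le> n" using n by auto
    have "(1 - \<epsilon>) * a * b * c = a * b * c - \<epsilon> / 4 * (a * b * c)
        - (\<epsilon> / 4 * (a * b * c) + \<epsilon> / 4 * (b * a * c) + \<epsilon> / 4 * (c * a * b))"
      by (simp add: field_simps)
    also have "\<dots> \<le> (\<Sum>z\<in>Z. \<Sum>y\<in>Y. indicator X (z \<circ> inv' y)) / ?A\<^sup>2"
      using product_mixing_quantitative[OF n M sub ne] rest devX devY devZ unfolding abc by linarith
    finally show ?thesis
      unfolding inner_prod_as_sum[OF sub] by (simp add: less_eq_complex_def)
  qed
  show ?thesis
    using C(4) main unfolding Let_def by (intro exI[of _ C] conjI exI[of _ 10]) blast+
qed

end
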